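(* Let $\mu$ be a Federer measure on a Besicovitch metric space $X$, let $\mathcal{L}$ be an affine subspace of $\mathbb{R}^n$, and let $\mathbf{f}:X\to\mathcal{L}$ be a continuous map such that $(\mathbf{f},\mu)$ is good and nonplanar in $\mathcal{L}$. Let $\lambda_{\mathcal{L}}$ be the Haar (Lebesgue) measure on $\mathcal{L}$. Then the following are equivalent: (1) there exists $x\in\operatorname{supp}(\mu)$ such that $\mathbf{f}(x)$ is not singular; (2) there exists $\mathbf{y}\in\mathcal{L}$ which is not singular; (3) for $\lambda_{\mathcal{L}}$-almost every $\mathbf{y}\in\mathcal{L}$, $\mathbf{y}$ is not singular; (4) for $\mu$-almost every $x\in X$, $\mathbf{f}(x)$ is not singular.
   Context: $\Vert\cdot\Vert$ is the max norm. A vector $\mathbf{x}\in\mathbb{R}^n$ is singular if for every $c>0$ and all sufficiently large $Q>0$ there exist $\mathbf{0}\neq\mathbf{q}\in\mathbb{Z}^n$, $q_0\in\mathbb{Z}$ with $|\mathbf{q}\cdot\mathbf{x}+q_0|<c/Q^n$ and $\Vert\mathbf{q}\Vert\le Q$. A metric space $X$ is Besicovitch if there is a constant $N_X$ such that for any bounded $A\subset X$ and any family $\mathcal{B}$ of nonempty open balls such that every $x\in A$ is the center of some ball in $\mathcal{B}$, there is a finite or countable subfamily $\{B_i\}\subset\mathcal{B}$ with $1_A\le\sum_i 1_{B_i}\le N_X$. A Radon measure $\mu$ on $X$ is $D$-Federer on an open $U$ with $\mu(U)>0$ if $\sup\{\mu(B(x,3r))/\mu(B(x,r)) : x\in\operatorname{supp}\mu,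 r>0, B(x,3r)\subset U\}<D$; $\mu$ is Federer if for $\mu$-a.e. $x$ there are a neighborhood $U$ of $x$ and $D>0$ with $\mu$ $D$-Federer on $U$. For $f:X\to\mathbb{R}$ and $A$ with $\mu(A)>0$ let $\Vert f\Vert_{\mu,A}=\sup_{x\in A\cap\operatorname{supp}\mu}|f(x)|$. $f$ is $(C,\alpha)$-good on $U$ with respect to $\mu$ if for every open ball $B\subset U$ centered in $\operatorname{supp}\mu$ and every $\varepsilon>0$, $\mu(\{x\in B:|f(x)|<\varepsilon\})\le C(\varepsilon/\Vert f\Vert_{\mu,B})^\alpha\mu(B)$. For $\mathbf{f}=(f_1,\dots,f_n):X\to\mathbb{R}^n$, $(\mathbf{f},\mu)$ is $(C,\alpha)$-good at $x$ if there is a neighborhood $U$ of $x$ on which every linear combination of $1,f_1,\dots,f_n$ is $(C,\alpha)$-good with respect to $\mu$; $(\mathbf{f},\mu)$ is good if it is $(C,\alpha)$-good (for some $C,\alpha$) at $\mu$-a.e. point. $(\mathbf{f},\mu)$ is nonplanar in $\mathcal{L}$ if for every ball $B$ with $\mu(B)>0$, $\mathcal{L}$ is the intersection of all affine subspaces containing $\mathbf{f}(B\cap\operatorname{supp}\mu)$. *)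

theory Defs
  imports "HOL-Analysis.Analysis"
begin

definition singular_vector :: "real ^ 'n \<Rightarrow> bool" where
  "singular_vector x \<longleftrightarrow>
    (\<forall>c>0. \<forall>\<^sub>F Q in at_top. \<exists>(q :: int ^ 'n) (q0 :: int). q \<noteq> 0 \<and>
        \<bar>(\<chi> i. real_of_int (q $ i)) \<bullet> x + real_of_int q0\<bar> < c / Q ^ CARD('n) \<and>
        infnorm (\<chi> i. real_of_int (q $ i)) \<le> Q)"

definition besicovitch_space :: "'a::metric_space itself \<Rightarrow> bool" where
  "besicovitch_space _ \<longleftrightarrow>
    (\<exists>N :: nat. \<forall>(A :: 'a set) \<B>.
        bounded A \<and> (\<forall>B\<in>\<B>. \<exists>x r. 0 < r \<and> B = ball x r) \<and>
        (\<forall>x\<in>A. \<exists>r>0. ball x r \<in> \<B>) \<longrightarrow>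
        (\<exists>\<C>\<subseteq>\<B>. countable \<C> \<and>
          (\<forall>x. (indicator A x :: ennreal) \<le> (\<Sum>\<^sub>\<infinity>B\<in>\<C>. indicator B x) \<and>
               (\<Sum>\<^sub>\<infinity>B\<in>\<C>. indicator B x :: ennreal) \<le> of_nat N)))"

definition radon_measure :: "'a::metric_space measure \<Rightarrow> bool" where
  "radon_measure M \<longleftrightarrow>
    sets M = sets borel \<and>
    (\<forall>x. \<exists>U. open U \<and> x \<in> U \<and> emeasure M U < \<infinity>) \<and>
    (\<forall>A\<in>sets M. emeasure M A = (SUP K\<in>{K. compact K \<and> K \<subseteq> A}. emeasure M K))"

definition measure_support :: "'a::topological_space measure \<Rightarrow> 'a set" where
  "measure_support M = {x. \<forall>U. open U \<and> x \<in> U \<longrightarrow> emeasure M U > 0}"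

definition federer_on :: "real \<Rightarrow> 'a::metric_space measure \<Rightarrow> 'a set \<Rightarrow> bool" where
  "federer_on D M U \<longleftrightarrow>
    open U \<and> emeasure M U > 0 \<and>
    Sup {emeasure M (ball x (3 * r)) / emeasure M (ball x r) | x r.
           x \<in> measure_support M \<and> 0 < r \<and> ball x (3 * r) \<subseteq> U} < ennreal D"

definition federer_measure :: "'a::metric_space measure \<Rightarrow> bool" where
  "federer_measure M \<longleftrightarrow>
    radon_measure M \<and> (AE x in M. \<exists>U D. x \<in> U \<and> 0 < D \<and> federer_on D M U)"

definition sup_norm_on :: "'a::topological_space measure \<Rightarrow> 'a set \<Rightarrow> ('a \<Rightarrow> real) \<Rightarrow> ennreal" where
  "sup_norm_on M A g = (SUP x\<in>A \<inter> measure_support M. ennreal \<bar>g x\<bar>)"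

text \<open>Only used with a positive exponent, where infinity to the power \<open>a\<close> is infinity.\<close>

definition ennreal_powr :: "ennreal \<Rightarrow> real \<Rightarrow> ennreal" where
  "ennreal_powr t a = (if t = \<infinity> then \<infinity> else ennreal (enn2real t powr a))"

text \<open>The quotient is formed in \<^typ>\<open>ennreal\<close>, where \<open>\<epsilon> / 0 = \<infinity>\<close> for \<open>\<epsilon> > 0\<close>:
  a function vanishing on \<open>B \<inter> supp M\<close> satisfies the inequality for \<open>B\<close> trivially.\<close>

definition good_function_on ::
    "real \<Rightarrow> real \<Rightarrow> 'a::metric_space measure \<Rightarrow> 'a set \<Rightarrow> ('a \<Rightarrow> real) \<Rightarrow> bool" where
  "good_function_on C \<alpha> M U g \<longleftrightarrow>
    (\<forall>x r \<epsilon>. x \<in> measure_support M \<and> 0 < r \<and> ball x r \<subseteq> U \<and> 0 < \<epsilon> \<longrightarrow>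
       emeasure M {y \<in> ball x r. \<bar>g y\<bar> < \<epsilon>} \<le>
         ennreal C * ennreal_powr (ennreal \<epsilon> / sup_norm_on M (ball x r) g) \<alpha> * emeasure M (ball x r))"

definition good_pair_at ::
    "real \<Rightarrow> real \<Rightarrow> ('a::metric_space \<Rightarrow> real ^ 'n) \<Rightarrow> 'a measure \<Rightarrow> 'a \<Rightarrow> bool" where
  "good_pair_at C \<alpha> f M x \<longleftrightarrow>
    (\<exists>U. open U \<and> x \<in> U \<and>
      (\<forall>(c0 :: real) (c :: real ^ 'n).
         good_function_on C \<alpha> M U (\<lambda>y. c0 + (\<Sum>i\<in>UNIV. c $ i * f y $ i))))"

definition good_pair :: "('a::metric_space \<Rightarrow> real ^ 'n) \<Rightarrow> 'a measure \<Rightarrow> bool" where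
  "good_pair f M \<longleftrightarrow> (AE x in M. \<exists>C>0. \<exists>\<alpha>>0. good_pair_at C \<alpha> f M x)"

definition nonplanar_in ::
    "('a::metric_space \<Rightarrow> real ^ 'n) \<Rightarrow> 'a measure \<Rightarrow> (real ^ 'n) set \<Rightarrow> bool" where
  "nonplanar_in f M L \<longleftrightarrow>
    (\<forall>x r. emeasure M (ball x r) > 0 \<longrightarrow>
       L = affine hull (f ` (ball x r \<inter> measure_support M)))"

definition affine_frame :: "'v::euclidean_space set \<Rightarrow> 'v \<Rightarrow> 'v set \<Rightarrow> bool" where
  "affine_frame L a E \<longleftrightarrow>
    a \<in> L \<and> pairwise orthogonal E \<and> (\<forall>e\<in>E. norm e = 1) \<and> span E = (\<lambda>y. y - a) ` L"

text \<open>Lebesgue measure on a nonempty affine subspace \<open>L\<close>, as a Borel measure on the ambient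
  space concentrated on \<open>L\<close>: the product Lebesgue measure transported by orthonormal coordinates
  of \<open>L\<close> (compare \<open>lborel_eq\<close>, the case \<open>L = UNIV\<close>). By invariance of Lebesgue measure under
  isometries it does not depend on the chosen origin and frame; on a single point it is the
  Dirac measure.\<close>

definition affine_lebesgue :: "'v::euclidean_space set \<Rightarrow> 'v measure" where
  "affine_lebesgue L =
    (let (a, E) = (SOME (a, E). affine_frame L a E)
     in distr (\<Pi>\<^sub>M e\<in>E. lborel) borel (\<lambda>t. a + (\<Sum>e\<in>E. t e *\<^sub>R e)))"

lemma affine_frame_exists:
  assumes "affine L" "L \<noteq> {}"
  shows "\<exists>a E. affine_frame L a E"
proof -
  obtain a where a: "a \<in> L" using assms(2) by blast
  have "subspace ((\<lambda>y. y - a) ` L)"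
    using affine_diffs_subspace_subtract[OF assms(1) a] by (simp add: image_def)
  then obtain E where "pairwise orthogonal E" "\<And>e. e \<in> E \<Longrightarrow> norm e = 1"
      "span E = (\<lambda>y. y - a) ` L"
    using orthonormal_basis_subspace by metis
  with a show ?thesis unfolding affine_frame_def by blast
qed

end

theory Submission
  imports Defs
begin

text \<open>
  By the Dani correspondence, \<open>y\<close> is singular iff the shortest nonzero vectors of the lattices
  \<open>flow Q y\<close> applied to \<open>\<int>\<^bsup>n+1\<^esup>\<close> tend to \<open>0\<close> as \<open>Q \<rightarrow> \<infinity>\<close>. If \<open>y \<in> L\<close> is not singular, then along a
  sequence of \<open>Q\<close> these lattices have no short vectors, so by Minkowski's theorem the covolumes
  of all rational subspaces are bounded below. The coordinates of the corresponding exterior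
  products are affine functions of \<open>y\<close>, so nonplanarity bounds their suprema over any ball of a
  measure in \<open>L\<close> from below, and quantitative nondivergence (Kleinbock--Margulis) shows that the
  points of the ball with a vector shorter than \<open>\<epsilon>\<close> have measure \<open>O(\<epsilon>\<^bsup>\<alpha>\<^esup>)\<close>, uniformly along the
  sequence. Hence almost no point is singular. This applies both to \<open>\<mu>\<close> and to Lebesgue measure on
  \<open>L\<close>. The covering argument uses Vitali's lemma and the doubling property.\<close>

section \<open>Covering by balls\<close>

text \<open>Singularity asks for short vectors at all large \<open>Q\<close>, so its failure at one
  \<open>y\<close> yields only a sequence \<open>Q k\<close>. That suffices: a singular point has
  ever shorter vectors along every sequence tending to infinity, so the sequence of \<open>y\<close>
  tests all points at once. The estimates must then be independent of \<open>k\<close>. This is why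
  nonplanarity enters through an affine combination: \<open>y\<close> is such a combination of
  finitely many points \<open>f z\<close>, with coefficients that do not involve the affine function
  to be bounded, so one constant serves all \<open>Q\<close> and all rational subspaces. For fixed
  \<epsilon> the points that are short for all large \<open>k\<close> lie in a liminf of sets with
  one common measure bound, so nothing is summed over \<open>k\<close>. Rational subspaces are
  measured by spanning integral vectors with least Plucker coordinates, without recourse to lattice
  bases. Null sets are glued by inner regularity rather than by a countable base, and disjoint balls
  are countable because they lie in a set of finite measure.\<close>

lemma vitali_disjoint_balls:
  fixes a :: "'i \<Rightarrow> 'a::metric_space" and r :: "'i \<Rightarrow> real"
  assumes r: "\<And>i. i \<in> K \<Longrightarrow> 0 < r i \<and> r i \<le> B"
  obtains C where "C \<subseteq> K" "disjoint_family_on (\<lambda>i. ball (a i) (r i)) C"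
    "\<And>i. i \<in> K \<Longrightarrow> \<exists>j\<in>C. a i \<in> ball (a j) (3 * r j)"
proof -
  define meets where "meets i j \<longleftrightarrow> ball (a i) (r i) \<inter> ball (a j) (r j) \<noteq> {}" for i j
  \<comment> \<open>The last clause is carried along so that a maximal family can only miss balls
    disjoint from all of it. Among those, one with radius above half the supremum could be added
    without breaking the clause.\<close>
  define \<Omega> where "\<Omega> = {C. C \<subseteq> K \<and> disjoint_family_on (\<lambda>i. ball (a i) (r i)) C \<and>
    (\<forall>i\<in>K. (\<exists>j\<in>C. meets i j) \<longrightarrow> (\<exists>j\<in>C. meets i j \<and> r i \<le> 2 * r j))}"
  have "\<Union>\<C> \<in> \<Omega>" if "\<C> \<in> chains \<Omega>" for \<C>
  proof -
    have sub: "\<C> \<subseteq> \<Omega>" and ch: "\<And>X Y. X \<in> \<C> \<Longrightarrow> Y \<in> \<C> \<Longrightarrow> X \<subseteq> Y \<or> Y \<subseteq> X"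
      using that by (auto simp: chains_def chain_subset_def)
    have "disjoint_family_on (\<lambda>i. ball (a i) (r i)) (\<Union>\<C>)"
      unfolding disjoint_family_on_def
    proof (intro ballI impI)
      fix i j assume "i \<in> \<Union>\<C>" "j \<in> \<Union>\<C>" and ne: "i \<noteq> j"
      then obtain X where "X \<in> \<C>" "i \<in> X" "j \<in> X" using ch by blast
      then show "ball (a i) (r i) \<inter> ball (a j) (r j) = {}"
        using sub ne by (auto simp: \<Omega>_def disjoint_family_on_def subset_iff)
    qed
    moreover have "\<exists>j\<in>\<Union>\<C>. meets i j \<and> r i \<le> 2 * r j" if "i \<in> K" "\<exists>j\<in>\<Union>\<C>. meets i j" for i
    proof -
      from that obtain X where X: "X \<in> \<C>" "\<exists>j\<in>X. meets i j" by blast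
      then have "\<exists>j\<in>X. meets i j \<and> r i \<le> 2 * r j" using sub that(1) by (auto simp: \<Omega>_def)
      then show ?thesis using X by blast
    qed
    moreover have "\<Union>\<C> \<subseteq> K" using sub by (auto simp: \<Omega>_def)
    ultimately show ?thesis by (auto simp: \<Omega>_def)
  qed
  then obtain C where C: "C \<in> \<Omega>" and mx: "\<And>X. X \<in> \<Omega> \<Longrightarrow> C \<subseteq> X \<Longrightarrow> X = C"
    using Zorn_Lemma[of \<Omega>] by blast
  have CK: "C \<subseteq> K" and dj: "disjoint_family_on (\<lambda>i. ball (a i) (r i)) C"
    and cov: "\<And>i. i \<in> K \<Longrightarrow> \<exists>j\<in>C. meets i j \<Longrightarrow> \<exists>j\<in>C. meets i j \<and> r i \<le> 2 * r j"
    using C by (auto simp: \<Omega>_def)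
  define K' where "K' = {i\<in>K. \<forall>j\<in>C. \<not> meets i j}"
  have "K' = {}"
  proof (rule ccontr)
    assume ne: "K' \<noteq> {}"
    have bdd: "bdd_above (r ` K')" using r by (auto simp: K'_def bdd_above_def)
    obtain k where k: "k \<in> K'" using ne by blast
    have "0 < r k" using k r by (auto simp: K'_def)
    also have "r k \<le> Sup (r ` K')" using bdd k by (intro cSup_upper) auto
    finally have "Sup (r ` K') / 2 < Sup (r ` K')" by simp
    then obtain i1 where i1: "i1 \<in> K'" "Sup (r ` K') / 2 < r i1"
      using less_cSup_iff[of "r ` K'" "Sup (r ` K') / 2"] ne bdd by blast
    have big: "r i \<le> 2 * r i1" if "i \<in> K'" for i
    proof -
      have "r i \<le> Sup (r ` K')" using bdd that by (intro cSup_upper) auto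
      then show ?thesis using i1 by simp
    qed
    have sym: "meets i j \<longleftrightarrow> meets j i" for i j by (auto simp: meets_def)
    have "insert i1 C \<in> \<Omega>"
      unfolding \<Omega>_def
    proof (intro CollectI conjI ballI impI)
      show "insert i1 C \<subseteq> K" using CK i1 by (auto simp: K'_def)
      show "disjoint_family_on (\<lambda>i. ball (a i) (r i)) (insert i1 C)"
        using dj i1(1) by (auto simp: disjoint_family_on_def K'_def meets_def)
      fix i assume "i \<in> K" "\<exists>j\<in>insert i1 C. meets i j"
      then show "\<exists>j\<in>insert i1 C. meets i j \<and> r i \<le> 2 * r j"
        using cov[of i] big[of i] by (auto simp: K'_def)
    qed
    then have "i1 \<in> C" using mx[of "insert i1 C"] by blast
    moreover have "meets i1 i1" using r[of i1] i1 by (auto simp: meets_def K'_def)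
    ultimately show False using i1 by (auto simp: K'_def)
  qed
  show thesis
  proof (rule that[OF CK dj])
    fix i assume i: "i \<in> K"
    then obtain j where j: "j \<in> C" "meets i j" "r i \<le> 2 * r j"
      using cov[of i] \<open>K' = {}\<close> by (auto simp: K'_def)
    then obtain z where "dist (a i) z < r i" "dist (a j) z < r j" by (auto simp: meets_def)
    \<comment> \<open>Only the centre of ball \<open>i\<close> has to be covered, so the factor is 2
      + 1 instead of the usual 5.\<close>
    then have "dist (a j) (a i) < 3 * r j"
      using dist_triangle[of "a j" "a i" z] j(3) by (simp add: dist_commute)
    then show "\<exists>j\<in>C. a i \<in> ball (a j) (3 * r j)" using j by auto
  qed
qed

text \<open>At most \<open>n\<close> disjoint subsets of \<open>U\<close> can each have more than a
  fraction 1/n of its measure. This makes the Vitali subfamily countable, hence its union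
  measurable.\<close>

lemma countable_disjoint_positive_measure:
  assumes dj: "disjoint_family_on A I" and A: "\<And>i. i \<in> I \<Longrightarrow> A i \<in> sets M \<and> A i \<subseteq> U \<and> 0 < emeasure M (A i)"
    and U: "U \<in> sets M" "emeasure M U < \<infinity>"
  shows "countable I"
proof -
  define J where "J n = {i\<in>I. emeasure M U < of_nat n * emeasure M (A i)}" for n :: nat
  have "finite (J n)" for n
  proof (rule ccontr)
    assume "infinite (J n)"
    then obtain F where F: "F \<subseteq> J n" "finite F" "card F = Suc n"
      using infinite_arbitrarily_large by blast
    have FI: "F \<subseteq> I" using F by (auto simp: J_def)
    have lt: "emeasure M U < of_nat n * emeasure M (A i)" if "i \<in> F" for i
      using F that by (auto simp: J_def)
    have "n \<noteq> 0" using lt F(3) by (cases "F = {}") auto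
    have "of_nat (Suc n) * emeasure M U = (\<Sum>i\<in>F. emeasure M U)" using F by simp
    also have "\<dots> \<le> (\<Sum>i\<in>F. of_nat n * emeasure M (A i))"
      using lt by (intro sum_mono) (auto intro: less_imp_le)
    also have "\<dots> = of_nat n * (\<Sum>i\<in>F. emeasure M (A i))" by (simp add: sum_distrib_left)
    also have "(\<Sum>i\<in>F. emeasure M (A i)) = emeasure M (\<Union>i\<in>F. A i)"
      using A FI F(2) disjoint_family_on_mono[OF FI dj]
      by (intro sum_emeasure) auto
    also have "emeasure M (\<Union>i\<in>F. A i) \<le> emeasure M U" using A FI U by (intro emeasure_mono) auto
    finally have le: "of_nat (Suc n) * emeasure M U \<le> of_nat n * emeasure M U"
      by (simp add: mult_left_mono)
    obtain i where "i \<in> F" using F by fastforce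
    then have "0 < emeasure M U" using A[of i] FI U emeasure_mono[of "A i" U M] by fastforce
    then obtain u where u: "emeasure M U = ennreal u" "0 < u"
      using U by (cases "emeasure M U") auto
    show False using le u(2) unfolding u(1)
      by (simp add: ennreal_of_nat_eq_real_of_nat ennreal_mult[symmetric] del: of_nat_Suc)
  qed
  moreover have "I = (\<Union>n. J n)"
  proof -
    have "\<exists>n. emeasure M U < of_nat n * emeasure M (A i)" if "i \<in> I" for i
    proof -
      have "0 < emeasure M (A i)" "emeasure M (A i) \<le> emeasure M U"
        using A[OF that] U by (auto intro: emeasure_mono)
      then obtain u b where ub: "emeasure M U = ennreal u" "emeasure M (A i) = ennreal b" "0 < b" "0 \<le> u"
        using U by (cases "emeasure M U"; cases "emeasure M (A i)") (auto simp: top_unique)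
      obtain n where "u < real n * b" using reals_Archimedean3[OF ub(3)] by blast
      then show ?thesis unfolding ub(1,2)
        using ub by (auto simp: ennreal_of_nat_eq_real_of_nat ennreal_mult[symmetric] ennreal_less_iff intro!: exI[of _ n])
    qed
    then show ?thesis by (auto simp: J_def)
  qed
  ultimately show ?thesis by (metis countable_UN countable_finite countableI_type)
qed

lemma emeasure_countable_UN_le:
  assumes I: "countable I" and X: "\<And>i. i \<in> I \<Longrightarrow> X i \<in> sets M"
    and fin: "\<And>F. finite F \<Longrightarrow> F \<subseteq> I \<Longrightarrow> (\<Sum>i\<in>F. emeasure M (X i)) \<le> b"
  shows "emeasure M (\<Union>i\<in>I. X i) \<le> b"
proof (cases "I = {}")
  case False
  define G where "G n = from_nat_into I ` {..<n}" for n :: nat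
  have G: "finite (G n)" "G n \<subseteq> I" for n using from_nat_into[OF False] by (auto simp: G_def)
  have un: "(\<Union>n. \<Union>i\<in>G n. X i) = (\<Union>i\<in>I. X i)"
  proof -
    have "(\<Union>n. G n) = I"
    proof
      show "I \<subseteq> (\<Union>n. G n)"
      proof
        fix i assume "i \<in> I"
        then obtain n where "from_nat_into I n = i" using from_nat_into_surj[OF I] by blast
        then show "i \<in> (\<Union>n. G n)" unfolding G_def by (auto intro!: exI[of _ "Suc n"])
      qed
    qed (use G in auto)
    then show ?thesis by blast
  qed
  have "(\<lambda>n. emeasure M (\<Union>i\<in>G n. X i)) \<longlonglongrightarrow> emeasure M (\<Union>n. \<Union>i\<in>G n. X i)"
  proof (rule Lim_emeasure_incseq)
    show "range (\<lambda>n. \<Union>i\<in>G n. X i) \<subseteq> sets M"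
      using X G by (auto intro!: sets.finite_UN)
    have "G m \<subseteq> G n" if "m \<le> n" for m n using that by (auto simp: G_def)
    then show "incseq (\<lambda>n. \<Union>i\<in>G n. X i)" unfolding incseq_def by blast
  qed
  moreover have "emeasure M (\<Union>i\<in>G n. X i) \<le> b" for n
  proof -
    have "emeasure M (\<Union>i\<in>G n. X i) \<le> (\<Sum>i\<in>G n. emeasure M (X i))"
      using X G by (intro emeasure_subadditive_finite) auto
    also have "\<dots> \<le> b" using G by (rule fin)
    finally show ?thesis .
  qed
  ultimately show ?thesis unfolding un by (intro LIMSEQ_le_const2) auto
qed simp

section \<open>Quantitative nondivergence\<close>

text \<open>The marked points of Kleinbock and Margulis, for an abstract ordered set so that an
  induction can pass to the elements comparable with a given one. Since \<open>F\<close> is a chain,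
  the lower bound \<epsilon> also applies to its own members.\<close>

definition marked :: "real \<Rightarrow> real \<Rightarrow> ('s::order \<Rightarrow> 'a \<Rightarrow> real) \<Rightarrow> 's set \<Rightarrow> 'a \<Rightarrow> bool" where
  "marked \<epsilon> \<rho> \<psi> P z \<longleftrightarrow>
    (\<exists>F\<subseteq>P. (\<forall>s\<in>F. \<forall>t\<in>F. s \<le> t \<or> t \<le> s) \<and> (\<forall>s\<in>F. \<psi> s z \<le> \<rho>) \<and>
       (\<forall>s\<in>P. (\<forall>t\<in>F. s \<le> t \<or> t \<le> s) \<longrightarrow> \<epsilon> \<le> \<psi> s z))"

text \<open>An element comparable with the whole enlarged flag is either \<open>s\<close> itself or
  lies in the smaller ordered set, where the old flag already controls it.\<close>

lemma marked_insert:
  assumes "marked \<epsilon> \<rho> \<psi> {t\<in>P. t \<noteq> s \<and> (s \<le> t \<or> t \<le> s)} z" "s \<in> P" "\<epsilon> \<le> \<psi> s z" "\<psi> s z \<le> \<rho>"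
  shows "marked \<epsilon> \<rho> \<psi> P z"
proof -
  let ?P = "{t\<in>P. t \<noteq> s \<and> (s \<le> t \<or> t \<le> s)}"
  from assms(1) obtain F where F: "F \<subseteq> ?P" "\<forall>s\<in>F. \<forall>t\<in>F. s \<le> t \<or> t \<le> s" "\<forall>s\<in>F. \<psi> s z \<le> \<rho>"
    "\<forall>u\<in>?P. (\<forall>t\<in>F. u \<le> t \<or> t \<le> u) \<longrightarrow> \<epsilon> \<le> \<psi> u z"
    unfolding marked_def by (elim exE conjE) (rule that)
  show ?thesis
    unfolding marked_def
  proof (intro exI[of _ "insert s F"] conjI ballI impI)
    fix u assume u: "u \<in> P" "\<forall>t\<in>insert s F. u \<le> t \<or> t \<le> u"
    show "\<epsilon> \<le> \<psi> u z"
      using F(4) u assms(3) by (cases "u = s") auto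
  qed (use F assms in auto)
qed

text \<open>The radius \<open>r\<close> below is, up to a factor 2, the largest one for which some weight stays below
  \<open>\<rho>\<close> on \<open>ball y r\<close>; comparing \<open>r\<close> with \<open>2 * r\<close> makes it unnecessary to attain a maximum.\<close>

lemma exists_critical_radius:
  fixes y :: "'a::metric_space" and \<psi> :: "'s \<Rightarrow> 'a \<Rightarrow> real"
  assumes "s0 \<in> P" "\<psi> s0 y < \<rho>" "continuous_on UNIV (\<psi> s0)"
    and sup: "\<And>s. s \<in> P \<Longrightarrow> \<exists>z\<in>ball y R \<inter> S. \<rho> \<le> \<psi> s z"
  obtains s r where "s \<in> P" "0 < r" "r \<le> R" "\<forall>z\<in>ball y r \<inter> S. \<psi> s z < \<rho>"
    "\<forall>t\<in>P. \<exists>z\<in>ball y (2 * r) \<inter> S. \<rho> \<le> \<psi> t z"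
proof -
  define A where "A = {r. 0 < r \<and> (\<exists>s\<in>P. \<forall>z\<in>ball y r \<inter> S. \<psi> s z < \<rho>)}"
  have "open (\<psi> s0 -` {..<\<rho>})" using assms(3) by (intro open_vimage) auto
  then obtain e where "0 < e" "ball y e \<subseteq> \<psi> s0 -` {..<\<rho>}"
    using assms(2) by (meson lessThan_iff open_contains_ball vimageI)
  then have e: "e \<in> A" using assms(1) by (auto simp: A_def)
  have le: "r \<le> R" if r: "r \<in> A" for r
  proof (rule ccontr)
    assume "\<not> r \<le> R"
    obtain s where s: "s \<in> P" "\<forall>z\<in>ball y r \<inter> S. \<psi> s z < \<rho>" using r by (auto simp: A_def)
    obtain z where "z \<in> ball y R \<inter> S" "\<rho> \<le> \<psi> s z" using sup[OF s(1)] by blast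
    then show False using s(2) \<open>\<not> r \<le> R\<close> by force
  qed
  then have bdd: "bdd_above A" by (auto simp: bdd_above_def)
  have "0 < Sup A" using cSup_upper[OF e bdd] e by (auto simp: A_def)
  then have "Sup A / 2 < Sup A" by simp
  then obtain r where r: "r \<in> A" "Sup A / 2 < r" using less_cSup_iff[OF _ bdd, of "Sup A / 2"] e by blast
  have "2 * r \<notin> A" using cSup_upper[OF _ bdd, of "2 * r"] r by auto
  moreover have r0: "0 < r" using r(1) by (simp add: A_def)
  ultimately have "\<forall>t\<in>P. \<not> (\<forall>z\<in>ball y (2 * r) \<inter> S. \<psi> t z < \<rho>)" by (simp add: A_def)
  then have "\<forall>t\<in>P. \<exists>z\<in>ball y (2 * r) \<inter> S. \<rho> \<le> \<psi> t z" by (meson not_less)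
  moreover obtain s where "s \<in> P" "\<forall>z\<in>ball y r \<inter> S. \<psi> s z < \<rho>" using r(1) by (auto simp: A_def)
  ultimately show thesis using that le[OF r(1)] r0 by blast
qed

text \<open>Induction on the maximal length \<open>m\<close> of a chain. On a ball of critical
  radius one weight \<open>s\<close> stays below \<rho>, so \<open>s\<close> can join any flag
  there, and the elements comparable with \<open>s\<close> have chains shorter by one. Each level
  costs three doublings, hence \<open>D ^ 3\<close>. The centre, the radius and \<open>P\<close>
  change in the induction, so the hypotheses about them stand in the conclusion.\<close>

lemma quantitative_nondivergence:
  fixes M :: "'a::metric_space measure" and \<psi> :: "'s::order \<Rightarrow> 'a \<Rightarrow> real"
  assumes sets_M: "sets M = sets borel"
    and U: "open U" "emeasure M U < \<infinity>"
    and D: "1 \<le> D" and K: "0 \<le> K" and \<epsilon>: "\<epsilon> \<le> \<rho>"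
    and pos: "\<And>x r. x \<in> S \<Longrightarrow> 0 < r \<Longrightarrow> 0 < emeasure M (ball x r)"
    and dbl: "\<And>x r. x \<in> S \<Longrightarrow> 0 < r \<Longrightarrow> ball x (3 * r) \<subseteq> U \<Longrightarrow>
      emeasure M (ball x (3 * r)) \<le> ennreal D * emeasure M (ball x r)"
  shows "\<lbrakk>x0 \<in> S; 0 < r0; ball x0 (5 ^ m * r0) \<subseteq> U;
      \<And>s. s \<in> P \<Longrightarrow> continuous_on UNIV (\<psi> s);
      \<And>s x r z. \<lbrakk>s \<in> P; x \<in> S; 0 < r; ball x r \<subseteq> U; z \<in> ball x r \<inter> S; \<rho> \<le> \<psi> s z\<rbrakk> \<Longrightarrow>
        emeasure M {y\<in>ball x r. \<psi> s y < \<epsilon>} \<le> ennreal K * emeasure M (ball x r);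
      \<And>s. s \<in> P \<Longrightarrow> \<exists>z\<in>ball x0 r0 \<inter> S. \<rho> \<le> \<psi> s z;
      \<And>F. \<lbrakk>F \<subseteq> P; finite F; \<forall>s\<in>F. \<forall>t\<in>F. s \<le> t \<or> t \<le> s\<rbrakk> \<Longrightarrow> card F \<le> m\<rbrakk>
    \<Longrightarrow> \<exists>T\<in>sets M. {z\<in>ball x0 r0 \<inter> S. \<not> marked \<epsilon> \<rho> \<psi> P z} \<subseteq> T \<and>
          emeasure M T \<le> ennreal (real m * (D ^ 3) ^ m * K) * emeasure M (ball x0 r0)"
proof (induction m arbitrary: x0 r0 P)
  case 0
  have "P = {}"
  proof (rule ccontr)
    assume "P \<noteq> {}"
    then obtain s where "s \<in> P" by blast
    then show False using "0.prems"(7)[of "{s}"] by auto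
  qed
  then have "marked \<epsilon> \<rho> \<psi> P z" for z by (auto simp: marked_def)
  then show ?case by (intro bexI[of _ "{}"]) auto
next
  case (Suc m)
  note x0 = Suc.prems(1) and r0 = Suc.prems(2) and ballU = Suc.prems(3) and cont = Suc.prems(4)
    and good = Suc.prems(5) and sup = Suc.prems(6) and len = Suc.prems(7)
  have m1: "1 \<le> (5::real) ^ m" by simp
  have opM: "open X \<Longrightarrow> X \<in> sets M" for X using sets_M by simp
  \<comment> \<open>Points of the support outside \<open>E\<close> are marked by the empty flag,
    because \<epsilon> \<le> \<rho>.\<close>
  define E where "E = {y\<in>ball x0 r0 \<inter> S. \<exists>s\<in>P. \<psi> s y < \<rho>}"
  define good_cover where "good_cover y r T \<longleftrightarrow>
      0 < r \<and> r \<le> 2 * r0 \<and> T \<in> sets M \<and> {z\<in>ball y r \<inter> S. \<not> marked \<epsilon> \<rho> \<psi> P z} \<subseteq> T \<and>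
      emeasure M T \<le> ennreal ((real m * (D ^ 3) ^ m + 1) * K) * emeasure M (ball y (2 * r))" for y r T
  have "\<exists>r T. good_cover y r T" if y: "y \<in> E" for y
  proof -
    from y obtain s0 where s0: "s0 \<in> P" "\<psi> s0 y < \<rho>" and yS: "y \<in> S" and dy: "dist x0 y < r0"
      by (auto simp: E_def)
    have sub: "ball x0 r0 \<subseteq> ball y (2 * r0)"
    proof
      fix z assume "z \<in> ball x0 r0"
      then show "z \<in> ball y (2 * r0)" using dy dist_triangle[of y z x0] by (simp add: dist_commute)
    qed
    have "\<exists>z\<in>ball y (2 * r0) \<inter> S. \<rho> \<le> \<psi> s z" if "s \<in> P" for s using sup[OF that] sub by blast
    then obtain s r where sr: "s \<in> P" "0 < r" "r \<le> 2 * r0" "\<forall>z\<in>ball y r \<inter> S. \<psi> s z < \<rho>"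
      "\<forall>t\<in>P. \<exists>z\<in>ball y (2 * r) \<inter> S. \<rho> \<le> \<psi> t z"
      using exists_critical_radius[where P = P and \<psi> = \<psi> and y = y and \<rho> = \<rho> and R = "2 * r0" and S = S,
          OF s0 cont[OF s0(1)]] by blast
    let ?P = "{t\<in>P. t \<noteq> s \<and> (s \<le> t \<or> t \<le> s)}"
    \<comment> \<open>Origin of the factor 5: \<open>y\<close> is within \<open>r0\<close> of
      \<open>x0\<close> and \<open>2 * r\<close> is at most \<open>4 * r0\<close>.\<close>
    have bsub: "ball y (5 ^ m * (2 * r)) \<subseteq> U"
    proof (rule order_trans[OF _ ballU], rule subsetI)
      fix z assume "z \<in> ball y (5 ^ m * (2 * r))"
      then have "dist y z < 5 ^ m * (2 * r)" by simp
      also have "\<dots> \<le> 5 ^ m * (4 * r0)" using sr by (intro mult_left_mono) auto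
      finally have "dist x0 z < r0 + 5 ^ m * (4 * r0)" using dy dist_triangle[of x0 z y] by simp
      also have "\<dots> \<le> 5 ^ m * r0 + 5 ^ m * (4 * r0)" using m1 r0 by simp
      finally show "z \<in> ball x0 (5 ^ Suc m * r0)" by (simp add: algebra_simps)
    qed
    have b2: "ball y (2 * r) \<subseteq> U"
      by (rule order_trans[OF subset_ball bsub]) (use m1 sr in simp)
    \<comment> \<open>On the doubled ball every weight reaches \<rho> again, which is the supremum
      hypothesis of the induction; on the original ball \<open>s\<close> stays below \<rho>.\<close>
    have "\<exists>T\<in>sets M. {z\<in>ball y (2 * r) \<inter> S. \<not> marked \<epsilon> \<rho> \<psi> ?P z} \<subseteq> T \<and>
          emeasure M T \<le> ennreal (real m * (D ^ 3) ^ m * K) * emeasure M (ball y (2 * r))"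
    proof (rule Suc.IH)
      show "card F \<le> m" if F: "F \<subseteq> ?P" "finite F" "\<forall>s\<in>F. \<forall>t\<in>F. s \<le> t \<or> t \<le> s" for F
      proof -
        have "card (insert s F) \<le> Suc m" using F sr by (intro len) auto
        moreover have "s \<notin> F" using F by auto
        ultimately show ?thesis using F by simp
      qed
      show "y \<in> S" "0 < 2 * r" "ball y (5 ^ m * (2 * r)) \<subseteq> U" using yS sr(2) bsub by simp_all
      show "continuous_on UNIV (\<psi> t)" if "t \<in> ?P" for t using cont that by blast
      show "emeasure M {y\<in>ball x r. \<psi> t y < \<epsilon>} \<le> ennreal K * emeasure M (ball x r)"
        if "t \<in> ?P" "x \<in> S" "0 < r" "ball x r \<subseteq> U" "z \<in> ball x r \<inter> S" "\<rho> \<le> \<psi> t z" for t x r z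
        using that by (intro good[of t x r z]) simp_all
      show "\<exists>z\<in>ball y (2 * r) \<inter> S. \<rho> \<le> \<psi> t z" if "t \<in> ?P" for t using sr(5) that by blast
    qed
    then obtain T where T: "T \<in> sets M" "{z\<in>ball y (2 * r) \<inter> S. \<not> marked \<epsilon> \<rho> \<psi> ?P z} \<subseteq> T"
      "emeasure M T \<le> ennreal (real m * (D ^ 3) ^ m * K) * emeasure M (ball y (2 * r))" by blast
    \<comment> \<open>Where \<open>s\<close> drops below \<epsilon> it cannot be put into the flag;
      this is the only loss beyond the induction hypothesis, and goodness bounds it.\<close>
    define B where "B = {z\<in>ball y (2 * r). \<psi> s z < \<epsilon>}"
    have "open (\<psi> s -` {..<\<epsilon>})" using cont[OF sr(1)] by (intro open_vimage) auto
    moreover have "B = ball y (2 * r) \<inter> \<psi> s -` {..<\<epsilon>}" by (auto simp: B_def)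
    ultimately have B: "B \<in> sets M" by (auto intro!: opM)
    obtain z where "z \<in> ball y (2 * r) \<inter> S" "\<rho> \<le> \<psi> s z" using sr by blast
    then have mB: "emeasure M B \<le> ennreal K * emeasure M (ball y (2 * r))"
      unfolding B_def using sr yS b2 by (intro good) auto
    have "{z\<in>ball y r \<inter> S. \<not> marked \<epsilon> \<rho> \<psi> P z} \<subseteq> T \<union> B"
    proof
      fix z assume z: "z \<in> {z\<in>ball y r \<inter> S. \<not> marked \<epsilon> \<rho> \<psi> P z}"
      then have z2: "z \<in> ball y (2 * r) \<inter> S" using sr by auto
      show "z \<in> T \<union> B"
      proof (rule ccontr)
        assume nz: "z \<notin> T \<union> B"
        then have "marked \<epsilon> \<rho> \<psi> ?P z" "\<epsilon> \<le> \<psi> s z" using T(2) z2 by (auto simp: B_def)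
        moreover have "\<psi> s z \<le> \<rho>" using sr(4) z by force
        ultimately have "marked \<epsilon> \<rho> \<psi> P z" using marked_insert[of \<epsilon> \<rho> \<psi> P s z] sr(1) by blast
        then show False using z by blast
      qed
    qed
    moreover have "emeasure M (T \<union> B) \<le> ennreal ((real m * (D ^ 3) ^ m + 1) * K) * emeasure M (ball y (2 * r))"
    proof -
      have "emeasure M (T \<union> B) \<le> emeasure M T + emeasure M B" using T B by (intro emeasure_subadditive) auto
      also have "\<dots> \<le> ennreal (real m * (D ^ 3) ^ m * K) * emeasure M (ball y (2 * r)) + ennreal K * emeasure M (ball y (2 * r))"
        using T mB by (intro add_mono) auto
      also have "\<dots> = ennreal ((real m * (D ^ 3) ^ m + 1) * K) * emeasure M (ball y (2 * r))"
        using D K by (simp add: distrib_right ennreal_plus)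
      finally show ?thesis .
    qed
    moreover have "T \<union> B \<in> sets M" using T(1) B by (rule sets.Un)
    ultimately have "good_cover y r (T \<union> B)" using sr(2,3) by (simp only: good_cover_def)
    then show ?thesis by blast
  qed
  then obtain r T where "\<And>y. y \<in> E \<Longrightarrow> good_cover y (r y) (T y)" by metis
  then have rT: "\<And>y. y \<in> E \<Longrightarrow> 0 < r y \<and> r y \<le> 2 * r0 \<and> T y \<in> sets M \<and>
      {z\<in>ball y (r y) \<inter> S. \<not> marked \<epsilon> \<rho> \<psi> P z} \<subseteq> T y \<and>
      emeasure M (T y) \<le> ennreal ((real m * (D ^ 3) ^ m + 1) * K) * emeasure M (ball y (2 * r y))"
    by (simp only: good_cover_def)
  have rE: "0 < r y / 3 \<and> r y / 3 \<le> r0" if "y \<in> E" for y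
  proof -
    have "0 < r y" "r y \<le> 2 * r0" using rT[OF that] by blast+
    then show ?thesis by simp
  qed
  \<comment> \<open>The radii are divided by 3 so that the tripled balls are the critical balls
    themselves, on which \<open>good_cover\<close> gives its conclusion.\<close>
  obtain C where C: "C \<subseteq> E" "disjoint_family_on (\<lambda>y. ball y (r y / 3)) C"
    "\<And>i. i \<in> E \<Longrightarrow> \<exists>j\<in>C. i \<in> ball j (3 * (r j / 3))"
    by (rule vitali_disjoint_balls[of E "\<lambda>y. r y / 3" r0 "\<lambda>y. y"]) (use rE in blast)+
  have C_in: "y \<in> S" "dist x0 y < r0" "0 < r y" "r y \<le> 2 * r0" "T y \<in> sets M" if "y \<in> C" for y
  proof -
    have y: "y \<in> E" using that C(1) by blast
    show "y \<in> S" "dist x0 y < r0" using y by (simp_all add: E_def)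
    show "0 < r y" "r y \<le> 2 * r0" "T y \<in> sets M" using rT[OF y] by blast+
  qed
  have sub5: "ball x0 (5 * r0) \<subseteq> U"
    by (rule order_trans[OF subset_ball ballU]) (use m1 r0 in simp)
  have sub2: "ball y (r y / 3) \<subseteq> ball x0 (3 * r0)" if "y \<in> C" for y
  proof
    fix z assume "z \<in> ball y (r y / 3)"
    then show "z \<in> ball x0 (3 * r0)" using C_in[OF that] dist_triangle[of x0 z y] by simp
  qed
  have U3: "ball x0 (3 * r0) \<subseteq> U" by (rule order_trans[OF subset_ball sub5]) (use r0 in simp)
  have U_sets: "U \<in> sets M" using U(1) by (rule opM)
  have "emeasure M (ball x0 (3 * r0)) \<le> emeasure M U" using U3 U_sets by (rule emeasure_mono)
  then have fin3: "emeasure M (ball x0 (3 * r0)) < \<infinity>" using U(2) by (rule le_less_trans)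
  have "countable C"
    using C(2) _ _ fin3 by (rule countable_disjoint_positive_measure) (use C_in pos sub2 opM in auto)
  have meas: "emeasure M (T y) \<le> ennreal ((real m * (D ^ 3) ^ m + 1) * K * D ^ 2) * emeasure M (ball y (r y / 3))"
    if y: "y \<in> C" for y
  proof -
    note cy = C_in[OF y]
    have "ball y (2 * r y) \<subseteq> ball x0 (5 * r0)"
    proof
      fix z assume "z \<in> ball y (2 * r y)"
      then show "z \<in> ball x0 (5 * r0)" using cy dist_triangle[of x0 z y] by simp
    qed
    then have sU: "ball y (2 * r y) \<subseteq> U" using sub5 by blast
    \<comment> \<open>Two doublings lead from radius 2r to 2r/9, which is below r/3. The third one
      is spent later on passing from \<open>3 * r0\<close> to \<open>r0\<close>.\<close>
    have "emeasure M (ball y (2 * r y)) = emeasure M (ball y (3 * (2 * r y / 3)))" by simp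
    also have "\<dots> \<le> ennreal D * emeasure M (ball y (2 * r y / 3))"
      using cy sU by (intro dbl) auto
    also have "emeasure M (ball y (2 * r y / 3)) = emeasure M (ball y (3 * (2 * r y / 9)))" by simp
    also have "\<dots> \<le> ennreal D * emeasure M (ball y (2 * r y / 9))"
      using cy by (intro dbl) (auto intro!: order_trans[OF subset_ball sU])
    also have "emeasure M (ball y (2 * r y / 9)) \<le> emeasure M (ball y (r y / 3))"
      using cy by (intro emeasure_mono subset_ball opM) auto
    finally have "emeasure M (ball y (2 * r y)) \<le> ennreal D * (ennreal D * emeasure M (ball y (r y / 3)))"
      by (auto simp: mult_left_mono)
    also have "\<dots> = ennreal (D ^ 2) * emeasure M (ball y (r y / 3))"
      using D by (simp add: power2_eq_square ennreal_mult mult.assoc)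
    finally have d: "emeasure M (ball y (2 * r y)) \<le> ennreal (D ^ 2) * emeasure M (ball y (r y / 3))" .
    have "emeasure M (T y) \<le> ennreal ((real m * (D ^ 3) ^ m + 1) * K) * emeasure M (ball y (2 * r y))"
      using rT[of y] C(1) y by blast
    also have "\<dots> \<le> ennreal ((real m * (D ^ 3) ^ m + 1) * K) * (ennreal (D ^ 2) * emeasure M (ball y (r y / 3)))"
      using d by (rule mult_left_mono) simp
    also have "\<dots> = ennreal ((real m * (D ^ 3) ^ m + 1) * K * D ^ 2) * emeasure M (ball y (r y / 3))"
      using D K by (simp add: ennreal_mult mult.assoc)
    finally show ?thesis .
  qed
  show ?case
  proof (intro bexI conjI)
    show "{z\<in>ball x0 r0 \<inter> S. \<not> marked \<epsilon> \<rho> \<psi> P z} \<subseteq> (\<Union>y\<in>C. T y)"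
    proof
      fix z assume z: "z \<in> {z\<in>ball x0 r0 \<inter> S. \<not> marked \<epsilon> \<rho> \<psi> P z}"
      have "z \<in> E"
      proof (rule ccontr)
        assume "z \<notin> E"
        then have "\<forall>s\<in>P. \<rho> \<le> \<psi> s z" using z by (auto simp: E_def)
        then have "marked \<epsilon> \<rho> \<psi> P z" unfolding marked_def using \<epsilon> by (intro exI[of _ "{}"]) auto
        then show False using z by simp
      qed
      then obtain j where j: "j \<in> C" "z \<in> ball j (r j)" using C(3)[of z] by auto
      have "{z\<in>ball j (r j) \<inter> S. \<not> marked \<epsilon> \<rho> \<psi> P z} \<subseteq> T j" using rT[of j] C(1) j(1) by blast
      then show "z \<in> (\<Union>y\<in>C. T y)" using j z by blast
    qed
    show "(\<Union>y\<in>C. T y) \<in> sets M" using \<open>countable C\<close> C_in(5) by (intro sets.countable_UN') auto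
    show "emeasure M (\<Union>y\<in>C. T y) \<le> ennreal (real (Suc m) * (D ^ 3) ^ Suc m * K) * emeasure M (ball x0 r0)"
    proof (rule emeasure_countable_UN_le[OF \<open>countable C\<close>])
      show "T i \<in> sets M" if "i \<in> C" for i using that by (rule C_in(5))
      fix F assume F: "finite F" "F \<subseteq> C"
      let ?c = "ennreal ((real m * (D ^ 3) ^ m + 1) * K * D ^ 2)"
      have "(\<Sum>y\<in>F. emeasure M (T y)) \<le> (\<Sum>y\<in>F. ?c * emeasure M (ball y (r y / 3)))"
        using meas F by (intro sum_mono) auto
      also have "\<dots> = ?c * (\<Sum>y\<in>F. emeasure M (ball y (r y / 3)))" by (simp add: sum_distrib_left)
      also have "(\<Sum>y\<in>F. emeasure M (ball y (r y / 3))) = emeasure M (\<Union>y\<in>F. ball y (r y / 3))"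
        using F disjoint_family_on_mono[OF F(2) C(2)] by (intro sum_emeasure) (auto intro: opM)
      also have "\<dots> \<le> emeasure M (ball x0 (3 * r0))"
        using F sub2 by (intro emeasure_mono opM) auto
      also have "\<dots> \<le> ennreal D * emeasure M (ball x0 r0)" using x0 r0 U3 by (intro dbl)
      finally have "(\<Sum>y\<in>F. emeasure M (T y)) \<le> ?c * (ennreal D * emeasure M (ball x0 r0))"
        by (simp add: mult_left_mono)
      also have "\<dots> = ennreal ((real m * (D ^ 3) ^ m + 1) * K * D ^ 3) * emeasure M (ball x0 r0)"
        using D K by (simp add: ennreal_mult[symmetric] mult.assoc[symmetric] power3_eq_cube power2_eq_square)
      also have "\<dots> \<le> ennreal (real (Suc m) * (D ^ 3) ^ Suc m * K) * emeasure M (ball x0 r0)"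
      proof (intro mult_right_mono ennreal_leI)
        have "1 \<le> (D ^ 3) ^ m" using D by simp
        then have "(real m * (D ^ 3) ^ m + 1) \<le> real (Suc m) * (D ^ 3) ^ m" by (simp add: algebra_simps)
        then have "(real m * (D ^ 3) ^ m + 1) * (K * D ^ 3) \<le> (real (Suc m) * (D ^ 3) ^ m) * (K * D ^ 3)"
          using D K by (intro mult_right_mono) auto
        then show "(real m * (D ^ 3) ^ m + 1) * K * D ^ 3 \<le> real (Suc m) * (D ^ 3) ^ Suc m * K"
          by (simp add: algebra_simps)
      qed simp
      finally show "(\<Sum>y\<in>F. emeasure M (T y)) \<le> ennreal (real (Suc m) * (D ^ 3) ^ Suc m * K) * emeasure M (ball x0 r0)" .
    qed
  qed
qed

section \<open>Plucker coordinates of integral subspaces\<close>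

text \<open>A fixed numbering gives a meaning to the first \<open>j\<close> rows of a matrix over
  any finite index type.\<close>

definition index_enum :: "'m::finite \<Rightarrow> nat" where
  "index_enum = (SOME e. bij_betw e UNIV {..<CARD('m)})"

lemma bij_index_enum: "bij_betw (index_enum :: 'm::finite \<Rightarrow> nat) UNIV {..<CARD('m)}"
proof -
  have "\<exists>e. bij_betw e (UNIV :: 'm set) {..<CARD('m)}"
    using ex_bij_betw_finite_nat[of "UNIV :: 'm set"] by (auto simp: atLeast0LessThan)
  then show ?thesis unfolding index_enum_def by (rule someI_ex)
qed

lemma index_enum_eq_iff [simp]: "index_enum i = index_enum k \<longleftrightarrow> i = k"
  using bij_index_enum by (metis UNIV_I bij_betw_inv_into_left)

lemma index_enum_less [simp]: "index_enum (i :: 'm::finite) < CARD('m)"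
  using bij_index_enum by (metis UNIV_I bij_betwE lessThan_iff)

lemma index_enum_surj:
  assumes "j < CARD('m::finite)"
  obtains k :: "'m::finite" where "index_enum k = j"
  using bij_index_enum assms by (metis bij_betw_imp_surj_on imageE lessThan_iff)

text \<open>Up to sign, the numbers \<open>plucker j w \<sigma>\<close> are the \<open>j \<times> j\<close> minors of the vectors
  \<open>w 0, \<dots>, w (j - 1)\<close>, that is the coordinates of their exterior product: the remaining rows
  are filled up with standard basis vectors, and \<open>\<sigma>\<close> selects which ones.\<close>

definition plucker :: "nat \<Rightarrow> (nat \<Rightarrow> real ^ 'm) \<Rightarrow> ('m::finite \<Rightarrow> 'm) \<Rightarrow> real" where
  "plucker j w \<sigma> = det (\<chi> i. if index_enum i < j then w (index_enum i) else axis (\<sigma> i) 1)"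

text \<open>The determinant is linear in row \<open>k\<close>, and a standard basis vector in that
  row is the same as another choice of \<sigma>. This is the coordinate form of taking the exterior
  product with \<open>v\<close>.\<close>

lemma plucker_expand:
  fixes v :: "real ^ 'm::finite"
  assumes k: "index_enum k = j"
  shows "plucker (Suc j) (w(j := v)) \<sigma> = (\<Sum>l\<in>UNIV. v $ l * plucker j w (\<sigma>(k := l)))"
proof -
  let ?c = "\<lambda>i. if index_enum i < j then w (index_enum i) else axis (\<sigma> i) 1"
  have "plucker (Suc j) (w(j := v)) \<sigma> = det (\<chi> i. if i = k then \<Sum>l\<in>UNIV. v $ l *s axis l 1 else ?c i)"
  proof -
    have "v = (\<Sum>l\<in>UNIV. v $ l *s axis l 1)" by (simp add: basis_expansion)
    moreover have "index_enum i < Suc j \<longleftrightarrow> index_enum i < j \<or> i = k" for i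
      using index_enum_eq_iff[of i k] unfolding less_Suc_eq k[symmetric] by blast
    ultimately show ?thesis unfolding plucker_def using k
      by (intro arg_cong[of _ _ det] Cart_lambda_cong) auto
  qed
  also have "\<dots> = (\<Sum>l\<in>UNIV. v $ l * det (\<chi> i. if i = k then axis l 1 else ?c i))"
    by (subst det_linear_row_sum) (auto simp: det_row_mul)
  also have "\<dots> = (\<Sum>l\<in>UNIV. v $ l * plucker j w (\<sigma>(k := l)))"
  proof (intro sum.cong refl arg_cong2[of _ _ _ _ "(*)"])
    fix l
    show "det (\<chi> i. if i = k then axis l 1 else ?c i) = plucker j w (\<sigma>(k := l))"
      unfolding plucker_def using k by (intro arg_cong[of _ _ det] Cart_lambda_cong) auto
  qed
  finally show ?thesis .
qed

lemma plucker_axis: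
  assumes k: "index_enum k = j"
  shows "plucker (Suc j) (w(j := axis l 1)) \<sigma> = plucker j w (\<sigma>(k := l))"
proof -
  have "(\<Sum>i\<in>UNIV. axis l 1 $ i * plucker j w (\<sigma>(k := i))) =
      (\<Sum>i\<in>UNIV. if i = l then plucker j w (\<sigma>(k := i)) else 0)"
    by (intro sum.cong) (auto simp: axis_def)
  then show ?thesis unfolding plucker_expand[OF k] by simp
qed

text \<open>Steinitz completion: append a standard vector outside the span until the matrix is
  square and of full rank. The induction runs on the number of missing rows.\<close>

lemma plucker_nonzero:
  fixes w :: "nat \<Rightarrow> real ^ 'm::finite"
  assumes "dim (w ` {..<j}) = j" "j \<le> CARD('m)"
  shows "\<exists>\<sigma>. plucker j w \<sigma> \<noteq> 0"
  using assms
proof (induction "CARD('m) - j" arbitrary: j w)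
  case 0
  then have j: "j = CARD('m)" by simp
  let ?A = "(\<chi> i. w (index_enum i)) :: real ^ 'm ^ 'm"
  have "rows ?A = w ` range (index_enum :: 'm \<Rightarrow> nat)" by (auto simp: rows_def row_def)
  also have "range (index_enum :: 'm \<Rightarrow> nat) = {..<j}"
    using bij_index_enum[where 'm = 'm] j by (simp add: bij_betw_def)
  finally have "rank ?A = j" using 0 by (simp add: row_rank_def)
  then have "det ?A \<noteq> 0" using j by (simp add: det_eq_0_rank)
  then show ?case unfolding plucker_def using j by auto
next
  case (Suc n)
  have lt: "j < CARD('m)" using Suc by simp
  then obtain k :: 'm where k: "index_enum k = j" by (rule index_enum_surj)
  have "\<exists>l. axis l 1 \<notin> span (w ` {..<j})"
  proof (rule ccontr)
    assume "\<not> ?thesis"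
    then have "Basis \<subseteq> span (w ` {..<j})" by (auto simp: Basis_vec_def)
    then have "span (w ` {..<j}) = UNIV" by (metis span_Basis span_mono span_span top.extremum_uniqueI)
    then have "dim (w ` {..<j}) = CARD('m)" by (metis dim_UNIV dim_span DIM_cart DIM_real mult.right_neutral)
    then show False using Suc.prems lt by simp
  qed
  then obtain l where l: "axis l 1 \<notin> span (w ` {..<j})" by blast
  have im: "(w(j := axis l 1)) ` {..<Suc j} = insert (axis l 1) (w ` {..<j})"
    by (auto simp: lessThan_Suc)
  have "dim ((w(j := axis l 1)) ` {..<Suc j}) = Suc j"
    using l Suc.prems unfolding im by (simp add: dim_insert)
  then obtain \<sigma> where "plucker (Suc j) (w(j := axis l 1)) \<sigma> \<noteq> 0"
    using Suc.hyps(1)[of "Suc j" "w(j := axis l 1)"] Suc.hyps(2) lt by (metis Suc_leI diff_Suc_1 diff_commute diff_diff_left plus_1_eq_Suc Suc_eq_plus1)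
  then show ?case unfolding plucker_axis[OF k] by blast
qed

lemma span_image_lessThan:
  fixes w :: "nat \<Rightarrow> 'v::real_vector"
  assumes "x \<in> span (w ` {..<j})"
  shows "\<exists>a. x = (\<Sum>l<j. a l *\<^sub>R w l)"
  using assms
proof (induction j arbitrary: x)
  case (Suc j)
  then have "x \<in> span (insert (w j) (w ` {..<j}))" by (simp add: lessThan_Suc)
  then obtain k where "x - k *\<^sub>R w j \<in> span (w ` {..<j})" by (auto simp: span_insert)
  then obtain a where "x - k *\<^sub>R w j = (\<Sum>l<j. a l *\<^sub>R w l)" using Suc.IH by blast
  then have "x = (\<Sum>l<Suc j. (a(j := k)) l *\<^sub>R w l)" by (simp add: algebra_simps)
  then show ?case by blast
qed simp

lemma sum_index_enum:
  assumes "j \<le> CARD('m::finite)"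
  shows "(\<Sum>i\<in>UNIV. if index_enum (i :: 'm) < j then g (index_enum i) else 0) = (\<Sum>l<j. g l)"
proof -
  have "(\<Sum>i\<in>UNIV. if index_enum (i :: 'm) < j then g (index_enum i) else 0) =
      (\<Sum>l<CARD('m). if l < j then g l else 0)"
    using sum.reindex_bij_betw[OF bij_index_enum, of "\<lambda>l. if l < j then g l else 0"] by simp
  also have "\<dots> = (\<Sum>l<j. g l)"
    using assms by (subst sum.inter_filter[symmetric]) (auto intro!: sum.cong)
  finally show ?thesis .
qed

text \<open>The coefficients of \<open>w'\<close> in terms of \<open>w\<close>, extended by the
  identity on the filling rows, form a matrix with determinant \<open>c\<close>. A linear map
  preserves these coefficients, so the same \<open>c\<close> serves every \<open>H\<close> and every
  \<sigma>.\<close>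

lemma plucker_proportional:
  fixes w w' :: "nat \<Rightarrow> real ^ 'm::finite"
  assumes sub: "w' ` {..<j} \<subseteq> span (w ` {..<j})" and j: "j \<le> CARD('m)"
  obtains c where "\<And>(H :: real ^ 'm \<Rightarrow> real ^ 'm) \<sigma>. linear H \<Longrightarrow> plucker j (\<lambda>i. H (w' i)) \<sigma> = c * plucker j (\<lambda>i. H (w i)) \<sigma>"
proof -
  have "\<exists>a. w' i = (\<Sum>l<j. a l *\<^sub>R w l)" if "i < j" for i
    using sub that by (intro span_image_lessThan) auto
  then obtain a where a: "\<And>i. i < j \<Longrightarrow> w' i = (\<Sum>l<j. a i l *\<^sub>R w l)" by metis
  define B :: "real ^ 'm ^ 'm" where
    "B = (\<chi> i l. if index_enum i < j then (if index_enum l < j then a (index_enum i) (index_enum l) else 0)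
           else if i = l then 1 else 0)"
  show thesis
  proof (rule that)
    fix H :: "real ^ 'm \<Rightarrow> real ^ 'm" and \<sigma> assume H: "linear H"
    let ?M = "\<lambda>w :: nat \<Rightarrow> real ^ 'm. (\<chi> i. if index_enum i < j then H (w (index_enum i)) else axis (\<sigma> i) 1) :: real ^ 'm ^ 'm"
    have "?M w' = B ** ?M w"
      unfolding matrix_mul_sum_alt
    proof (rule Cart_lambda_cong)
      fix i
      show "(if index_enum i < j then H (w' (index_enum i)) else axis (\<sigma> i) 1) = (\<Sum>k\<in>UNIV. B $ i $ k *s ?M w $ k)"
      proof (cases "index_enum i < j")
        case True
        have "(\<Sum>k\<in>UNIV. B $ i $ k *s ?M w $ k) =
            (\<Sum>k\<in>UNIV. if index_enum (k :: 'm) < j then a (index_enum i) (index_enum k) *\<^sub>R H (w (index_enum k)) else 0)"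
          using True by (intro sum.cong) (auto simp: B_def scalar_mult_eq_scaleR)
        also have "\<dots> = (\<Sum>l<j. a (index_enum i) l *\<^sub>R H (w l))"
          using j by (rule sum_index_enum[where g = "\<lambda>l. a (index_enum i) l *\<^sub>R H (w l)"])
        also have "\<dots> = H (w' (index_enum i))"
          using a[OF True] H by (simp add: linear_sum linear_scale)
        finally show ?thesis using True by simp
      next
        case False
        have "(\<Sum>k\<in>UNIV. B $ i $ k *s ?M w $ k) = (\<Sum>k\<in>UNIV. if k = i then ?M w $ k else 0)"
          using False by (intro sum.cong) (auto simp: B_def)
        then show ?thesis using False by simp
      qed
    qed
    then show "plucker j (\<lambda>i. H (w' i)) \<sigma> = det B * plucker j (\<lambda>i. H (w i)) \<sigma>"
      unfolding plucker_def by (simp add: det_mul)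
  qed
qed

section \<open>Integral bases with least Plucker coordinates\<close>

definition integral_vector :: "real ^ 'm \<Rightarrow> bool" where
  "integral_vector v \<longleftrightarrow> (\<forall>i. v $ i \<in> \<int>)"

lemma plucker_in_Ints:
  fixes w :: "nat \<Rightarrow> real ^ 'm::finite"
  assumes "\<And>i. i < j \<Longrightarrow> integral_vector (w i)"
  shows "plucker j w \<sigma> \<in> \<int>"
  unfolding plucker_def det_def
  using assms by (intro Ints_sum Ints_mult Ints_prod) (auto simp: integral_vector_def axis_def)

text \<open>The vectors need not generate the integral points of \<open>V\<close>; being
  \<open>dim V\<close> many and spanning, they are linearly independent. The index in the lattice is
  dealt with by minimisation.\<close>

definition integral_basis :: "(real ^ 'm::finite) set \<Rightarrow> (nat \<Rightarrow> real ^ 'm) \<Rightarrow> bool" where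
  "integral_basis V w \<longleftrightarrow> (\<forall>i<dim V. integral_vector (w i)) \<and> span (w ` {..<dim V}) = V"

text \<open>All Plucker vectors of integral bases of a subspace are proportional, so one of
  them is minimal simultaneously for all \<open>H\<close>.\<close>

lemma minimal_integral_basis:
  fixes V :: "(real ^ 'm::finite) set"
  assumes "integral_basis V w0"
  shows "\<exists>w. integral_basis V w \<and> (\<forall>w' (H :: real ^ 'm \<Rightarrow> real ^ 'm) \<sigma>. integral_basis V w' \<longrightarrow> linear H \<longrightarrow>
     \<bar>plucker (dim V) (\<lambda>i. H (w i)) \<sigma>\<bar> \<le> \<bar>plucker (dim V) (\<lambda>i. H (w' i)) \<sigma>\<bar>)"
proof -
  define j where "j = dim V"
  have jm: "j \<le> CARD('m)" using dim_subset_UNIV[of V] by (simp add: j_def)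
  \<comment> \<open>On integral bases this sum is a natural number, so a least value is attained.
    Comparing with it at \<open>H\<close> = identity forces the proportionality factor of any
    competitor to be at least 1 in absolute value, and that factor is the same for every
    \<open>H\<close>.\<close>
  define size where "size w = (\<Sum>\<sigma>\<in>UNIV. \<bar>plucker j w \<sigma>\<bar>)" for w :: "nat \<Rightarrow> real ^ 'm"
  obtain w where w: "integral_basis V w"
    and least: "\<And>w'. integral_basis V w' \<Longrightarrow> nat \<lfloor>size w\<rfloor> \<le> nat \<lfloor>size w'\<rfloor>"
    using ex_has_least_nat[of "integral_basis V" w0 "\<lambda>w. nat \<lfloor>size w\<rfloor>"] assms by blast
  have "size w' \<in> \<int>" if "integral_basis V w'" for w'
    using that unfolding size_def j_def integral_basis_def by (intro Ints_sum Ints_abs plucker_in_Ints) auto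
  moreover have "0 \<le> size w'" for w' by (auto simp: size_def sum_nonneg)
  ultimately have size_eq: "size w' = real (nat \<lfloor>size w'\<rfloor>)" if "integral_basis V w'" for w'
    using that by (auto elim!: Ints_cases)
  have pos: "0 < size w"
  proof -
    have "dim (w ` {..<j}) = j" using w dim_span[of "w ` {..<j}"] by (simp add: integral_basis_def j_def)
    then obtain \<sigma> where "plucker j w \<sigma> \<noteq> 0" using plucker_nonzero jm by blast
    moreover have "\<bar>plucker j w \<sigma>\<bar> \<le> size w" unfolding size_def by (rule member_le_sum) auto
    ultimately show ?thesis by linarith
  qed
  show ?thesis
  proof (intro exI conjI allI impI)
    fix w' H \<sigma> assume w': "integral_basis V w'" and H: "linear (H :: real ^ 'm \<Rightarrow> real ^ 'm)"
    have "w' ` {..<j} \<subseteq> span (w ` {..<j})"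
      using w w' span_superset[of "w' ` {..<j}"] by (simp add: integral_basis_def j_def)
    then obtain c where c: "\<And>(H :: real ^ 'm \<Rightarrow> real ^ 'm) \<sigma>. linear H \<Longrightarrow> plucker j (\<lambda>i. H (w' i)) \<sigma> = c * plucker j (\<lambda>i. H (w i)) \<sigma>"
      using plucker_proportional[of w' j w] jm by metis
    have "size w' = \<bar>c\<bar> * size w"
      unfolding size_def using c[OF linear_ident] by (simp add: abs_mult sum_distrib_left)
    moreover have "size w \<le> size w'" using least[OF w'] size_eq[OF w] size_eq[OF w'] by linarith
    ultimately have "1 \<le> \<bar>c\<bar>" using pos by simp
    then have "1 * \<bar>plucker j (\<lambda>i. H (w i)) \<sigma>\<bar> \<le> \<bar>c\<bar> * \<bar>plucker j (\<lambda>i. H (w i)) \<sigma>\<bar>"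
      by (rule mult_right_mono) simp
    then show "\<bar>plucker (dim V) (\<lambda>i. H (w i)) \<sigma>\<bar> \<le> \<bar>plucker (dim V) (\<lambda>i. H (w' i)) \<sigma>\<bar>"
      using c[OF H, of \<sigma>] by (simp add: j_def abs_mult)
  qed (rule w)
qed

section \<open>Minkowski's theorem on linear forms\<close>

lemma countable_integral_vectors: "countable {z :: real ^ 'm::finite. integral_vector z}"
proof -
  have "{z :: real ^ 'm. integral_vector z} \<subseteq> (\<lambda>g :: 'm \<Rightarrow> int. \<chi> i. real_of_int (g i)) ` UNIV"
  proof
    fix z :: "real ^ 'm" assume "z \<in> {z. integral_vector z}"
    then have "z = (\<chi> i. real_of_int \<lfloor>z $ i\<rfloor>)" by (auto simp: integral_vector_def vec_eq_iff elim!: Ints_cases)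
    then show "z \<in> range (\<lambda>g :: 'm \<Rightarrow> int. \<chi> i. real_of_int (g i))" by (intro image_eqI[where x = "\<lambda>i. \<lfloor>z $ i\<rfloor>"]) auto
  qed
  then show ?thesis by (rule countable_subset) simp
qed

text \<open>\<open>G z\<close> is the part of \<open>E\<close> in the unit cell at \<open>z\<close>,
  and \<open>F z\<close> the same part moved into the cell \<open>C\<close>. If no two points of
  \<open>E\<close> differ by an integral vector, the \<open>F z\<close> are disjoint, so
  \<open>E\<close> has measure at most that of the unit cube.\<close>

lemma blichfeldt:
  fixes E :: "(real ^ 'm::finite) set"
  assumes E: "E \<in> sets borel" and big: "1 < emeasure lborel E"
  obtains x y where "x \<in> E" "y \<in> E" "x \<noteq> y" "integral_vector (x - y)"
proof (rule ccontr)
  note pair = that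
  assume "\<not> thesis"
  then have no: "x = y" if "x \<in> E" "y \<in> E" "integral_vector (x - y)" for x y
    using that pair by blast
  define Z where "Z = {z :: real ^ 'm. integral_vector z}"
  define C where "C = {x :: real ^ 'm. \<forall>i. 0 \<le> x $ i \<and> x $ i < 1}"
  have Zc: "countable Z" unfolding Z_def by (rule countable_integral_vectors)
  have Cb[measurable]: "C \<in> sets borel"
  proof -
    have "{x :: real ^ 'm. 0 \<le> x $ i} \<in> sets borel" "{x :: real ^ 'm. x $ i < 1} \<in> sets borel" for i
      by (intro borel_closed closed_Collect_le borel_open open_Collect_less continuous_intros)+
    moreover have "C = (\<Inter>i. {x. 0 \<le> x $ i} \<inter> {x. x $ i < 1})" by (auto simp: C_def)
    ultimately show ?thesis by (auto intro!: sets.finite_INT sets.Int simp del: Collect_conj_eq)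
  qed
  define G where "G z = {x\<in>E. x - z \<in> C}" for z
  define F where "F z = {x\<in>C. z + x \<in> E}" for z
  have G_eq: "G z = E \<inter> (\<lambda>x. x - z) -` C" for z by (auto simp: G_def)
  have F_eq: "F z = (+) z -` G z" for z by (auto simp: F_def G_def)
  have Gb: "G z \<in> sets borel" for z unfolding G_eq
    using E by (intro sets.Int measurable_sets_borel[OF _ Cb]) auto
  have Fb: "F z \<in> sets borel" for z unfolding F_eq
    by (intro measurable_sets_borel[OF _ Gb]) auto
  have GF: "emeasure lborel (G z) = emeasure lborel (F z)" for z
  proof -
    have "emeasure lborel (G z) = emeasure (distr lborel borel ((+) z)) (G z)" by (simp add: lborel_distr_plus)
    also have "\<dots> = emeasure lborel (F z)" using Gb by (subst emeasure_distr) (auto simp: F_eq)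
    finally show ?thesis .
  qed
  have E_eq: "E = (\<Union>z\<in>Z. G z)"
  proof
    show "E \<subseteq> (\<Union>z\<in>Z. G z)"
    proof
      fix x assume x: "x \<in> E"
      let ?z = "(\<chi> i. real_of_int \<lfloor>x $ i\<rfloor>) :: real ^ 'm"
      have "?z \<in> Z" by (simp add: Z_def integral_vector_def)
      moreover have "x \<in> G ?z" using x by (auto simp: G_def C_def frac_def[symmetric] frac_lt_1)
      ultimately show "x \<in> (\<Union>z\<in>Z. G z)" by blast
    qed
  qed (auto simp: G_def)
  have C_eq: "x = y" if xy: "x \<in> C" "y \<in> C" "integral_vector (x - y)" for x y
  proof -
    have "x $ i = y $ i" for i
    proof -
      obtain k where k: "x $ i - y $ i = real_of_int k"
        using xy(3) unfolding integral_vector_def by (metis Ints_cases vector_minus_component)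
      moreover have "0 \<le> x $ i" "x $ i < 1" "0 \<le> y $ i" "y $ i < 1" using xy(1,2) by (simp_all add: C_def)
      ultimately have "k = 0" by linarith
      then show ?thesis using k by simp
    qed
    then show ?thesis by (simp add: vec_eq_iff)
  qed
  have iv_diff: "integral_vector (a - b)" if "integral_vector a" "integral_vector b" for a b :: "real ^ 'm"
    using that by (simp add: integral_vector_def)
  have djG: "disjoint_family_on G Z"
    unfolding disjoint_family_on_def
  proof (intro ballI impI equals0I)
    fix a b x assume ab: "a \<in> Z" "b \<in> Z" "a \<noteq> b" "x \<in> G a \<inter> G b"
    then have "x - a = x - b" using iv_diff[of b a] by (intro C_eq) (auto simp: G_def Z_def)
    then show False using ab by simp
  qed
  have djF: "disjoint_family_on F Z"
    unfolding disjoint_family_on_def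
  proof (intro ballI impI equals0I)
    fix a b x assume ab: "a \<in> Z" "b \<in> Z" "a \<noteq> b" "x \<in> F a \<inter> F b"
    then have "a + x = b + x" using iv_diff[of a b] by (intro no) (auto simp: F_def Z_def)
    then show False using ab by simp
  qed
  have "emeasure lborel E = (\<integral>\<^sup>+z. emeasure lborel (G z) \<partial>count_space Z)"
    unfolding E_eq using Gb Zc djG by (intro emeasure_UN_countable) auto
  also have "\<dots> = (\<integral>\<^sup>+z. emeasure lborel (F z) \<partial>count_space Z)" by (simp add: GF)
  also have "\<dots> = emeasure lborel (\<Union>z\<in>Z. F z)"
    using Fb Zc djF by (intro emeasure_UN_countable[symmetric]) auto
  also have "\<dots> \<le> emeasure lborel (cbox 0 (\<chi> i. 1) :: (real ^ 'm) set)"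
    by (intro emeasure_mono) (auto simp: F_def C_def mem_box_cart less_imp_le)
  also have "\<dots> = 1"
    by (subst emeasure_lborel_cbox) (auto simp: inner_Basis Basis_vec_def inner_axis prod.neutral)
  finally show False using big by simp
qed

text \<open>Blichfeldt's theorem for the preimage under \<open>A\<close> of a centred cube of side
  \<open>s\<close>: its volume \<open>s ^ CARD('m) / \<bar>det A\<bar>\<close> exceeds 1, and
  differences of points of that cube have coordinates below \<open>s\<close>.\<close>

lemma minkowski_linear_forms:
  fixes A :: "real ^ 'm::{finite,wellorder} ^ 'm::_"
  assumes det: "det A \<noteq> 0" "\<bar>det A\<bar> < s ^ CARD('m)" and s: "0 < s"
  obtains z where "integral_vector z" "z \<noteq> 0" "\<And>i. \<bar>(A *v z) $ i\<bar> < s"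
proof -
  define b :: "(real ^ 'm::_) set" where "b = box (\<chi> i. - (s / 2)) (\<chi> i. s / 2)"
  have mb: "measure lebesgue b = s ^ CARD('m)"
  proof -
    have *: "((\<chi> i. s / 2) - (\<chi> i. - (s / 2)) :: real ^ 'm::_) \<bullet> v = s"
      "(\<chi> i. - (s / 2)) \<bullet> v \<le> (\<chi> i. s / 2) \<bullet> v" if "v \<in> Basis" for v
      using that s by (auto simp: Basis_vec_def inner_axis)
    have "measure lborel b = (\<Prod>v\<in>(Basis :: (real ^ 'm::_) set). s)"
      unfolding b_def measure_lborel_box_eq using * by (auto intro!: prod.cong)
    then show ?thesis by (simp add: b_def)
  qed
  obtain B where AB: "A ** B = mat 1" and BA: "B ** A = mat 1"
    using det(1) invertible_det_nz[of A] by (auto simp: invertible_def)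
  define E where "E = (*v) B ` b"
  have b_lm: "b \<in> lmeasurable" by (simp add: b_def)
  have "E \<in> lmeasurable" unfolding E_def using b_lm by (intro Change_Of_Vars.measurable_linear_image[OF matrix_vector_mul_linear])
  have E_eq: "E = (*v) A -` b"
  proof
    show "E \<subseteq> (*v) A -` b" by (auto simp: E_def matrix_vector_mul_assoc AB)
    show "(*v) A -` b \<subseteq> E"
    proof
      fix x assume "x \<in> (*v) A -` b"
      moreover have "x = B *v (A *v x)" by (simp add: matrix_vector_mul_assoc BA)
      ultimately show "x \<in> E" unfolding E_def by blast
    qed
  qed
  have "open E" unfolding E_eq b_def by (intro open_vimage open_box) (auto intro!: continuous_intros matrix_vector_mult_linear_continuous_on)
  then have Eb: "E \<in> sets borel" by simp
  have "(*v) A ` E = b" by (auto simp: E_def image_image matrix_vector_mul_assoc AB)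
  then have "s ^ CARD('m) = \<bar>det A\<bar> * measure lebesgue E"
    using measure_linear_image[of "(*v) A" E] \<open>E \<in> lmeasurable\<close> mb by (simp add: matrix_vector_mul_linear)
  then have "\<bar>det A\<bar> * 1 < \<bar>det A\<bar> * measure lebesgue E" using det by simp
  then have "1 < measure lebesgue E" using det(1) by (simp add: mult_less_cancel_left)
  then have "1 < measure lborel E" using Eb by (simp add: measure_completion)
  then have "1 < emeasure lborel E"
    by (metis emeasure_eq_ennreal_measure ennreal_1 ennreal_less_iff ennreal_one_less_top top.not_eq_extremum zero_le_one)
  then obtain x y where xy: "x \<in> E" "y \<in> E" "x \<noteq> y" "integral_vector (x - y)"
    using blichfeldt[OF Eb] by metis
  show thesis
  proof (rule that[of "x - y"])
    fix i
    have "- (s / 2) < (A *v x) $ i" "(A *v x) $ i < s / 2" "- (s / 2) < (A *v y) $ i" "(A *v y) $ i < s / 2"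
      using xy(1,2) unfolding E_eq b_def by (simp_all add: mem_box_cart)
    then show "\<bar>(A *v (x - y)) $ i\<bar> < s" by (simp add: matrix_vector_mult_diff_distrib abs_less_iff)
  qed (use xy in auto)
qed

section \<open>Weights of rational subspaces\<close>

lemma integral_vector_sum:
  "(\<And>i. i \<in> I \<Longrightarrow> integral_vector (g i)) \<Longrightarrow> integral_vector (\<Sum>i\<in>I. g i)"
  by (simp add: integral_vector_def sum_component Ints_sum)

lemma integral_vector_scaleR: "c \<in> \<int> \<Longrightarrow> integral_vector v \<Longrightarrow> integral_vector (c *\<^sub>R v)"
  by (simp add: integral_vector_def)

definition minimal_basis :: "(real ^ 'm::finite) set \<Rightarrow> nat \<Rightarrow> real ^ 'm" where
  "minimal_basis V = (SOME w. integral_basis V w \<and>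
     (\<forall>w' (H :: real ^ 'm \<Rightarrow> real ^ 'm) \<sigma>. integral_basis V w' \<longrightarrow> linear H \<longrightarrow>
       \<bar>plucker (dim V) (\<lambda>i. H (w i)) \<sigma>\<bar> \<le> \<bar>plucker (dim V) (\<lambda>i. H (w' i)) \<sigma>\<bar>))"

text \<open>Up to a constant factor, \<open>weight H V\<close> is the covolume of the image under \<open>H\<close> of the
  integral points of \<open>V\<close>.\<close>

definition weight :: "(real ^ 'm \<Rightarrow> real ^ 'm) \<Rightarrow> (real ^ 'm::finite) set \<Rightarrow> real" where
  "weight H V = Max (range (\<lambda>\<sigma>. \<bar>plucker (dim V) (\<lambda>i. H (minimal_basis V i)) \<sigma>\<bar>))"

lemma minimal_basis:
  fixes V :: "(real ^ 'm::finite) set"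
  assumes "integral_basis V w"
  shows integral_basis_minimal_basis: "integral_basis V (minimal_basis V)"
    and plucker_minimal_basis_le: "\<And>(H :: real ^ 'm \<Rightarrow> real ^ 'm) \<sigma>. linear H \<Longrightarrow>
      \<bar>plucker (dim V) (\<lambda>i. H (minimal_basis V i)) \<sigma>\<bar> \<le> \<bar>plucker (dim V) (\<lambda>i. H (w i)) \<sigma>\<bar>"
proof -
  note mb = someI_ex[OF minimal_integral_basis[OF assms], folded minimal_basis_def]
  show "integral_basis V (minimal_basis V)" using mb by (rule conjunct1)
  show "\<bar>plucker (dim V) (\<lambda>i. H (minimal_basis V i)) \<sigma>\<bar> \<le> \<bar>plucker (dim V) (\<lambda>i. H (w i)) \<sigma>\<bar>"
    if "linear H" for H :: "real ^ 'm \<Rightarrow> real ^ 'm" and \<sigma>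
    using mb assms that by (elim conjE allE[of _ w] allE[of _ H] allE[of _ \<sigma>] impE)
qed

lemma weight_attained:
  obtains \<sigma> where "weight H V = \<bar>plucker (dim V) (\<lambda>i. H (minimal_basis V i)) \<sigma>\<bar>"
proof -
  have "weight H V \<in> range (\<lambda>\<sigma>. \<bar>plucker (dim V) (\<lambda>i. H (minimal_basis V i)) \<sigma>\<bar>)"
    unfolding weight_def by (rule Max_in) auto
  then show thesis using that by blast
qed

lemma plucker_le_weight: "\<bar>plucker (dim V) (\<lambda>i. H (minimal_basis V i)) \<sigma>\<bar> \<le> weight H V"
  unfolding weight_def by (rule Max_ge) auto

lemma integral_basis_extend:
  fixes V :: "(real ^ 'm::finite) set"
  assumes w: "integral_basis V w" and v: "integral_vector v" "v \<notin> V"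
  shows "dim (span (insert v V)) = Suc (dim V)" "integral_basis (span (insert v V)) (w(dim V := v))"
proof -
  have sp: "span V = V" using w span_span unfolding integral_basis_def by metis
  show d: "dim (span (insert v V)) = Suc (dim V)" 
  proof -
    have "v \<notin> span V" using v(2) sp by metis
    then show ?thesis by (simp add: dim_insert)
  qed
  have "(w(dim V := v)) ` {..<Suc (dim V)} = insert v (w ` {..<dim V})" by (auto simp: lessThan_Suc)
  moreover have "span (insert v (w ` {..<dim V})) = span (insert v V)"
    using w unfolding integral_basis_def by (simp add: span_insert sp)
  ultimately show "integral_basis (span (insert v V)) (w(dim V := v))"
    unfolding integral_basis_def d using w v by (auto simp: integral_basis_def less_Suc_eq)
qed

text \<open>Expand along the new vector. The extended basis need not be minimal for the larger
  space, but passing to a minimal one can only lower the coordinates.\<close>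

lemma weight_extend:
  fixes V :: "(real ^ 'm::finite) set"
  assumes V: "integral_basis V w" and v: "integral_vector v" "v \<notin> V"
    and H: "linear H" and B: "\<And>l. \<bar>H v $ l\<bar> \<le> B"
  shows "weight H (span (insert v V)) \<le> real CARD('m) * B * weight H V"
proof -
  let ?V = "span (insert v V)" and ?j = "dim V" and ?w = "minimal_basis V"
  have w: "integral_basis V ?w" using V by (rule integral_basis_minimal_basis)
  note ext = integral_basis_extend[OF w v]
  have "dim ?V \<le> CARD('m)" using dim_subset_UNIV[of ?V] by simp
  then have "?j < CARD('m)" using ext(1) by simp
  then obtain k :: 'm where k: "index_enum k = ?j" by (rule index_enum_surj)
  obtain \<sigma> where "weight H ?V = \<bar>plucker (dim ?V) (\<lambda>i. H (minimal_basis ?V i)) \<sigma>\<bar>" by (rule weight_attained)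
  also have "\<dots> \<le> \<bar>plucker (dim ?V) (\<lambda>i. H ((?w(?j := v)) i)) \<sigma>\<bar>"
    using plucker_minimal_basis_le[OF ext(2) H] .
  also have "(\<lambda>i. H ((?w(?j := v)) i)) = (\<lambda>i. H (?w i))(?j := H v)" by auto
  also have "plucker (dim ?V) ((\<lambda>i. H (?w i))(?j := H v)) \<sigma> =
      (\<Sum>l\<in>UNIV. H v $ l * plucker ?j (\<lambda>i. H (?w i)) (\<sigma>(k := l)))"
    unfolding ext(1) by (rule plucker_expand[OF k])
  also have "\<bar>\<dots>\<bar> \<le> (\<Sum>l\<in>(UNIV :: 'm set). B * weight H V)"
  proof (rule order_trans[OF sum_abs], rule sum_mono)
    fix l
    show "\<bar>H v $ l * plucker ?j (\<lambda>i. H (?w i)) (\<sigma>(k := l))\<bar> \<le> B * weight H V"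
      unfolding abs_mult using B[of l] by (intro mult_mono plucker_le_weight) auto
  qed
  finally show ?thesis by simp
qed

lemma weight_lower_bound:
  fixes V :: "(real ^ 'm::{finite,wellorder}) set"
  assumes V: "integral_basis V w0" and H: "linear H" "inj H"
    and s: "0 < s" "real CARD('m) * s < e"
    and long: "\<And>v. integral_vector v \<Longrightarrow> v \<noteq> 0 \<Longrightarrow> \<exists>i. e \<le> \<bar>H v $ i\<bar>"
  shows "s ^ dim V \<le> weight H V"
proof (rule ccontr)
  assume "\<not> ?thesis"
  then have small: "weight H V < s ^ dim V" by simp
  define j where "j = dim V"
  define w where "w = minimal_basis V"
  have jm: "j \<le> CARD('m)" using dim_subset_UNIV[of V] by (simp add: j_def)
  have w: "integral_basis V w" unfolding w_def using V by (rule integral_basis_minimal_basis)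
  have wint: "integral_vector (w i)" if "i < j" for i using w that by (simp add: integral_basis_def j_def)
  have "dim ((\<lambda>i. H (w i)) ` {..<j}) = j"
  proof -
    have "dim (H ` (w ` {..<j})) = dim (w ` {..<j})" using H(2) by (intro dim_image_eq[OF H(1)]) (auto intro: inj_on_subset)
    moreover have "dim (w ` {..<j}) = j" using w dim_span[of "w ` {..<j}"] by (simp add: integral_basis_def j_def)
    ultimately show ?thesis by (simp add: image_image)
  qed
  then obtain \<tau> where "plucker j (\<lambda>i. H (w i)) \<tau> \<noteq> 0" using plucker_nonzero jm by blast
  then have "0 < \<bar>plucker j (\<lambda>i. H (w i)) \<tau>\<bar>" by simp
  moreover have le_weight: "\<bar>plucker j (\<lambda>i. H (w i)) \<sigma>\<bar> \<le> weight H V" for \<sigma>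
    unfolding j_def w_def by (rule plucker_le_weight)
  ultimately have pos: "0 < weight H V" by (rule less_le_trans)
  obtain \<sigma> where "weight H V = \<bar>plucker (dim V) (\<lambda>i. H (minimal_basis V i)) \<sigma>\<bar>"
    by (rule weight_attained)
  then have \<sigma>: "weight H V = \<bar>plucker j (\<lambda>i. H (w i)) \<sigma>\<bar>" by (simp only: j_def w_def)
  \<comment> \<open>Since \<sigma> gives a largest coordinate, replacing one filling row by another
    standard vector cannot increase the absolute determinant.\<close>
  define M :: "real ^ 'm::_ ^ 'm::_" where
    "M = (\<chi> i. if index_enum i < j then H (w (index_enum i)) else axis (\<sigma> i) 1)"
  have detM: "\<bar>det M\<bar> = weight H V" by (simp add: \<sigma> plucker_def M_def)
  define c where "c i = (if index_enum (i :: 'm) < j then 1 else s)" for i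
  define M' :: "real ^ 'm::_ ^ 'm::_" where "M' = (\<chi> i. c i *s M $ i)"
  have "(\<Prod>i\<in>UNIV. c i) = s ^ (CARD('m) - j)"
  proof -
    have "(\<Prod>i\<in>UNIV. c i) = (\<Prod>l<CARD('m). if l < j then 1 else s)"
      unfolding c_def using prod.reindex_bij_betw[OF bij_index_enum[where 'm = 'm], of "\<lambda>l. if l < j then 1 else s"] by simp
    also have "\<dots> = (\<Prod>l\<in>{j..<CARD('m)}. s)"
      by (intro prod.mono_neutral_cong_right) auto
    finally show ?thesis by simp
  qed
  then have "\<bar>det M'\<bar> = s ^ (CARD('m) - j) * weight H V"
    unfolding M'_def det_rows_mul using s(1) detM by (simp add: abs_mult)
  moreover have "s ^ (CARD('m) - j) * weight H V < s ^ (CARD('m) - j) * s ^ j"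
    using small s(1) by (simp add: j_def)
  moreover have "s ^ (CARD('m) - j) * s ^ j = s ^ CARD('m)" using jm by (simp add: power_add[symmetric])
  ultimately have "\<bar>det (transpose M')\<bar> < s ^ CARD('m)" and nz: "det (transpose M') \<noteq> 0"
    using s(1) pos by auto
  then obtain z where z: "integral_vector z" "z \<noteq> 0" "\<And>i. \<bar>(transpose M' *v z) $ i\<bar> < s"
    using minkowski_linear_forms[of "transpose M'" s] s(1) by blast
  define u where "u = (\<Sum>i\<in>UNIV. if index_enum i < j then z $ i *\<^sub>R w (index_enum i) else 0)"
  define q where "q = (\<Sum>i\<in>UNIV. if index_enum i < j then 0 else z $ i *\<^sub>R (axis (\<sigma> i) 1 :: real ^ 'm::_))"
  have Hu: "H u = (\<Sum>i\<in>UNIV. if index_enum i < j then z $ i *\<^sub>R M $ i else 0)"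
    unfolding u_def linear_sum[OF H(1)] using H(1)
    by (intro sum.cong) (auto simp: M_def linear_scale linear_0)
  \<comment> \<open>The transpose makes \<open>z\<close> the coefficients of the rows:
    \<open>u\<close> collects the rows from \<open>V\<close>, \<open>q\<close> the filling
    rows.\<close>
  have Az: "transpose M' *v z = H u + s *\<^sub>R q"
  proof -
    have "transpose M' *v z = (\<Sum>i\<in>UNIV. z $ i *s (c i *s M $ i))"
      unfolding matrix_mult_sum
      by (intro sum.cong) (auto simp: M'_def column_def transpose_def vec_eq_iff)
    also have "\<dots> = (\<Sum>i\<in>UNIV. (if index_enum i < j then z $ i *\<^sub>R M $ i else 0) +
        s *\<^sub>R (if index_enum i < j then 0 else z $ i *\<^sub>R (axis (\<sigma> i) 1 :: real ^ 'm::_)))"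
      by (intro sum.cong) (auto simp: c_def M_def scalar_mult_eq_scaleR)
    also have "\<dots> = H u + s *\<^sub>R q" unfolding Hu q_def by (simp add: sum.distrib scaleR_sum_right)
    finally show ?thesis .
  qed
  have zi: "z $ i \<in> \<int>" for i using z(1) by (simp add: integral_vector_def)
  have iu: "integral_vector u" unfolding u_def
    using zi wint by (intro integral_vector_sum) (auto intro!: integral_vector_scaleR simp: integral_vector_def[of 0])
  have iq: "integral_vector q" unfolding q_def
    using zi by (intro integral_vector_sum) (auto simp: integral_vector_def axis_def)
  show False
  proof (cases "u = 0")
    case True
    have "q $ l = 0" for l
    proof -
      have "\<bar>s * q $ l\<bar> < s" using z(3)[of l] unfolding Az True linear_0[OF H(1)] by simp
      then have "\<bar>q $ l\<bar> < 1" using s(1) by (simp add: abs_mult)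
      moreover obtain k where "q $ l = real_of_int k" using iq by (metis Ints_cases integral_vector_def)
      ultimately show ?thesis by auto
    qed
    then have "transpose M' *v z = 0" unfolding Az True linear_0[OF H(1)] by (simp add: vec_eq_iff)
    moreover have "invertible (transpose M')" using nz by (simp add: invertible_det_nz)
    ultimately have "z = 0" by (meson invertible_left_inverse matrix_left_invertible_ker)
    then show False using z(2) by simp
  next
    case False
    then obtain l0 where l0: "e \<le> \<bar>H u $ l0\<bar>" using long iu by blast
    define F where "F = \<sigma> ` {i. \<not> index_enum i < j}"
    have off: "\<bar>H u $ l\<bar> < s" if "l \<notin> F" for l
    proof -
      have "q $ l = 0" unfolding q_def sum_component using that
        by (intro sum.neutral) (auto simp: F_def axis_def)
      then show ?thesis using z(3)[of l] unfolding Az by simp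
    qed
    have sle: "s \<le> real CARD('m) * s" using s(1) by simp
    show False
    proof (cases "l0 \<in> F")
      case False
      then show False using off[OF False] l0 s sle by linarith
    next
      case True
      then obtain k where k: "l0 = \<sigma> k" "\<not> index_enum k < j" by (auto simp: F_def)
      have row: "det (\<chi> i. if i = k then axis l 1 else M $ i) = plucker j (\<lambda>i. H (w i)) (\<sigma>(k := l))" for l
        unfolding plucker_def M_def using k(2) by (intro arg_cong[of _ _ det] Cart_lambda_cong) auto
      have row_le: "\<bar>det (\<chi> i. if i = k then axis l 1 else M $ i)\<bar> \<le> weight H V" for l
        unfolding row by (rule le_weight)
      have dup: "det (\<chi> i. if i = k then M $ a else M $ i) = 0" if "a \<noteq> k" for a
        using that by (intro det_identical_rows[of k a]) (auto simp: row_def)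
      \<comment> \<open>\<open>H u\<close> is a combination of the first \<open>j\<close> rows, so
        placing it in row \<open>k\<close> gives determinant 0. Expanding it in standard vectors
        turns this into a linear relation between the coordinates of \<open>H u\<close>, which is
        solved for coordinate \<open>l0\<close>.\<close>
      have "(\<Sum>l\<in>UNIV. H u $ l * det (\<chi> i. if i = k then axis l 1 else M $ i)) =
          det (\<chi> i. if i = k then \<Sum>l\<in>UNIV. H u $ l *s axis l 1 else M $ i)"
        by (subst det_linear_row_sum) (auto simp: det_row_mul)
      also have "(\<Sum>l\<in>UNIV. H u $ l *s axis l 1) =
          (\<Sum>a\<in>UNIV. (if index_enum a < j then z $ a else 0) *s M $ a)"
        unfolding basis_expansion Hu by (intro sum.cong) (auto simp: scalar_mult_eq_scaleR)
      also have "det (\<chi> i. if i = k then \<Sum>a\<in>UNIV. (if index_enum a < j then z $ a else 0) *s M $ a else M $ i) =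
          (\<Sum>a\<in>UNIV. (if index_enum a < j then z $ a else 0) * det (\<chi> i. if i = k then M $ a else M $ i))"
        by (subst det_linear_row_sum) (auto simp: det_row_mul)
      also have "\<dots> = 0"
      proof (intro sum.neutral ballI)
        fix a
        show "(if index_enum a < j then z $ a else 0) * det (\<chi> i. if i = k then M $ a else M $ i) = 0"
          using k(2) dup[of a] by (cases "index_enum a < j") auto
      qed
      finally have zero: "(\<Sum>l\<in>UNIV. H u $ l * det (\<chi> i. if i = k then axis l 1 else M $ i)) = 0" .
      have self: "(\<chi> i. if i = k then axis l0 1 else M $ i) = M"
        using k by (auto simp: vec_eq_iff M_def)
      have "H u $ l0 * det M = - (\<Sum>l\<in>UNIV - {l0}. H u $ l * det (\<chi> i. if i = k then axis l 1 else M $ i))"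
        using zero by (subst (asm) sum.remove[of _ l0]) (auto simp: self)
      then have "\<bar>H u $ l0\<bar> * weight H V =
          \<bar>\<Sum>l\<in>UNIV - {l0}. H u $ l * det (\<chi> i. if i = k then axis l 1 else M $ i)\<bar>"
        unfolding detM[symmetric] abs_mult[symmetric] by (simp only: abs_minus_cancel)
      also have "\<dots> \<le> (\<Sum>l\<in>UNIV - {l0}. s * weight H V)"
      proof (rule order_trans[OF sum_abs], rule sum_mono)
        fix l assume l: "l \<in> UNIV - {l0}"
        show "\<bar>H u $ l * det (\<chi> i. if i = k then axis l 1 else M $ i)\<bar> \<le> s * weight H V"
        \<comment> \<open>A coordinate used by another filling row would repeat that row and
          contributes 0; all coordinates outside \<open>F\<close> are below
          \<open>s\<close>.\<close>
        proof (cases "l \<in> F")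
          case True
          then obtain k' where k': "l = \<sigma> k'" "\<not> index_enum k' < j" by (auto simp: F_def)
          have "k' \<noteq> k" using l k k' by auto
          moreover have "M $ k' = axis l 1" using k' by (simp add: M_def)
          ultimately have "det (\<chi> i. if i = k then axis l 1 else M $ i) = 0" using dup[of k'] by metis
          then show ?thesis using s(1) pos by simp
        next
          case False
          then show ?thesis unfolding abs_mult
            using off[OF False] row_le[of l] s(1) by (intro mult_mono) auto
        qed
      qed
      also have "\<dots> \<le> (\<Sum>l\<in>(UNIV :: 'm set). s * weight H V)"
        using s(1) pos by (intro sum_mono2) auto
      also have "\<dots> = real CARD('m) * s * weight H V" by simp
      finally have "\<bar>H u $ l0\<bar> \<le> real CARD('m) * s" using pos by simp
      then show False using l0 s(2) by linarith
    qed
  qed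
qed

section \<open>The Dani correspondence\<close>

text \<open>The coordinates \<open>(q0, q)\<close> of the lattice, as a type of class \<open>wellorder\<close>: the library's
  formula for the volume of a linear image is restricted to such index types.\<close>

typedef 'n coord = "UNIV :: 'n option set" by simp

instance coord :: (finite) finite
proof
  have "(UNIV :: 'a coord set) = Abs_coord ` UNIV" by (metis Rep_coord_inverse surj_def)
  then show "finite (UNIV :: 'a coord set)" by (metis finite_imageI finite_class.finite_UNIV)
qed

instantiation coord :: (finite) wellorder
begin

definition less_eq_coord :: "'a coord \<Rightarrow> 'a coord \<Rightarrow> bool" where
  "less_eq_coord x y \<longleftrightarrow> index_enum (Rep_coord x) \<le> index_enum (Rep_coord y)"
definition less_coord :: "'a coord \<Rightarrow> 'a coord \<Rightarrow> bool" where
  "less_coord x y \<longleftrightarrow> index_enum (Rep_coord x) < index_enum (Rep_coord y)"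

instance
proof
  fix P :: "'a coord \<Rightarrow> bool" and a
  assume step: "\<And>x. (\<And>y. y < x \<Longrightarrow> P y) \<Longrightarrow> P x"
  show "P a"
  proof (induction a rule: measure_induct_rule[where f = "\<lambda>x. index_enum (Rep_coord x)"])
    case (less x)
    show ?case by (rule step) (rule less, simp only: less_coord_def)
  qed
qed (auto simp: less_eq_coord_def less_coord_def Rep_coord_inject)

end

abbreviation const_coord :: "'n coord" where "const_coord \<equiv> Abs_coord None"
abbreviation lin_coord :: "'n \<Rightarrow> 'n coord" where "lin_coord i \<equiv> Abs_coord (Some i)"

lemma all_coord_iff: "(\<forall>k. P k) \<longleftrightarrow> P const_coord \<and> (\<forall>i. P (lin_coord i))"
  by (metis Abs_coord_cases option.exhaust)

text \<open>This is the matrix product \<open>g\<^sub>t u\<^sub>x\<close> of the Dani correspondence, for \<open>Q = e\<^bsup>t/n\<^esup>\<close>.\<close>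

definition flow :: "real \<Rightarrow> real ^ 'n \<Rightarrow> real ^ 'n coord \<Rightarrow> real ^ ('n::finite) coord" where
  "flow Q x v = (\<chi> k. case Rep_coord k of
      None \<Rightarrow> Q ^ CARD('n) * (v $ const_coord + (\<Sum>i\<in>UNIV. x $ i * v $ lin_coord i))
    | Some i \<Rightarrow> v $ lin_coord i / Q)"

lemma flow_const [simp]:
  "flow Q (x :: real ^ 'n::finite) v $ const_coord =
    Q ^ CARD('n) * (v $ const_coord + (\<Sum>i\<in>UNIV. x $ i * v $ lin_coord i))"
  by (simp add: flow_def Abs_coord_inverse)

lemma flow_lin [simp]: "flow Q x v $ lin_coord i = v $ lin_coord i / Q"
  by (simp add: flow_def Abs_coord_inverse)

lemma linear_flow: "linear (flow Q x)"
proof (rule linearI)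
  show "flow Q x (v + w) = flow Q x v + flow Q x w" for v w
    unfolding vec_eq_iff all_coord_iff
    by (simp add: algebra_simps sum.distrib add_divide_distrib)
  show "flow Q x (c *\<^sub>R v) = c *\<^sub>R flow Q x v" for c v
    unfolding vec_eq_iff all_coord_iff
    by (simp add: algebra_simps sum_distrib_left)
qed

lemma inj_flow:
  assumes "0 < Q"
  shows "inj (flow Q x)"
proof -
  have "v = 0" if "flow Q x v = 0" for v
  proof -
    have "flow Q x v $ lin_coord i = 0" "flow Q x v $ const_coord = 0" for i using that by simp_all
    then show ?thesis unfolding vec_eq_iff all_coord_iff using assms by simp
  qed
  then show ?thesis unfolding linear_injective_0[OF linear_flow] by blast
qed

text \<open>\<open>x\<close> enters \<open>flow Q x v\<close> only in the coordinate
  \<open>const_coord\<close>, that is in one row of the transposed matrix, and the determinant is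
  affine in that row.\<close>

lemma plucker_flow_affine:
  obtains c0 :: real and c :: "real ^ 'n::finite"
  where "\<And>x. plucker j (\<lambda>i. flow Q x (w i)) \<sigma> = c0 + (\<Sum>l\<in>UNIV. c $ l * x $ l)"
proof -
  define b where "b = (\<lambda>k. \<chi> i. if index_enum i < j then flow Q 0 (w (index_enum i)) $ k else axis (\<sigma> i) (1::real) $ k :: real ^ 'n coord)"
  define d where "d = (\<lambda>l. \<chi> i. if index_enum i < j then Q ^ CARD('n) * w (index_enum i) $ lin_coord l else 0 :: real ^ 'n coord)"
  \<comment> \<open>The idle conditional is the shape in which \<open>det_row_add\<close> leaves
    this summand.\<close>
  define c0 where "c0 = det (\<chi> k. if k = const_coord then b k else b k)"
  define c :: "real ^ 'n" where "c = (\<chi> l. det (\<chi> k. if k = const_coord then d l else b k))"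
  show thesis
  proof (rule that)
    fix x :: "real ^ 'n"
    have "plucker j (\<lambda>i. flow Q x (w i)) \<sigma> =
        det (transpose (\<chi> i. if index_enum i < j then flow Q x (w (index_enum i)) else axis (\<sigma> i) 1))"
      by (simp add: plucker_def)
    also have "transpose (\<chi> i. if index_enum i < j then flow Q x (w (index_enum i)) else axis (\<sigma> i) 1) =
        (\<chi> k. if k = const_coord then b k + (\<Sum>l\<in>UNIV. x $ l *s d l) else b k)"
      unfolding vec_eq_iff[of "transpose _"] all_coord_iff
      by (simp add: Abs_coord_inject vec_eq_iff transpose_def b_def d_def sum_distrib_left algebra_simps)
    also have "det \<dots> = c0 + (\<Sum>l\<in>UNIV. c $ l * x $ l)"
      unfolding det_row_add c0_def
      by (simp add: det_linear_row_sum det_row_mul c_def mult.commute)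
    finally show "plucker j (\<lambda>i. flow Q x (w i)) \<sigma> = c0 + (\<Sum>l\<in>UNIV. c $ l * x $ l)" .
  qed
qed

section \<open>Continuity of weights and flags of rational subspaces\<close>

lemma continuous_on_Max:
  fixes g :: "'i \<Rightarrow> 'a::topological_space \<Rightarrow> real"
  assumes "finite I" "I \<noteq> {}" "\<And>i. i \<in> I \<Longrightarrow> continuous_on A (g i)"
  shows "continuous_on A (\<lambda>x. Max ((\<lambda>i. g i x) ` I))"
  using assms
proof (induction I rule: finite_ne_induct)
  case (insert i I)
  have "(\<lambda>x. Max ((\<lambda>i. g i x) ` insert i I)) = (\<lambda>x. max (g i x) (Max ((\<lambda>i. g i x) ` I)))"
    using insert by auto
  then show ?case using insert by (auto intro!: continuous_on_max)
qed simp

lemma continuous_on_weight_flow: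
  fixes f :: "'a::topological_space \<Rightarrow> real ^ 'n::finite"
  assumes f: "continuous_on A f"
  shows "continuous_on A (\<lambda>x. weight (flow Q (f x)) V)"
  unfolding weight_def
proof (rule continuous_on_Max)
  fix \<sigma> :: "'n coord \<Rightarrow> 'n coord"
  obtain c0 c where c: "\<And>x. plucker (dim V) (\<lambda>i. flow Q x (minimal_basis V i)) \<sigma> = c0 + (\<Sum>l\<in>UNIV. c $ l * x $ l)"
    using plucker_flow_affine[of "dim V" Q "minimal_basis V" \<sigma>] by metis
  show "continuous_on A (\<lambda>x. \<bar>plucker (dim V) (\<lambda>i. flow Q (f x) (minimal_basis V i)) \<sigma>\<bar>)"
    unfolding c using f by (intro continuous_intros)
qed auto

text \<open>The zero subspace is left out: its weight does not depend on \<open>H\<close>, and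
  without it the dimensions in a chain lie between 1 and \<open>CARD('m)\<close>.\<close>

definition rational_subspaces :: "(real ^ 'm::finite) set set" where
  "rational_subspaces = {V. 0 < dim V \<and> (\<exists>w. integral_basis V w)}"

lemma rational_subspaces_subspace:
  assumes "V \<in> rational_subspaces"
  shows "subspace V"
proof -
  obtain w where "span (w ` {..<dim V}) = V"
    using assms by (auto simp: rational_subspaces_def integral_basis_def)
  then show ?thesis by (metis subspace_span)
qed

lemma card_chain_rational_subspaces:
  fixes F :: "(real ^ 'm::finite) set set"
  assumes F: "F \<subseteq> rational_subspaces" and chain: "\<forall>V\<in>F. \<forall>W\<in>F. V \<subseteq> W \<or> W \<subseteq> V"
  shows "card F \<le> CARD('m)"
proof -
  have "inj_on dim F"
  proof (rule inj_onI)
    fix V W assume VW: "V \<in> F" "W \<in> F" "dim V = dim W"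
    then have "subspace V" "subspace W" using F rational_subspaces_subspace by blast+
    then show "V = W" using VW chain subspace_dim_equal[of V W] subspace_dim_equal[of W V] by auto
  qed
  then have "card F = card (dim ` F)" by (simp add: card_image)
  also have "\<dots> \<le> card {1..CARD('m)}"
  proof (rule card_mono)
    show "dim ` F \<subseteq> {1..CARD('m)}"
    proof
      fix n assume "n \<in> dim ` F"
      then obtain V where V: "V \<in> F" "n = dim V" by blast
      then have "0 < n" using F by (auto simp: rational_subspaces_def)
      moreover have "n \<le> CARD('m)" using dim_subset_UNIV[of V] V by simp
      ultimately show "n \<in> {1..CARD('m)}" by simp
    qed
  qed simp
  finally show ?thesis by simp
qed

text \<open>In the flag \<open>F\<close> that marks the point, take the largest member \<open>W\<close> that avoids the given
  vector \<open>v\<close>: the span of \<open>W\<close> and \<open>v\<close> is comparable with the whole flag.\<close>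

lemma marked_imp_long_vectors:
  fixes H :: "'a \<Rightarrow> real ^ 'm::finite \<Rightarrow> real ^ 'm"
  assumes marked: "marked \<epsilon> \<rho> (\<lambda>V z. weight (H z) V) rational_subspaces z"
    and H: "linear (H z)" and \<epsilon>: "0 < \<epsilon>"
    and \<kappa>: "\<rho> \<le> \<kappa>" "weight (H z) {0} \<le> \<kappa>" "0 < \<kappa>"
    and v: "integral_vector v" "v \<noteq> 0"
  shows "\<exists>i. \<epsilon> / (2 * real CARD('m) * \<kappa>) < \<bar>H z v $ i\<bar>"
proof (rule ccontr)
  assume "\<not> ?thesis"
  then have short: "\<bar>H z v $ i\<bar> \<le> \<epsilon> / (2 * real CARD('m) * \<kappa>)" for i by (simp add: not_less)
  obtain F where F: "F \<subseteq> rational_subspaces" and chain: "\<forall>V\<in>F. \<forall>W\<in>F. V \<subseteq> W \<or> W \<subseteq> V"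
    and small: "\<forall>V\<in>F. weight (H z) V \<le> \<rho>"
    and large: "\<forall>V\<in>rational_subspaces. (\<forall>W\<in>F. V \<subseteq> W \<or> W \<subseteq> V) \<longrightarrow> \<epsilon> \<le> weight (H z) V"
    using marked unfolding marked_def by (elim exE conjE) (rule that)
  \<comment> \<open>Adding the zero subspace to the flag guarantees a member that avoids
    \<open>v\<close>; this is why \<open>\<kappa>\<close> must also bound the weight of
    \<open>{0}\<close>.\<close>
  define G where "G = {W\<in>insert {0} F. v \<notin> W}"
  have "{0} \<in> G" using v(2) by (simp add: G_def)
  moreover have "\<forall>W. W \<in> G \<longrightarrow> dim W < Suc CARD('m)"
    using dim_subset_UNIV[where 'a = "real ^ 'm"] by (simp add: less_Suc_eq_le)
  ultimately obtain W where W: "W \<in> G" and mx: "\<And>T. T \<in> G \<Longrightarrow> dim T \<le> dim W"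
    using ex_has_greatest_nat[of "\<lambda>W. W \<in> G" "{0}" dim "Suc CARD('m)"] by blast
  have zero_in: "0 \<in> T" "subspace T" if "T \<in> F" for T
    using F that rational_subspaces_subspace subspace_0 by blast+
  have "subspace W" using W zero_in by (auto simp: G_def)
  have vW: "v \<notin> W" using W by (simp add: G_def)
  have cmpW: "W \<subseteq> T \<or> T \<subseteq> W" if "T \<in> F" for T
    using W chain that zero_in[OF that] by (auto simp: G_def)
  have "\<exists>w. integral_basis W w"
    using W F by (auto simp: G_def rational_subspaces_def integral_basis_def)
  then obtain w where w: "integral_basis W w" by blast
  let ?V = "span (insert v W)"
  note ext = integral_basis_extend[OF w v(1) vW]
  have "?V \<in> rational_subspaces" using ext by (auto simp: rational_subspaces_def)
  moreover have "?V \<subseteq> T \<or> T \<subseteq> ?V" if T: "T \<in> F" for T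
  proof (cases "v \<in> T")
    case True
    then have "insert v W \<subseteq> T" using cmpW[OF T] vW by blast
    then show ?thesis using span_minimal zero_in[OF T] by blast
  next
    case False
    have "T \<subseteq> W"
    proof (rule ccontr)
      assume "\<not> T \<subseteq> W"
      then have "W \<subseteq> T" using cmpW[OF T] by blast
      moreover have "dim T \<le> dim W" using False T by (intro mx) (simp add: G_def)
      ultimately have "W = T" using \<open>subspace W\<close> zero_in[OF T] by (intro subspace_dim_equal) auto
      then show False using \<open>\<not> T \<subseteq> W\<close> by simp
    qed
    then show ?thesis using span_superset[of "insert v W"] by blast
  qed
  ultimately have "\<epsilon> \<le> weight (H z) ?V" using large by blast
  \<comment> \<open>The factor 2 in the denominator leaves \<epsilon> \<le> \<epsilon> / 2, a
    contradiction.\<close>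
  also have "\<dots> \<le> real CARD('m) * (\<epsilon> / (2 * real CARD('m) * \<kappa>)) * weight (H z) W"
    using short by (intro weight_extend[OF w v(1) vW H])
  also have "\<dots> \<le> real CARD('m) * (\<epsilon> / (2 * real CARD('m) * \<kappa>)) * \<kappa>"
  proof (intro mult_left_mono)
    show "weight (H z) W \<le> \<kappa>" using W small \<kappa> by (auto simp: G_def intro: order_trans)
    show "0 \<le> real CARD('m) * (\<epsilon> / (2 * real CARD('m) * \<kappa>))" using \<epsilon> \<kappa>(3) by simp
  qed
  also have "\<dots> = \<epsilon> / 2" using \<kappa>(3) by simp
  finally show False using \<epsilon> by simp
qed

section \<open>The measure of points with short vectors\<close>

definition has_short_vector :: "real \<Rightarrow> real ^ 'n::finite \<Rightarrow> real \<Rightarrow> bool" where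
  "has_short_vector Q x \<delta> \<longleftrightarrow>
    (\<exists>v. integral_vector v \<and> v \<noteq> 0 \<and> (\<forall>i. \<bar>flow Q x v $ i\<bar> < \<delta>))"

text \<open>Half of the limit value e/m is taken for \<open>s\<close>, since
  \<open>weight_lower_bound\<close> needs a strict inequality; the minimum with 1 lets one exponent
  serve all dimensions.\<close>

lemma rational_weight_lower_bound:
  fixes y :: "real ^ 'n::finite" and V :: "(real ^ 'n coord) set"
  assumes e: "0 < e" "\<not> has_short_vector Q y e" and Q: "0 < Q" and V: "V \<in> rational_subspaces"
  shows "min 1 (e / (2 * real CARD('n coord))) ^ CARD('n coord) \<le> weight (flow Q y) V"
proof -
  let ?m = "CARD('n coord)"
  define s where "s = e / (2 * real ?m)"
  obtain w where w: "integral_basis V w" using V by (auto simp: rational_subspaces_def)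
  have s: "0 < s" "real ?m * s < e" using e(1) by (auto simp: s_def)
  have dimV: "dim V \<le> ?m" using dim_subset_UNIV[of V] by simp
  have "min 1 s ^ ?m \<le> min 1 s ^ dim V" using s(1) dimV by (intro power_decreasing) auto
  also have "\<dots> \<le> s ^ dim V" using s(1) by (intro power_mono) auto
  also have "\<dots> \<le> weight (flow Q y) V"
  proof (rule weight_lower_bound[OF w linear_flow inj_flow[OF Q] s])
    fix v :: "real ^ 'n coord" assume "integral_vector v" "v \<noteq> 0"
    then show "\<exists>i. e \<le> \<bar>flow Q y v $ i\<bar>" using e(2) unfolding has_short_vector_def by (meson not_le)
  qed
  finally show ?thesis by (simp add: s_def)
qed

text \<open>Write \<open>y\<close> as an affine combination of points of \<open>X\<close> and let
  \<open>A\<close> be the sum of the absolute coefficients. It depends on \<open>y\<close> and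
  \<open>X\<close> only, which is the source of the uniformity in \<open>Q\<close> and in the
  subspace.\<close>

lemma affine_hull_controls_affine_functions:
  fixes y :: "real ^ 'n::finite"
  assumes "y \<in> affine hull X"
  obtains A where "1 \<le> A" "\<And>c0 c. \<exists>x\<in>X. \<bar>c0 + (\<Sum>l\<in>UNIV. c $ l * y $ l)\<bar> \<le> A * \<bar>c0 + (\<Sum>l\<in>UNIV. c $ l * x $ l)\<bar>"
proof -
  obtain F u where F: "finite F" "F \<noteq> {}" "F \<subseteq> X" and u: "sum u F = 1" "(\<Sum>v\<in>F. u v *\<^sub>R v) = y"
    using assms unfolding affine_hull_explicit by blast
  define A where "A = (\<Sum>v\<in>F. \<bar>u v\<bar>)"
  have "1 \<le> A" using u(1) sum_abs[of u F] by (simp add: A_def)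
  show thesis
  proof (rule that[OF \<open>1 \<le> A\<close>])
    fix c0 :: real and c :: "real ^ 'n"
    define g where "g x = c0 + (\<Sum>l\<in>UNIV. c $ l * x $ l)" for x
    have gy: "g y = (\<Sum>v\<in>F. u v * g v)"
    proof -
      have "(\<Sum>v\<in>F. u v * g v) = c0 * sum u F + (\<Sum>v\<in>F. \<Sum>l\<in>UNIV. c $ l * (u v * v $ l))"
        by (simp add: g_def distrib_left sum.distrib sum_distrib_left mult_ac)
      also have "(\<Sum>v\<in>F. \<Sum>l\<in>UNIV. c $ l * (u v * v $ l)) = (\<Sum>l\<in>UNIV. c $ l * y $ l)"
        unfolding u(2)[symmetric] by (subst sum.swap) (simp add: sum_distrib_left sum_component)
      finally show ?thesis using u(1) by (simp add: g_def)
    qed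
    show "\<exists>x\<in>X. \<bar>c0 + (\<Sum>l\<in>UNIV. c $ l * y $ l)\<bar> \<le> A * \<bar>c0 + (\<Sum>l\<in>UNIV. c $ l * x $ l)\<bar>"
    proof (rule ccontr)
      assume "\<not> ?thesis"
      then have lt: "A * \<bar>g v\<bar> < \<bar>g y\<bar>" if "v \<in> F" for v using F(3) that by (force simp: g_def not_le)
      have "A * \<bar>g y\<bar> \<le> A * (\<Sum>v\<in>F. \<bar>u v\<bar> * \<bar>g v\<bar>)"
        unfolding gy using \<open>1 \<le> A\<close> by (intro mult_left_mono order_trans[OF sum_abs]) (auto simp: abs_mult)
      also have "\<dots> = (\<Sum>v\<in>F. \<bar>u v\<bar> * (A * \<bar>g v\<bar>))" by (simp add: sum_distrib_left mult_ac)
      also have "\<dots> < (\<Sum>v\<in>F. \<bar>u v\<bar> * \<bar>g y\<bar>)"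
      proof (rule sum_strict_mono_ex1[OF F(1)])
        show "\<forall>v\<in>F. \<bar>u v\<bar> * (A * \<bar>g v\<bar>) \<le> \<bar>u v\<bar> * \<bar>g y\<bar>"
          using less_imp_le[OF lt] by (intro ballI mult_left_mono) auto
        obtain v where "v \<in> F" "u v \<noteq> 0" using u(1) by (metis sum.neutral zero_neq_one)
        then show "\<exists>v\<in>F. \<bar>u v\<bar> * (A * \<bar>g v\<bar>) < \<bar>u v\<bar> * \<bar>g y\<bar>"
          using lt[of v] by (intro bexI[of _ v] mult_strict_left_mono) auto
      qed
      also have "\<dots> = A * \<bar>g y\<bar>" by (simp add: A_def sum_distrib_right)
      finally show False by simp
    qed
  qed
qed

text \<open>The local setting shared by \<mu>, with \<open>S\<close> its support, and by Lebesgue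
  measure on the affine subspace, with \<open>S\<close> that subspace and \<open>f\<close> the
  identity. Goodness is stated with the value at one point \<open>z\<close> instead of a supremum,
  which might be infinite. The factor \<open>5 ^ CARD('n coord)\<close> is the room taken up by the
  induction over flags.\<close>

locale good_chart =
  fixes M :: "'a::metric_space measure" and S U :: "'a set" and f :: "'a \<Rightarrow> real ^ 'n::finite"
    and D C \<alpha> :: real and x0 :: 'a and r0 :: real
  assumes sets_M: "sets M = sets borel"
    and U: "open U" "emeasure M U < \<infinity>"
    and D: "1 \<le> D" and C: "0 \<le> C" and \<alpha>: "0 < \<alpha>"
    and pos: "\<And>x r. x \<in> S \<Longrightarrow> 0 < r \<Longrightarrow> 0 < emeasure M (ball x r)"
    and dbl: "\<And>x r. x \<in> S \<Longrightarrow> 0 < r \<Longrightarrow> ball x (3 * r) \<subseteq> U \<Longrightarrow>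
      emeasure M (ball x (3 * r)) \<le> ennreal D * emeasure M (ball x r)"
    and f: "continuous_on UNIV f"
    and good: "\<And>c0 (c :: real ^ 'n) x r z \<epsilon>. \<lbrakk>x \<in> S; 0 < r; ball x r \<subseteq> U; z \<in> ball x r \<inter> S; 0 < \<epsilon>;
        c0 + (\<Sum>i\<in>UNIV. c $ i * f z $ i) \<noteq> 0\<rbrakk> \<Longrightarrow>
        emeasure M {y\<in>ball x r. \<bar>c0 + (\<Sum>i\<in>UNIV. c $ i * f y $ i)\<bar> < \<epsilon>} \<le>
        ennreal (C * (\<epsilon> / \<bar>c0 + (\<Sum>i\<in>UNIV. c $ i * f z $ i)\<bar>) powr \<alpha>) * emeasure M (ball x r)"
    and x0: "x0 \<in> S" and r0: "0 < r0" and chartU: "ball x0 (5 ^ CARD('n coord) * r0) \<subseteq> U"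
begin

text \<open>A maximum of good functions is good: the coordinate that attains the weight at
  \<open>z\<close> lies below the weight everywhere else.\<close>

lemma weight_good:
  assumes x: "x \<in> S" "0 < r" "ball x r \<subseteq> U" and z: "z \<in> ball x r \<inter> S"
    and \<rho>: "0 < \<rho>" "\<rho> \<le> weight (flow Q (f z)) V" and \<epsilon>: "0 < \<epsilon>"
  shows "emeasure M {y\<in>ball x r. weight (flow Q (f y)) V < \<epsilon>} \<le>
    ennreal (C * (\<epsilon> / \<rho>) powr \<alpha>) * emeasure M (ball x r)"
proof -
  obtain \<sigma> where \<sigma>: "weight (flow Q (f z)) V = \<bar>plucker (dim V) (\<lambda>i. flow Q (f z) (minimal_basis V i)) \<sigma>\<bar>"
    by (rule weight_attained)
  obtain c0 c where c: "\<And>x. plucker (dim V) (\<lambda>i. flow Q x (minimal_basis V i)) \<sigma> = c0 + (\<Sum>l\<in>UNIV. c $ l * x $ l)"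
    using plucker_flow_affine[of "dim V" Q "minimal_basis V" \<sigma>] by metis
  let ?g = "\<lambda>y. c0 + (\<Sum>l\<in>UNIV. c $ l * f y $ l)"
  have gz: "\<rho> \<le> \<bar>?g z\<bar>" using \<rho> \<sigma> c by simp
  have "\<bar>?g y\<bar> \<le> weight (flow Q (f y)) V" for y using plucker_le_weight[of V "flow Q (f y)" \<sigma>] c by simp
  then have sub: "{y\<in>ball x r. weight (flow Q (f y)) V < \<epsilon>} \<subseteq> {y\<in>ball x r. \<bar>?g y\<bar> < \<epsilon>}"
    by (auto intro: le_less_trans)
  have op: "open (ball x r \<inter> {y. \<bar>?g y\<bar> < \<epsilon>})"
    using f by (intro open_Int open_ball open_Collect_less continuous_intros)
  have eq: "{y\<in>ball x r. \<bar>?g y\<bar> < \<epsilon>} = ball x r \<inter> {y. \<bar>?g y\<bar> < \<epsilon>}" by blast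
  have "{y\<in>ball x r. \<bar>?g y\<bar> < \<epsilon>} \<in> sets M" unfolding sets_M eq using op by (rule borel_open)
  then have "emeasure M {y\<in>ball x r. weight (flow Q (f y)) V < \<epsilon>} \<le> emeasure M {y\<in>ball x r. \<bar>?g y\<bar> < \<epsilon>}"
    using sub by (intro emeasure_mono)
  also have "\<dots> \<le> ennreal (C * (\<epsilon> / \<bar>?g z\<bar>) powr \<alpha>) * emeasure M (ball x r)"
    using x z \<epsilon> gz \<rho>(1) by (intro good) auto
  also have "\<dots> \<le> ennreal (C * (\<epsilon> / \<rho>) powr \<alpha>) * emeasure M (ball x r)"
    using C \<alpha> \<epsilon> gz \<rho>(1) by (intro mult_right_mono ennreal_leI mult_left_mono powr_mono2 divide_left_mono) auto
  finally show ?thesis .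
qed

text \<open>The constants are fixed before \<open>Q\<close> and \<epsilon>: the weights at
  \<open>y\<close> are at least \<open>\<rho>0\<close> by Minkowski, so over the ball each of them
  reaches \<open>\<rho>0 / A\<close>.\<close>

lemma short_vectors_small_measure:
  assumes y: "y \<in> affine hull (f ` (ball x0 r0 \<inter> S))" and e: "0 < e"
  obtains \<rho> \<kappa> where "0 < \<rho>" "0 < \<kappa>"
    "\<And>Q \<epsilon>. \<lbrakk>0 < Q; \<not> has_short_vector Q y e; 0 < \<epsilon>; \<epsilon> \<le> \<rho>\<rbrakk> \<Longrightarrow>
      \<exists>T\<in>sets M. {z\<in>ball x0 r0 \<inter> S. has_short_vector Q (f z) (\<epsilon> / \<kappa>)} \<subseteq> T \<and>
        emeasure M T \<le> ennreal (\<kappa> * (\<epsilon> / \<rho>) powr \<alpha>)"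
proof -
  let ?m = "CARD('n coord)"
  obtain A where A: "1 \<le> A" "\<And>c0 c. \<exists>x\<in>f ` (ball x0 r0 \<inter> S).
      \<bar>c0 + (\<Sum>l\<in>UNIV. c $ l * y $ l)\<bar> \<le> A * \<bar>c0 + (\<Sum>l\<in>UNIV. c $ l * x $ l)\<bar>"
    by (rule affine_hull_controls_affine_functions[OF y]) (rule that)
  define \<rho>0 where "\<rho>0 = min 1 (e / (2 * real ?m)) ^ ?m"
  define \<rho> where "\<rho> = \<rho>0 / A"
  have "0 < \<rho>0" using e by (auto simp: \<rho>0_def)
  then have \<rho>: "0 < \<rho>" using A(1) by (simp add: \<rho>_def)
  define w0 where "w0 = weight (\<lambda>v :: real ^ 'n coord. v) {0}"
  have w0: "weight H {0} = w0" for H :: "real ^ 'n coord \<Rightarrow> real ^ 'n coord"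
    by (simp add: w0_def weight_def plucker_def)
  define \<kappa>1 where "\<kappa>1 = max \<rho> w0"
  define b where "b = enn2real (emeasure M (ball x0 r0))"
  have r05: "1 * r0 \<le> 5 ^ ?m * r0" using r0 by (intro mult_right_mono) auto
  then have "ball x0 r0 \<subseteq> U" using chartU subset_ball[of r0 "5 ^ ?m * r0" x0] by simp
  then have "emeasure M (ball x0 r0) \<le> emeasure M U" using U(1) sets_M by (intro emeasure_mono) auto
  then have b: "emeasure M (ball x0 r0) = ennreal b"
    unfolding b_def using U(2) by (simp add: le_less_trans less_top)
  have b0: "0 \<le> b" by (simp add: b_def)
  \<comment> \<open>One constant plays two parts: it divides \<epsilon> in the length of the vectors
    and is the factor in the measure bound.\<close>
  define \<kappa> where "\<kappa> = max (2 * real ?m * \<kappa>1) (real ?m * (D ^ 3) ^ ?m * C * b)"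
  have \<kappa>1: "0 < \<kappa>1" using \<rho> by (simp add: \<kappa>1_def)
  have \<kappa>: "0 < \<kappa>" using \<kappa>1 by (simp add: \<kappa>_def less_max_iff_disj)
  show thesis
  proof (rule that[OF \<rho> \<kappa>])
    fix Q \<epsilon> assume Q: "0 < Q" and y_long: "\<not> has_short_vector Q y e" and \<epsilon>: "0 < \<epsilon>" "\<epsilon> \<le> \<rho>"
    let ?\<psi> = "\<lambda>V z. weight (flow Q (f z)) V"
    have sup: "\<exists>z\<in>ball x0 r0 \<inter> S. \<rho> \<le> ?\<psi> V z" if V: "V \<in> rational_subspaces" for V
    proof -
      have "\<rho>0 \<le> weight (flow Q y) V"
        unfolding \<rho>0_def using e y_long Q V by (rule rational_weight_lower_bound)
      also obtain \<sigma> where \<sigma>: "weight (flow Q y) V = \<bar>plucker (dim V) (\<lambda>i. flow Q y (minimal_basis V i)) \<sigma>\<bar>"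
        by (rule weight_attained)
      obtain c0 c where c: "\<And>x. plucker (dim V) (\<lambda>i. flow Q x (minimal_basis V i)) \<sigma> = c0 + (\<Sum>l\<in>UNIV. c $ l * x $ l)"
        using plucker_flow_affine[of "dim V" Q "minimal_basis V" \<sigma>] by metis
      obtain z where z: "z \<in> ball x0 r0 \<inter> S"
        "\<bar>c0 + (\<Sum>l\<in>UNIV. c $ l * y $ l)\<bar> \<le> A * \<bar>c0 + (\<Sum>l\<in>UNIV. c $ l * f z $ l)\<bar>"
        using A(2)[of c0 c] by blast
      note \<sigma>
      also have "\<bar>plucker (dim V) (\<lambda>i. flow Q y (minimal_basis V i)) \<sigma>\<bar> \<le>
          A * \<bar>plucker (dim V) (\<lambda>i. flow Q (f z) (minimal_basis V i)) \<sigma>\<bar>"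
        unfolding c by (rule z(2))
      also have "\<dots> \<le> A * ?\<psi> V z"
        using A(1) by (intro mult_left_mono plucker_le_weight) auto
      finally have "\<rho>0 \<le> A * ?\<psi> V z" .
      then have "\<rho> \<le> ?\<psi> V z" using A(1) by (simp add: \<rho>_def divide_le_eq mult.commute)
      then show ?thesis using z(1) by blast
    qed
    have K: "0 \<le> C * (\<epsilon> / \<rho>) powr \<alpha>" using C by simp
    have "\<exists>T\<in>sets M. {z\<in>ball x0 r0 \<inter> S. \<not> marked \<epsilon> \<rho> ?\<psi> rational_subspaces z} \<subseteq> T \<and>
          emeasure M T \<le> ennreal (real ?m * (D ^ 3) ^ ?m * (C * (\<epsilon> / \<rho>) powr \<alpha>)) * emeasure M (ball x0 r0)"
    proof (rule quantitative_nondivergence[where \<psi> = ?\<psi> and P = rational_subspaces, OF sets_M U D K \<epsilon>(2) pos dbl x0 r0 chartU])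
      show "continuous_on UNIV (?\<psi> V)" for V using f by (rule continuous_on_weight_flow)
      show "emeasure M {y\<in>ball x r. ?\<psi> V y < \<epsilon>} \<le> ennreal (C * (\<epsilon> / \<rho>) powr \<alpha>) * emeasure M (ball x r)"
        if "x \<in> S" "0 < r" "ball x r \<subseteq> U" "z \<in> ball x r \<inter> S" "\<rho> \<le> ?\<psi> V z" for V x r z
        using that \<rho> \<epsilon>(1) by (intro weight_good)
      show "card F \<le> ?m" if "F \<subseteq> rational_subspaces" "\<forall>V\<in>F. \<forall>W\<in>F. V \<subseteq> W \<or> W \<subseteq> V"
        for F :: "(real ^ 'n coord) set set"
        using that by (rule card_chain_rational_subspaces)
      show "\<exists>z\<in>ball x0 r0 \<inter> S. \<rho> \<le> ?\<psi> V z" if "V \<in> rational_subspaces" for V using that by (rule sup)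
    qed
    then obtain T where T: "T \<in> sets M" "{z\<in>ball x0 r0 \<inter> S. \<not> marked \<epsilon> \<rho> ?\<psi> rational_subspaces z} \<subseteq> T"
      "emeasure M T \<le> ennreal (real ?m * (D ^ 3) ^ ?m * (C * (\<epsilon> / \<rho>) powr \<alpha>)) * emeasure M (ball x0 r0)" by blast
    show "\<exists>T\<in>sets M. {z\<in>ball x0 r0 \<inter> S. has_short_vector Q (f z) (\<epsilon> / \<kappa>)} \<subseteq> T \<and>
        emeasure M T \<le> ennreal (\<kappa> * (\<epsilon> / \<rho>) powr \<alpha>)"
    proof (intro bexI[OF _ T(1)] conjI subsetI)
      fix z assume z: "z \<in> {z\<in>ball x0 r0 \<inter> S. has_short_vector Q (f z) (\<epsilon> / \<kappa>)}"
      then obtain v where v: "integral_vector v" "v \<noteq> 0" "\<And>i. \<bar>flow Q (f z) v $ i\<bar> < \<epsilon> / \<kappa>"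
        by (auto simp: has_short_vector_def)
      have "\<not> marked \<epsilon> \<rho> ?\<psi> rational_subspaces z"
      proof
        assume m: "marked \<epsilon> \<rho> ?\<psi> rational_subspaces z"
        obtain i where "\<epsilon> / (2 * real ?m * \<kappa>1) < \<bar>flow Q (f z) v $ i\<bar>"
          using marked_imp_long_vectors[where H = "\<lambda>z. flow Q (f z)", OF m linear_flow \<epsilon>(1), of \<kappa>1 v] v \<kappa>1 w0
          by (auto simp: \<kappa>1_def)
        also have "\<dots> < \<epsilon> / \<kappa>" by (rule v(3))
        also have "\<dots> \<le> \<epsilon> / (2 * real ?m * \<kappa>1)"
          using \<epsilon>(1) \<kappa>1 \<kappa> by (intro divide_left_mono) (auto simp: \<kappa>_def)
        finally show False by simp
      qed
      then show "z \<in> T" using T(2) z by blast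
    next
      note T(3)
      also have "ennreal (real ?m * (D ^ 3) ^ ?m * (C * (\<epsilon> / \<rho>) powr \<alpha>)) * emeasure M (ball x0 r0) =
          ennreal ((real ?m * (D ^ 3) ^ ?m * C * b) * (\<epsilon> / \<rho>) powr \<alpha>)"
        unfolding b using b0 D C by (simp add: ennreal_mult[symmetric] mult_ac)
      also have "\<dots> \<le> ennreal (\<kappa> * (\<epsilon> / \<rho>) powr \<alpha>)"
        by (intro ennreal_leI mult_right_mono) (auto simp: \<kappa>_def)
      finally show "emeasure M T \<le> ennreal (\<kappa> * (\<epsilon> / \<rho>) powr \<alpha>)" .
    qed
  qed
qed

text \<open>A point that is short for all large \<open>k\<close> lies in the liminf
  \<open>L i\<close> of the exceptional sets for \<open>\<epsilon> i\<close>. This is an increasing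
  union of sets under a common bound, and the bound tends to 0 with \<open>i\<close>.\<close>

lemma eventually_short_null:
  assumes y: "y \<in> affine hull (f ` (ball x0 r0 \<inter> S))" and e: "0 < e"
    and Q: "\<And>k. 0 < Q k" "\<And>k :: nat. \<not> has_short_vector (Q k) y e"
  shows "\<exists>T\<in>null_sets M. {z\<in>ball x0 r0 \<inter> S. \<forall>\<delta>>0. \<forall>\<^sub>F k in sequentially. has_short_vector (Q k) (f z) \<delta>} \<subseteq> T"
proof -
  obtain \<rho> \<kappa> where \<rho>\<kappa>: "0 < \<rho>" "0 < \<kappa>" and est: "\<And>Q \<epsilon>. \<lbrakk>0 < Q; \<not> has_short_vector Q y e; 0 < \<epsilon>; \<epsilon> \<le> \<rho>\<rbrakk> \<Longrightarrow>
      \<exists>T\<in>sets M. {z\<in>ball x0 r0 \<inter> S. has_short_vector Q (f z) (\<epsilon> / \<kappa>)} \<subseteq> T \<and>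
        emeasure M T \<le> ennreal (\<kappa> * (\<epsilon> / \<rho>) powr \<alpha>)"
    by (rule short_vectors_small_measure[OF y e]) (rule that)
  define \<epsilon> where "\<epsilon> i = \<rho> / real (Suc i)" for i
  have \<epsilon>: "0 < \<epsilon> i" "\<epsilon> i \<le> \<rho>" "\<epsilon> i / \<rho> = 1 / real (Suc i)" for i
    using \<rho>\<kappa> by (auto simp: \<epsilon>_def divide_le_eq)
  define cover where "cover i k T \<longleftrightarrow> T \<in> sets M \<and>
      {z\<in>ball x0 r0 \<inter> S. has_short_vector (Q k) (f z) (\<epsilon> i / \<kappa>)} \<subseteq> T \<and>
      emeasure M T \<le> ennreal (\<kappa> * (1 / real (Suc i)) powr \<alpha>)" for i k T
  have "\<exists>T. cover i k T" for i k
    using est[OF Q(1,2) \<epsilon>(1,2), of k i] unfolding \<epsilon>(3) cover_def by blast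
  then obtain T where "\<And>i k. cover i k (T i k)" by metis
  then have T: "T i k \<in> sets M"
    "{z\<in>ball x0 r0 \<inter> S. has_short_vector (Q k) (f z) (\<epsilon> i / \<kappa>)} \<subseteq> T i k"
    "emeasure M (T i k) \<le> ennreal (\<kappa> * (1 / real (Suc i)) powr \<alpha>)" for i k
    by (simp_all only: cover_def)
  define L where "L i = (\<Union>n. \<Inter>k\<in>{n..}. T i k)" for i
  have L_sets: "(\<Inter>k\<in>{n..}. T i k) \<in> sets M" "L i \<in> sets M" for i n
    using T(1) by (auto simp: L_def intro!: sets.countable_INT'' sets.countable_UN)
  have L_le: "emeasure M (L i) \<le> ennreal (\<kappa> * (1 / real (Suc i)) powr \<alpha>)" for i
  proof -
    have "(\<lambda>n. emeasure M (\<Inter>k\<in>{n..}. T i k)) \<longlonglongrightarrow> emeasure M (L i)"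
      unfolding L_def using L_sets by (intro Lim_emeasure_incseq) (auto simp: incseq_def)
    moreover have "emeasure M (\<Inter>k\<in>{n..}. T i k) \<le> ennreal (\<kappa> * (1 / real (Suc i)) powr \<alpha>)" for n
      by (rule order_trans[OF emeasure_mono T(3)[of i n]]) (use T(1) in auto)
    ultimately show ?thesis by (intro LIMSEQ_le_const2) auto
  qed
  have I_sets: "(\<Inter>i. L i) \<in> sets M" using L_sets by (intro sets.countable_INT) auto
  have "emeasure M (\<Inter>i. L i) \<le> ennreal (\<kappa> * (1 / real (Suc i)) powr \<alpha>)" for i
    by (rule order_trans[OF emeasure_mono L_le[of i]]) (use L_sets in auto)
  moreover have "(\<lambda>i. ennreal (\<kappa> * (1 / real (Suc i)) powr \<alpha>)) \<longlonglongrightarrow> ennreal (\<kappa> * 0 powr \<alpha>)"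
  proof (intro tendsto_ennrealI tendsto_mult tendsto_const tendsto_powr2)
    show "(\<lambda>i. 1 / real (Suc i)) \<longlonglongrightarrow> 0" using LIMSEQ_inverse_real_of_nat by (simp add: inverse_eq_divide)
  qed (use \<alpha> in auto)
  ultimately have "emeasure M (\<Inter>i. L i) \<le> ennreal (\<kappa> * 0 powr \<alpha>)"
    by (intro LIMSEQ_le_const) auto
  then have "(\<Inter>i. L i) \<in> null_sets M" using I_sets by (auto simp: null_sets_def)
  moreover have "{z\<in>ball x0 r0 \<inter> S. \<forall>\<delta>>0. \<forall>\<^sub>F k in sequentially. has_short_vector (Q k) (f z) \<delta>} \<subseteq> (\<Inter>i. L i)"
  proof (intro subsetI INT_I)
    fix z i assume z: "z \<in> {z\<in>ball x0 r0 \<inter> S. \<forall>\<delta>>0. \<forall>\<^sub>F k in sequentially. has_short_vector (Q k) (f z) \<delta>}"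
    have "0 < \<epsilon> i / \<kappa>" using \<epsilon>(1) \<rho>\<kappa> by simp
    then have "\<forall>\<^sub>F k in sequentially. has_short_vector (Q k) (f z) (\<epsilon> i / \<kappa>)" using z by blast
    then obtain n where "\<And>k. n \<le> k \<Longrightarrow> has_short_vector (Q k) (f z) (\<epsilon> i / \<kappa>)"
      by (auto simp: eventually_sequentially)
    then have "z \<in> T i k" if "n \<le> k" for k using T(2)[of k i] z that by blast
    then show "z \<in> L i" unfolding L_def by blast
  qed
  ultimately show ?thesis by blast
qed

end

section \<open>Lebesgue measure on affine subspaces\<close>

lemma affine_lebesgue_eq_distr:
  assumes "affine L" "L \<noteq> {}"
  obtains a E where "affine_frame L a E"
    "affine_lebesgue L = distr (\<Pi>\<^sub>M e\<in>E. lborel) borel (\<lambda>t. a + (\<Sum>e\<in>E. t e *\<^sub>R e))"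
proof -
  have "\<exists>p. case p of (a, E) \<Rightarrow> affine_frame L a E" using affine_frame_exists[OF assms] by auto
  then have "case SOME p. case p of (a, E) \<Rightarrow> affine_frame L a E of (a, E) \<Rightarrow> affine_frame L a E"
    by (rule someI_ex)
  then show thesis
    using that unfolding affine_lebesgue_def by (auto split: prod.splits)
qed

text \<open>Fixes one choice of frame behind \<open>affine_lebesgue\<close>. All estimates compare
  balls with cubes in its coordinates; \<open>E\<close> may be empty, when \<open>L\<close> is a
  point.\<close>

locale framed_affine =
  fixes L :: "'v::euclidean_space set" and a :: 'v and E :: "'v set" and \<mu> :: "'v measure"
  assumes frame: "affine_frame L a E"
    and \<mu>_eq: "\<mu> = distr (\<Pi>\<^sub>M e\<in>E. lborel) borel (\<lambda>t. a + (\<Sum>e\<in>E. t e *\<^sub>R e))"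
begin

definition "\<phi> t = a + (\<Sum>e\<in>E. t e *\<^sub>R e)"

lemma norm_E: "e \<in> E \<Longrightarrow> norm e = 1" and orth_E: "pairwise orthogonal E"
  and a_in: "a \<in> L" and span_E: "span E = (\<lambda>y. y - a) ` L"
  using frame by (auto simp: affine_frame_def)

lemma finite_E: "finite E"
proof -
  have "0 \<notin> E" using norm_E by force
  then have "independent E" using orth_E by (intro pairwise_orthogonal_independent)
  then show ?thesis by (rule independent_imp_finite)
qed

lemma inner_E: "e \<in> E \<Longrightarrow> e' \<in> E \<Longrightarrow> e \<bullet> e' = (if e = e' then 1 else 0)"
  using orth_E norm_E by (auto simp: pairwise_def orthogonal_def norm_eq_1)

lemma phi_in: "\<phi> t \<in> L"
proof -
  have "(\<Sum>e\<in>E. t e *\<^sub>R e) \<in> span E" by (intro span_sum span_scale span_base)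
  then obtain y where "y \<in> L" "(\<Sum>e\<in>E. t e *\<^sub>R e) = y - a" unfolding span_E by blast
  then show ?thesis by (simp add: \<phi>_def)
qed

lemma phi_inner: "e \<in> E \<Longrightarrow> (\<phi> t - a) \<bullet> e = t e"
proof -
  assume e: "e \<in> E"
  have "(\<phi> t - a) \<bullet> e = (\<Sum>e'\<in>E. if e' = e then t e' else 0)"
    unfolding \<phi>_def using e by (auto simp: inner_sum_left inner_E intro!: sum.cong)
  also have "\<dots> = t e" using e finite_E by simp
  finally show ?thesis .
qed

lemma phi_surj:
  assumes "x \<in> L"
  obtains s where "x = \<phi> s"
proof -
  have "x - a \<in> span E" using assms unfolding span_E by blast
  then obtain s where "x - a = (\<Sum>e\<in>E. s e *\<^sub>R e)"
    using finite_E by (auto simp: span_finite)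
  then show thesis using that[of s] by (simp add: \<phi>_def algebra_simps)
qed

lemma phi_measurable [measurable]: "\<phi> \<in> borel_measurable (\<Pi>\<^sub>M e\<in>E. lborel)"
  unfolding \<phi>_def by measurable

lemma emeasure_mu:
  "A \<in> sets borel \<Longrightarrow> emeasure \<mu> A = emeasure (\<Pi>\<^sub>M e\<in>E. lborel) (\<phi> -` A \<inter> space (\<Pi>\<^sub>M e\<in>E. lborel))"
  using phi_measurable unfolding \<mu>_eq \<phi>_def[abs_def] by (intro emeasure_distr)

lemma sets_mu: "sets \<mu> = sets borel" by (simp add: \<mu>_eq)

lemma coord_dist: "e \<in> E \<Longrightarrow> \<bar>t e - s e\<bar> \<le> dist (\<phi> s) (\<phi> t)"
proof -
  assume e: "e \<in> E"
  have "t e - s e = (\<phi> t - \<phi> s) \<bullet> e"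
    using phi_inner[OF e, of t] phi_inner[OF e, of s] by (simp add: inner_diff_left)
  then show ?thesis using Cauchy_Schwarz_ineq2[of "\<phi> t - \<phi> s" e] norm_E[OF e] by (simp add: dist_norm norm_minus_commute)
qed

lemma dist_phi_le: "dist (\<phi> s) (\<phi> t) \<le> (\<Sum>e\<in>E. \<bar>t e - s e\<bar>)"
proof -
  have "dist (\<phi> s) (\<phi> t) = norm (\<Sum>e\<in>E. (t e - s e) *\<^sub>R e)"
    unfolding dist_commute[of "\<phi> s"] unfolding dist_norm \<phi>_def
    by (simp add: scaleR_left_diff_distrib sum_subtractf)
  also have "\<dots> \<le> (\<Sum>e\<in>E. norm ((t e - s e) *\<^sub>R e))" by (rule norm_sum)
  also have "\<dots> = (\<Sum>e\<in>E. \<bar>t e - s e\<bar>)" using norm_E by (intro sum.cong) auto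
  finally show ?thesis .
qed

text \<open>The index set is arbitrary because the strip estimate integrates over \<open>E\<close>
  with one direction removed.\<close>

lemma emeasure_box:
  fixes I :: "'v set"
  assumes "finite I" "0 \<le> r"
  shows "emeasure (\<Pi>\<^sub>M e\<in>I. lborel) (\<Pi>\<^sub>E e\<in>I. {s e - r<..<s e + r}) = ennreal ((2 * r) ^ card I)"
proof -
  interpret product_sigma_finite "\<lambda>_ :: 'v. lborel :: real measure" ..
  have "emeasure (\<Pi>\<^sub>M e\<in>I. lborel) (\<Pi>\<^sub>E e\<in>I. {s e - r<..<s e + r}) = (\<Prod>e\<in>I. ennreal (2 * r))"
    using assms by (subst emeasure_PiM) auto
  also have "\<dots> = ennreal ((2 * r) ^ card I)" using assms by (simp add: ennreal_power)
  finally show ?thesis .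
qed

lemma emeasure_ball_le:
  assumes "x \<in> L" "0 < r"
  shows "emeasure \<mu> (ball x r) \<le> ennreal ((2 * r) ^ card E)"
proof -
  obtain s where s: "x = \<phi> s" using assms(1) by (rule phi_surj)
  have "\<phi> -` ball x r \<inter> space (\<Pi>\<^sub>M e\<in>E. lborel) \<subseteq> (\<Pi>\<^sub>E e\<in>E. {s e - r<..<s e + r})"
  proof
    fix t assume t: "t \<in> \<phi> -` ball x r \<inter> space (\<Pi>\<^sub>M e\<in>E. lborel)"
    then have "\<bar>t e - s e\<bar> < r" if "e \<in> E" for e using coord_dist[OF that, of t s] s by auto
    then show "t \<in> (\<Pi>\<^sub>E e\<in>E. {s e - r<..<s e + r})"
      using t by (auto simp: space_PiM PiE_iff abs_less_iff) (smt (verit))+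
  qed
  then have "emeasure \<mu> (ball x r) \<le> emeasure (\<Pi>\<^sub>M e\<in>E. lborel) (\<Pi>\<^sub>E e\<in>E. {s e - r<..<s e + r})"
    using finite_E by (subst emeasure_mu) (auto intro!: emeasure_mono sets_PiM_I_finite)
  also have "\<dots> = ennreal ((2 * r) ^ card E)" using finite_E assms(2) by (intro emeasure_box) auto
  finally show ?thesis .
qed

text \<open>A cube with half side \<open>r / (card E + 1)\<close> fits into the ball by the triangle
  inequality. The summand 1 makes the inclusion strict and keeps the denominator positive when
  \<open>L\<close> is a point.\<close>

lemma emeasure_ball_ge:
  assumes "x \<in> L" "0 < r"
  shows "ennreal ((2 * (r / (card E + 1))) ^ card E) \<le> emeasure \<mu> (ball x r)"
proof -
  obtain s where s: "x = \<phi> s" using assms(1) by (rule phi_surj)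
  let ?r = "r / (card E + 1)"
  have "(\<Pi>\<^sub>E e\<in>E. {s e - ?r<..<s e + ?r}) \<subseteq> \<phi> -` ball x r \<inter> space (\<Pi>\<^sub>M e\<in>E. lborel)"
  proof
    fix t assume t: "t \<in> (\<Pi>\<^sub>E e\<in>E. {s e - ?r<..<s e + ?r})"
    have "\<bar>t e - s e\<bar> \<le> ?r" if "e \<in> E" for e
    proof -
      have "t e \<in> {s e - ?r<..<s e + ?r}" using t that by blast
      then show ?thesis unfolding greaterThanLessThan_iff abs_le_iff by linarith
    qed
    then have "(\<Sum>e\<in>E. \<bar>t e - s e\<bar>) \<le> real (card E) * ?r" using sum_bounded_above[of E _ ?r] by simp
    also have "\<dots> < r" using assms(2) by (simp add: field_simps)
    finally have "dist x (\<phi> t) < r" using dist_phi_le[of s t] s by simp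
    then show "t \<in> \<phi> -` ball x r \<inter> space (\<Pi>\<^sub>M e\<in>E. lborel)" using t by (auto simp: space_PiM)
  qed
  then have "emeasure (\<Pi>\<^sub>M e\<in>E. lborel) (\<Pi>\<^sub>E e\<in>E. {s e - ?r<..<s e + ?r}) \<le> emeasure \<mu> (ball x r)"
    using measurable_sets[OF phi_measurable, of "ball x r"]
    by (subst emeasure_mu) (auto intro!: emeasure_mono)
  moreover have "emeasure (\<Pi>\<^sub>M e\<in>E. lborel) (\<Pi>\<^sub>E e\<in>E. {s e - ?r<..<s e + ?r}) = ennreal ((2 * ?r) ^ card E)"
    using finite_E assms(2) by (intro emeasure_box) auto
  ultimately show ?thesis by simp
qed

text \<open>Fubini in the direction \<open>e0\<close>: with the other coordinates fixed in a cube of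
  side 2r, the condition confines the last one to an interval of length
  \<open>2 * \<epsilon> / \<bar>c \<bullet> e0\<bar>\<close>.\<close>

lemma emeasure_strip_le:
  assumes x: "x \<in> L" and r: "0 < r" and \<epsilon>: "0 < \<epsilon>" and e0: "e0 \<in> E" "c \<bullet> e0 \<noteq> 0"
  shows "emeasure \<mu> {y\<in>ball x r. \<bar>c0 + c \<bullet> y\<bar> < \<epsilon>} \<le>
    ennreal ((2 * r) ^ (card E - 1) * (2 * \<epsilon> / \<bar>c \<bullet> e0\<bar>))"
proof -
  interpret product_sigma_finite "\<lambda>_ :: 'v. lborel :: real measure" ..
  obtain s where s: "x = \<phi> s" using x by (rule phi_surj)
  let ?Y = "{y\<in>ball x r. \<bar>c0 + c \<bullet> y\<bar> < \<epsilon>}"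
  define I where "I = E - {e0}"
  have E_eq: "E = insert e0 I" "e0 \<notin> I" "finite I" using e0 finite_E by (auto simp: I_def)
  define w where "w = c \<bullet> e0"
  define k where "k t = c0 + c \<bullet> a + (\<Sum>e\<in>I. t e * (c \<bullet> e))" for t
  define B where "B = (\<Pi>\<^sub>E e\<in>I. {s e - r<..<s e + r})"
  define J where "J t = {- k t / w - \<epsilon> / \<bar>w\<bar>..- k t / w + \<epsilon> / \<bar>w\<bar>}" for t
  have w: "w \<noteq> 0" using e0 by (simp add: w_def)
  have "open (ball x r \<inter> {y. \<bar>c0 + c \<bullet> y\<bar> < \<epsilon>})"
    by (intro open_Int open_ball open_Collect_less continuous_intros)
  moreover have "?Y = ball x r \<inter> {y. \<bar>c0 + c \<bullet> y\<bar> < \<epsilon>}" by blast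
  ultimately have Y: "?Y \<in> sets borel" by simp
  let ?A = "\<phi> -` ?Y \<inter> space (\<Pi>\<^sub>M e\<in>E. lborel)"
  have A: "?A \<in> sets (\<Pi>\<^sub>M e\<in>insert e0 I. lborel)"
    using measurable_sets[OF phi_measurable Y] unfolding E_eq(1)[symmetric] .
  have ind: "indicator ?A (t(e0 := y)) \<le> (indicator B t * indicator (J t) y :: ennreal)"
    if t: "t \<in> space (\<Pi>\<^sub>M e\<in>I. lborel)" for t y
  proof (cases "t(e0 := y) \<in> ?A")
    case True
    let ?t = "t(e0 := y)"
    have "\<bar>?t e - s e\<bar> < r" if "e \<in> E" for e using coord_dist[OF that, of ?t s] True s by auto
    then have "t e \<in> {s e - r<..<s e + r}" if "e \<in> I" for e
      using that E_eq(1,2) by (auto simp: abs_less_iff) (smt (verit) fun_upd_other insertI2)+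
    then have tB: "t \<in> B" using t by (auto simp: B_def space_PiM PiE_iff)
    have "c0 + c \<bullet> \<phi> ?t = k t + y * w"
    proof -
      have "c \<bullet> (\<Sum>e\<in>E. ?t e *\<^sub>R e) = (\<Sum>e\<in>insert e0 I. ?t e * (c \<bullet> e))"
        unfolding E_eq(1) by (simp add: inner_sum_right)
      also have "\<dots> = y * w + (\<Sum>e\<in>I. t e * (c \<bullet> e))"
        using E_eq(2,3) by (auto simp: w_def intro!: sum.cong)
      finally show ?thesis by (simp add: \<phi>_def k_def inner_add_right)
    qed
    then have "\<bar>k t + y * w\<bar> < \<epsilon>" using True by simp
    moreover have "k t + y * w = (y - (- k t / w)) * w" using w by (simp add: field_simps)
    ultimately have "\<bar>y - (- k t / w)\<bar> * \<bar>w\<bar> < \<epsilon>" by (simp only: abs_mult)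
    then have "\<bar>y - (- k t / w)\<bar> \<le> \<epsilon> / \<bar>w\<bar>" using w by (simp add: pos_le_divide_eq)
    then have "y \<in> J t" unfolding J_def atLeastAtMost_iff by linarith
    then show ?thesis using tB True by simp
  qed simp
  have "emeasure \<mu> ?Y = (\<integral>\<^sup>+t. indicator ?A t \<partial>(\<Pi>\<^sub>M e\<in>insert e0 I. lborel))"
    using A Y by (simp add: emeasure_mu E_eq(1)[symmetric])
  also have "\<dots> = (\<integral>\<^sup>+t. (\<integral>\<^sup>+y. indicator ?A (t(e0 := y)) \<partial>lborel) \<partial>(\<Pi>\<^sub>M e\<in>I. lborel))"
    using A E_eq by (intro product_nn_integral_insert) auto
  also have "\<dots> \<le> (\<integral>\<^sup>+t. (\<integral>\<^sup>+y. indicator B t * indicator (J t) y \<partial>lborel) \<partial>(\<Pi>\<^sub>M e\<in>I. lborel))"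
    using ind by (intro nn_integral_mono) auto
  also have "\<dots> = (\<integral>\<^sup>+t. ennreal (2 * \<epsilon> / \<bar>w\<bar>) * indicator B t \<partial>(\<Pi>\<^sub>M e\<in>I. lborel))"
  proof (intro nn_integral_cong)
    fix t
    have "(\<integral>\<^sup>+y. indicator B t * indicator (J t) y \<partial>lborel) = indicator B t * emeasure lborel (J t)"
      by (subst nn_integral_cmult) (auto simp: J_def)
    also have "emeasure lborel (J t) = ennreal (2 * \<epsilon> / \<bar>w\<bar>)"
      unfolding J_def using \<epsilon> by (subst emeasure_lborel_Icc) auto
    finally show "(\<integral>\<^sup>+y. indicator B t * indicator (J t) y \<partial>lborel) = ennreal (2 * \<epsilon> / \<bar>w\<bar>) * indicator B t"
      by (simp add: mult.commute)
  qed
  also have "\<dots> = ennreal (2 * \<epsilon> / \<bar>w\<bar>) * emeasure (\<Pi>\<^sub>M e\<in>I. lborel) B"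
    using E_eq(3) by (intro nn_integral_cmult_indicator) (auto simp: B_def intro!: sets_PiM_I_finite)
  also have "emeasure (\<Pi>\<^sub>M e\<in>I. lborel) B = ennreal ((2 * r) ^ card I)"
    unfolding B_def using E_eq(3) r by (intro emeasure_box) auto
  also have "card I = card E - 1" using e0 finite_E by (simp add: I_def)
  also have "ennreal (2 * \<epsilon> / \<bar>w\<bar>) * ennreal ((2 * r) ^ (card E - 1)) =
      ennreal ((2 * r) ^ (card E - 1) * (2 * \<epsilon> / \<bar>w\<bar>))"
    using \<epsilon> r by (simp add: ennreal_mult[symmetric] mult.commute)
  finally show ?thesis by (simp add: w_def)
qed

text \<open>Affine functions are good with exponent 1: if one is large at \<open>z\<close> and small
  somewhere else in the ball, its slope in some frame direction is large and the strip is
  thin.\<close>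

lemma good_affine:
  assumes x: "x \<in> L" "0 < r" and z: "z \<in> ball x r \<inter> L" and \<epsilon>: "0 < \<epsilon>" and nz: "c0 + c \<bullet> z \<noteq> 0"
  shows "emeasure \<mu> {y\<in>ball x r. \<bar>c0 + c \<bullet> y\<bar> < \<epsilon>} \<le>
    ennreal (4 * (real (card E) + 1) ^ (card E + 1) * (\<epsilon> / \<bar>c0 + c \<bullet> z\<bar>)) * emeasure \<mu> (ball x r)"
proof -
  let ?g = "\<lambda>y. c0 + c \<bullet> y" and ?d = "card E"
  let ?Y = "{y\<in>ball x r. \<bar>?g y\<bar> < \<epsilon>}" and ?K = "4 * (real ?d + 1) ^ (?d + 1) * (\<epsilon> / \<bar>?g z\<bar>)"
  have d1: "1 \<le> (real ?d + 1) ^ (?d + 1)" by (rule one_le_power) simp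
  have op: "open (ball x r \<inter> {y. \<bar>?g y\<bar> < \<epsilon>})"
    by (intro open_Int open_ball open_Collect_less continuous_intros)
  have Y_eq: "?Y = ball x r \<inter> {y. \<bar>?g y\<bar> < \<epsilon>}" by blast
  have Y: "?Y \<in> sets borel" unfolding Y_eq using op by (rule borel_open)
  \<comment> \<open>In the first case the factor is at least 1 and the bound is trivial; in the
    second the set misses \<open>L\<close> and is null.\<close>
  consider "\<bar>?g z\<bar> \<le> 2 * \<epsilon>" | "2 * \<epsilon> < \<bar>?g z\<bar>" "?Y \<inter> L = {}" | "2 * \<epsilon> < \<bar>?g z\<bar>" "?Y \<inter> L \<noteq> {}" by linarith
  then show ?thesis
  proof cases
    case 1
    have "1 / 2 \<le> \<epsilon> / \<bar>?g z\<bar>" using 1 nz by (simp add: field_simps)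
    then have "4 * 1 * (1 / 2) \<le> ?K" using d1 by (intro mult_mono) auto
    then have "ennreal 1 \<le> ennreal ?K" by (intro ennreal_leI) linarith
    then have "1 * emeasure \<mu> (ball x r) \<le> ennreal ?K * emeasure \<mu> (ball x r)"
      by (intro mult_right_mono) auto
    moreover have "emeasure \<mu> ?Y \<le> emeasure \<mu> (ball x r)" using sets_mu by (intro emeasure_mono) auto
    ultimately show ?thesis by simp
  next
    case 2
    then have "\<phi> -` ?Y \<inter> space (\<Pi>\<^sub>M e\<in>E. lborel) = {}" using phi_in by blast
    then have "emeasure \<mu> ?Y = 0" using emeasure_mu[OF Y] by simp
    then show ?thesis by simp
  next
    case 3
    then obtain y where y: "y \<in> L" "dist x y < r" "\<bar>?g y\<bar> < \<epsilon>" by auto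
    obtain s where s: "y = \<phi> s" using y(1) by (rule phi_surj)
    obtain t where t: "z = \<phi> t" using z phi_surj by blast
    define \<delta> where "\<delta> = \<bar>?g z\<bar>"
    have \<delta>: "0 < \<delta>" using nz by (simp add: \<delta>_def)
    have zy: "dist y z < 2 * r" using z y(2) dist_triangle[of y z x] by (simp add: dist_commute)
    have "?g z - ?g y = (\<Sum>e\<in>E. (t e - s e) * (c \<bullet> e))"
      unfolding s t \<phi>_def by (simp add: inner_add_right inner_sum_right left_diff_distrib sum_subtractf)
    also have "\<bar>\<dots>\<bar> \<le> (\<Sum>e\<in>E. 2 * r * \<bar>c \<bullet> e\<bar>)"
    proof (rule order_trans[OF sum_abs], rule sum_mono)
      fix e assume "e \<in> E"
      then have "\<bar>t e - s e\<bar> \<le> 2 * r" using coord_dist[of e t s] zy s t by simp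
      then show "\<bar>(t e - s e) * (c \<bullet> e)\<bar> \<le> 2 * r * \<bar>c \<bullet> e\<bar>" by (simp add: abs_mult mult_right_mono)
    qed
    finally have diff: "\<bar>?g z - ?g y\<bar> \<le> (\<Sum>e\<in>E. 2 * r * \<bar>c \<bullet> e\<bar>)" .
    \<comment> \<open>The values at \<open>z\<close> and \<open>y\<close> differ by more than
      \<delta>/2 while the coordinates differ by at most 2r, so the average slope over the frame
      exceeds \<delta>/(4dr), where d = \<open>card E\<close>.\<close>
    have "\<exists>e0\<in>E. \<delta> < 4 * real ?d * r * \<bar>c \<bullet> e0\<bar>"
    proof (rule ccontr)
      assume "\<not> ?thesis"
      then have le: "4 * real ?d * r * \<bar>c \<bullet> e\<bar> \<le> \<delta>" if "e \<in> E" for e using that by (simp add: not_less)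
      have "2 * real ?d * (\<Sum>e\<in>E. 2 * r * \<bar>c \<bullet> e\<bar>) = (\<Sum>e\<in>E. 4 * real ?d * r * \<bar>c \<bullet> e\<bar>)"
        unfolding sum_distrib_left by (intro sum.cong) auto
      also have "\<dots> \<le> real ?d * \<delta>" using sum_bounded_above[of E _ \<delta>] le by simp
      finally have "real ?d * (2 * (\<Sum>e\<in>E. 2 * r * \<bar>c \<bullet> e\<bar>)) \<le> real ?d * \<delta>" by simp
      then have "2 * (\<Sum>e\<in>E. 2 * r * \<bar>c \<bullet> e\<bar>) \<le> \<delta>"
        using \<delta> finite_E by (cases "E = {}") (auto simp: mult_le_cancel_left card_gt_0_iff)
      then show False using diff 3(1) y(3) unfolding \<delta>_def by linarith
    qed
    then obtain e0 where e0: "e0 \<in> E" and big: "\<delta> < 4 * real ?d * r * \<bar>c \<bullet> e0\<bar>" by blast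
    have ne: "c \<bullet> e0 \<noteq> 0" using big \<delta> by auto
    have d: "0 < ?d" using e0 finite_E by (auto simp: card_gt_0_iff)
    have "emeasure \<mu> ?Y \<le> ennreal ((2 * r) ^ (?d - 1) * (2 * \<epsilon> / \<bar>c \<bullet> e0\<bar>))"
      using x \<epsilon> e0 ne by (intro emeasure_strip_le) auto
    also have "\<dots> \<le> ennreal (?K * (2 * (r / (?d + 1))) ^ ?d)"
    proof (rule ennreal_leI)
      have "1 / \<bar>c \<bullet> e0\<bar> \<le> 4 * real ?d * r / \<delta>" using big \<delta> ne by (simp add: field_simps)
      then have "(2 * r) ^ (?d - 1) * (2 * \<epsilon>) * (1 / \<bar>c \<bullet> e0\<bar>) \<le> (2 * r) ^ (?d - 1) * (2 * \<epsilon>) * (4 * real ?d * r / \<delta>)"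
        using x(2) \<epsilon> by (intro mult_left_mono) auto
      also have "\<dots> = (2 * r) ^ (?d - 1) * (2 * r) * (4 * real ?d * (\<epsilon> / \<delta>))" by simp
      also have "(2 * r) ^ (?d - 1) * (2 * r) = (2 * r) ^ ?d" using d by (rule power_minus_mult)
      also have "(2 * r) ^ ?d = ((real ?d + 1) * (2 * (r / (?d + 1)))) ^ ?d"
        by (rule arg_cong[of _ _ "\<lambda>b. b ^ ?d"]) (simp add: field_simps)
      also have "\<dots> = (real ?d + 1) ^ ?d * (2 * (r / (?d + 1))) ^ ?d" by (rule power_mult_distrib)
      also have "(real ?d + 1) ^ ?d * (2 * (r / (?d + 1))) ^ ?d * (4 * real ?d * (\<epsilon> / \<delta>)) =
          real ?d * (4 * (real ?d + 1) ^ ?d * (\<epsilon> / \<delta>) * (2 * (r / (?d + 1))) ^ ?d)" by simp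
      also have "\<dots> \<le> (real ?d + 1) * (4 * (real ?d + 1) ^ ?d * (\<epsilon> / \<delta>) * (2 * (r / (?d + 1))) ^ ?d)"
        using \<epsilon> \<delta> x(2) by (intro mult_right_mono) auto
      finally show "(2 * r) ^ (?d - 1) * (2 * \<epsilon> / \<bar>c \<bullet> e0\<bar>) \<le> ?K * (2 * (r / (?d + 1))) ^ ?d"
        unfolding \<delta>_def by (simp add: mult_ac)
    qed
    also have "\<dots> = ennreal ?K * ennreal ((2 * (r / (?d + 1))) ^ ?d)"
      using \<epsilon> x(2) by (intro ennreal_mult) auto
    also have "\<dots> \<le> ennreal ?K * emeasure \<mu> (ball x r)"
      using emeasure_ball_ge[OF x] by (intro mult_left_mono) auto
    finally show ?thesis .
  qed
qed

lemma doubling: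
  assumes x: "x \<in> L" "0 < r"
  shows "emeasure \<mu> (ball x (3 * r)) \<le> ennreal ((3 * (real (card E) + 1)) ^ card E) * emeasure \<mu> (ball x r)"
proof -
  let ?d = "card E"
  have "emeasure \<mu> (ball x (3 * r)) \<le> ennreal ((2 * (3 * r)) ^ ?d)"
    using x by (intro emeasure_ball_le) auto
  also have "2 * (3 * r) = (3 * (real ?d + 1)) * (2 * (r / (?d + 1)))" by (simp add: field_simps)
  also have "\<dots> ^ ?d = (3 * (real ?d + 1)) ^ ?d * (2 * (r / (?d + 1))) ^ ?d" by (rule power_mult_distrib)
  also have "ennreal \<dots> = ennreal ((3 * (real ?d + 1)) ^ ?d) * ennreal ((2 * (r / (?d + 1))) ^ ?d)"
    using x(2) by (intro ennreal_mult) auto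
  also have "\<dots> \<le> ennreal ((3 * (real ?d + 1)) ^ ?d) * emeasure \<mu> (ball x r)"
    using emeasure_ball_ge[OF x] by (intro mult_left_mono) auto
  finally show ?thesis .
qed

lemma emeasure_ball_pos:
  assumes x: "x \<in> L" "0 < r"
  shows "0 < emeasure \<mu> (ball x r)"
proof -
  have "0 < ennreal ((2 * (r / (card E + 1))) ^ card E)" using x(2) by simp
  then show ?thesis using emeasure_ball_ge[OF x] by (rule less_le_trans)
qed

lemma closed_L: "closed L"
proof -
  have "L = (+) a ` span E" unfolding span_E by (auto simp: image_image)
  then show ?thesis by (metis closed_span closed_translation)
qed

lemma AE_in_L: "AE y in \<mu>. y \<in> L"
proof (rule AE_I[of _ _ "- L"])
  have "\<phi> -` (- L) \<inter> space (\<Pi>\<^sub>M e\<in>E. lborel) = {}" using phi_in by blast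
  moreover have L: "- L \<in> sets borel" using closed_L by (simp add: borel_closed)
  ultimately show "emeasure \<mu> (- L) = 0" using emeasure_mu[OF L] by simp
  show "- L \<in> sets \<mu>" using L sets_mu by simp
qed auto

end

text \<open>Balls around the origin of the frame with radii \<open>R k\<close> exhaust
  \<open>L\<close>, and each contains \<open>y\<close>, which therefore lies in the affine hull of
  the chart.\<close>

lemma affine_lebesgue_eventually_short_null:
  fixes L :: "(real ^ 'n::finite) set"
  assumes L: "affine L" and y: "y \<in> L" and e: "0 < e"
    and Q: "\<And>k. 0 < Q k" "\<And>k :: nat. \<not> has_short_vector (Q k) y e"
  shows "AE z in affine_lebesgue L. \<not> (\<forall>\<delta>>0. \<forall>\<^sub>F k in sequentially. has_short_vector (Q k) z \<delta>)"
proof -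
  have "L \<noteq> {}" using y by blast
  then obtain a E where aE: "affine_frame L a E"
    "affine_lebesgue L = distr (\<Pi>\<^sub>M e\<in>E. lborel) borel (\<lambda>t. a + (\<Sum>e\<in>E. t e *\<^sub>R e))"
    using affine_lebesgue_eq_distr[OF L] by blast
  interpret framed_affine L a E "affine_lebesgue L" using aE by unfold_locales
  let ?\<mu> = "affine_lebesgue L" and ?m = "CARD('n coord)"
  define R where "R k = dist y a + real k + 1" for k
  have R: "0 < R k" "dist y a < R k" for k
  proof -
    have "0 \<le> dist y a" by simp
    then show "0 < R k" "dist y a < R k" unfolding R_def by linarith+
  qed
  define D where "D = (3 * (real (card E) + 1)) ^ card E"
  define C where "C = 4 * (real (card E) + 1) ^ (card E + 1)"
  define N where "N k = {z\<in>ball a (R k) \<inter> L. \<forall>\<delta>>0. \<forall>\<^sub>F k in sequentially. has_short_vector (Q k) z \<delta>}" for k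
  have "\<exists>T\<in>null_sets ?\<mu>. N k \<subseteq> T" for k
  proof -
    interpret good_chart ?\<mu> L "ball a (5 ^ ?m * R k)" "\<lambda>z. z" D C 1 a "R k"
    proof
      show "emeasure ?\<mu> (ball a (5 ^ ?m * R k)) < \<infinity>"
        using emeasure_ball_le[OF a_in, of "5 ^ ?m * R k"] R(1)[of k] by (simp add: le_less_trans[OF _ ennreal_less_top])
      show "1 \<le> D" unfolding D_def by (rule one_le_power) simp
      show "0 \<le> C" by (simp add: C_def)
      show "emeasure ?\<mu> (ball x (3 * r)) \<le> ennreal D * emeasure ?\<mu> (ball x r)" if "x \<in> L" "0 < r" for x r
        unfolding D_def using that by (rule doubling)
      show "0 < emeasure ?\<mu> (ball x r)" if "x \<in> L" "0 < r" for x r using that by (rule emeasure_ball_pos)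
      show "emeasure ?\<mu> {y\<in>ball x r. \<bar>c0 + (\<Sum>i\<in>UNIV. c $ i * y $ i)\<bar> < \<epsilon>} \<le>
          ennreal (C * (\<epsilon> / \<bar>c0 + (\<Sum>i\<in>UNIV. c $ i * z $ i)\<bar>) powr 1) * emeasure ?\<mu> (ball x r)"
        if "x \<in> L" "0 < r" "z \<in> ball x r \<inter> L" "0 < \<epsilon>" "c0 + (\<Sum>i\<in>UNIV. c $ i * z $ i) \<noteq> 0"
        for c0 c x r z \<epsilon>
        using good_affine[of x r z \<epsilon> c0 c] that by (simp add: inner_vec_def C_def)
    qed (use sets_mu a_in R in auto)
    have "y \<in> affine hull ((\<lambda>z. z) ` (ball a (R k) \<inter> L))"
      using y R(2)[of k] by (intro hull_inc) (simp add: dist_commute)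
    then show ?thesis unfolding N_def using e Q by (rule eventually_short_null)
  qed
  then obtain T where T: "\<And>k. T k \<in> null_sets ?\<mu>" "\<And>k. N k \<subseteq> T k" by metis
  have "(\<Union>k. T k) \<in> null_sets ?\<mu>" using T(1) by (rule null_sets_UN)
  then have "AE z in ?\<mu>. z \<notin> (\<Union>k. T k)" by (rule AE_not_in)
  with AE_in_L show ?thesis
  proof eventually_elim
    case (elim z)
    obtain k where "dist a z < real k" using reals_Archimedean2 by blast
    then have "z \<in> ball a (R k)" using zero_le_dist[of y a] unfolding R_def mem_ball by linarith
    then show ?case using elim T(2)[of k] unfolding N_def by blast
  qed
qed

section \<open>The dichotomy\<close>

text \<open>The threshold is \<open>min c 1\<close>: the bound \<open>c\<close> gives the linear
  form, and the bound 1 gives the norm of \<open>q\<close> and excludes \<open>q = 0\<close>, since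
  \<open>Q k \<ge> 1\<close> and a nonzero integer has absolute value at least 1.\<close>

lemma nonsingular_imp_no_short_vectors:
  fixes y :: "real ^ 'n::finite"
  assumes "\<not> singular_vector y"
  obtains e Q where "0 < e" "\<And>k. 1 \<le> Q k" "filterlim Q at_top sequentially"
    "\<And>k :: nat. \<not> has_short_vector (Q k) y e"
proof -
  define approx where "approx c Q \<longleftrightarrow> (\<exists>(q :: int ^ 'n) (q0 :: int). q \<noteq> 0 \<and>
        \<bar>(\<chi> i. real_of_int (q $ i)) \<bullet> y + real_of_int q0\<bar> < c / Q ^ CARD('n) \<and>
        infnorm (\<chi> i. real_of_int (q $ i) :: real ^ 'n) \<le> Q)" for c Q
  obtain c where c: "0 < c" "\<not> (\<forall>\<^sub>F Q in at_top. approx c Q)"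
    using assms unfolding singular_vector_def approx_def by blast
  have "\<exists>Q. max 1 (real k) \<le> Q \<and> \<not> approx c Q" for k :: nat
    using c(2) unfolding eventually_at_top_linorder by blast
  then obtain Q where Q: "\<And>k :: nat. max 1 (real k) \<le> Q k" "\<And>k. \<not> approx c (Q k)" by metis
  have "filterlim Q at_top sequentially"
    by (rule filterlim_at_top_mono[OF filterlim_real_sequentially]) (use Q(1) in auto)
  moreover have "1 \<le> Q k" for k using Q(1)[of k] by simp
  moreover have "\<not> has_short_vector (Q k) y (min c 1)" for k
  proof
    assume "has_short_vector (Q k) y (min c 1)"
    then obtain v where v: "integral_vector v" "v \<noteq> 0" and short: "\<And>i. \<bar>flow (Q k) y v $ i\<bar> < min c 1"
      by (auto simp: has_short_vector_def)
    have Q1: "1 \<le> Q k" and Qn: "1 \<le> Q k ^ CARD('n)" using Q(1)[of k] by auto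
    have fl: "real_of_int \<lfloor>v $ i\<rfloor> = v $ i" for i using v(1) by (simp add: integral_vector_def)
    have c0: "Q k ^ CARD('n) * \<bar>v $ const_coord + (\<Sum>i\<in>UNIV. y $ i * v $ lin_coord i)\<bar> < min c 1"
      using short[of const_coord] Qn by (simp add: abs_mult)
    define q :: "int ^ 'n" where "q = (\<chi> i. \<lfloor>v $ lin_coord i\<rfloor>)"
    have q: "(\<chi> i. real_of_int (q $ i)) = (\<chi> i. v $ lin_coord i)" by (simp add: q_def fl)
    have "q \<noteq> 0"
    proof
      assume "q = 0"
      then have lin: "v $ lin_coord i = 0" for i using q by (simp add: vec_eq_iff)
      then have "v $ const_coord \<noteq> 0" using v(2) by (auto simp: vec_eq_iff all_coord_iff)
      then have "1 \<le> \<bar>v $ const_coord\<bar>" using v(1) by (simp add: integral_vector_def Ints_nonzero_abs_ge1)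
      then have "1 * 1 \<le> Q k ^ CARD('n) * \<bar>v $ const_coord\<bar>" using Qn by (intro mult_mono) auto
      then show False using c0 lin by simp
    qed
    moreover have "\<bar>(\<chi> i. real_of_int (q $ i)) \<bullet> y + real_of_int \<lfloor>v $ const_coord\<rfloor>\<bar> < c / Q k ^ CARD('n)"
    proof -
      have "(\<chi> i. real_of_int (q $ i)) \<bullet> y = (\<Sum>i\<in>UNIV. y $ i * v $ lin_coord i)"
        unfolding q by (simp add: inner_vec_def mult.commute)
      then show ?thesis using c0 Qn by (simp add: fl pos_less_divide_eq mult.commute add.commute)
    qed
    moreover have "infnorm (\<chi> i. real_of_int (q $ i) :: real ^ 'n) \<le> Q k"
      unfolding infnorm_cart
    proof (rule cSup_least)
      fix t assume "t \<in> {\<bar>(\<chi> i. real_of_int (q $ i) :: real ^ 'n) $ i\<bar> |i. i \<in> UNIV}"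
      then obtain i where t: "t = \<bar>v $ lin_coord i\<bar>" unfolding q by auto
      have "\<bar>v $ lin_coord i\<bar> / Q k < 1" using short[of "lin_coord i"] Q1 by simp
      then show "t \<le> Q k" using Q1 t by (simp add: divide_less_eq)
    qed auto
    ultimately show False using Q(2)[of k] unfolding approx_def by blast
  qed
  ultimately show thesis using that[of "min c 1" Q] c(1) by simp
qed

lemma singular_imp_short_vectors:
  fixes x :: "real ^ 'n::finite"
  assumes x: "singular_vector x" and Q: "filterlim Q at_top sequentially" "\<And>k. 0 < Q k" and \<delta>: "0 < \<delta>"
  shows "\<forall>\<^sub>F k in sequentially. has_short_vector (Q k) x \<delta>"
proof -
  \<comment> \<open>Singularity is used at \<open>\<delta> / 2 * Q k\<close>, which keeps the
    coordinates of \<open>q / Q k\<close> strictly below \<delta>; this \<open>c\<close> then turns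
    the bound on the linear form into \<open>\<delta> / Q k ^ CARD('n)\<close>.\<close>
  define c where "c = \<delta> * (\<delta> / 2) ^ CARD('n)"
  have "0 < c" using \<delta> by (simp add: c_def)
  have "filterlim (\<lambda>k. \<delta> / 2 * Q k) at_top sequentially"
    using Q(1) \<delta> by (intro filterlim_tendsto_pos_mult_at_top[OF tendsto_const]) auto
  with x[unfolded singular_vector_def, rule_format, OF \<open>0 < c\<close>]
  have "\<forall>\<^sub>F k in sequentially. \<exists>(q :: int ^ 'n) (q0 :: int). q \<noteq> 0 \<and>
        \<bar>(\<chi> i. real_of_int (q $ i)) \<bullet> x + real_of_int q0\<bar> < c / (\<delta> / 2 * Q k) ^ CARD('n) \<and>
        infnorm (\<chi> i. real_of_int (q $ i) :: real ^ 'n) \<le> \<delta> / 2 * Q k"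
    by (rule eventually_compose_filterlim)
  then show ?thesis
  proof eventually_elim
    case (elim k)
    then obtain q :: "int ^ 'n" and q0 :: int where q: "q \<noteq> 0"
      "\<bar>(\<chi> i. real_of_int (q $ i)) \<bullet> x + real_of_int q0\<bar> < c / (\<delta> / 2 * Q k) ^ CARD('n)"
      "infnorm (\<chi> i. real_of_int (q $ i) :: real ^ 'n) \<le> \<delta> / 2 * Q k" by blast
    define v :: "real ^ 'n coord" where
      "v = (\<chi> j. case Rep_coord j of None \<Rightarrow> real_of_int q0 | Some i \<Rightarrow> real_of_int (q $ i))"
    have v: "v $ const_coord = real_of_int q0" "v $ lin_coord i = real_of_int (q $ i)" for i
      by (simp_all add: v_def Abs_coord_inverse)
    have "\<forall>i. v $ i \<in> \<int>" unfolding all_coord_iff v by simp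
    moreover have "v \<noteq> 0" using q(1) by (auto simp: vec_eq_iff all_coord_iff v)
    moreover have "\<forall>i. \<bar>flow (Q k) x v $ i\<bar> < \<delta>"
      unfolding all_coord_iff
    proof (intro conjI allI)
      have "c / (\<delta> / 2 * Q k) ^ CARD('n) = \<delta> / Q k ^ CARD('n)"
        using \<delta> by (simp add: c_def power_mult_distrib field_simps)
      moreover have "(\<chi> i. real_of_int (q $ i)) \<bullet> x = (\<Sum>i\<in>UNIV. x $ i * v $ lin_coord i)"
        by (simp add: inner_vec_def v mult.commute)
      ultimately have "\<bar>v $ const_coord + (\<Sum>i\<in>UNIV. x $ i * v $ lin_coord i)\<bar> < \<delta> / Q k ^ CARD('n)"
        using q(2) by (simp add: v add.commute)
      then show "\<bar>flow (Q k) x v $ const_coord\<bar> < \<delta>"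
        using Q(2)[of k] by (simp add: abs_mult pos_less_divide_eq mult.commute)
      fix i
      have "\<bar>v $ lin_coord i\<bar> \<le> \<delta> / 2 * Q k"
        using component_le_infnorm_cart[of "\<chi> i. real_of_int (q $ i)" i] q(3) by (simp add: v)
      also have "\<dots> < \<delta> * Q k" using \<delta> Q(2)[of k] by simp
      finally show "\<bar>flow (Q k) x v $ lin_coord i\<bar> < \<delta>"
        using Q(2)[of k] by (simp add: divide_less_eq)
    qed
    ultimately show ?case unfolding has_short_vector_def integral_vector_def by blast
  qed
qed

section \<open>Measurability, and passage from local to global null sets\<close>

lemma open_has_short_vector:
  assumes f: "continuous_on UNIV f"
  shows "open {z. has_short_vector Q (f z) \<delta>}"
proof -
  have cont: "continuous_on UNIV (\<lambda>z. flow Q (f z) v $ i)" for v i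
  proof -
    have "\<forall>i. continuous_on UNIV (\<lambda>z. flow Q (f z) v $ i)"
      unfolding all_coord_iff flow_const flow_lin using f by (intro conjI allI continuous_intros)
    then show ?thesis by blast
  qed
  have "{z. has_short_vector Q (f z) \<delta>} =
      (\<Union>v\<in>{v. integral_vector v \<and> v \<noteq> 0}. \<Inter>i. {z. \<bar>flow Q (f z) v $ i\<bar> < \<delta>})"
    by (auto simp: has_short_vector_def)
  also have "open \<dots>"
    by (intro open_UN ballI open_INT finite open_Collect_less continuous_intros cont)
  finally show ?thesis .
qed

lemma borel_eventually_short:
  assumes f: "continuous_on UNIV f"
  shows "{z. \<forall>\<delta>>0. \<forall>\<^sub>F k in sequentially. has_short_vector (Q k) (f z) \<delta>} \<in> sets borel"
proof -
  have mono: "has_short_vector q x \<delta> \<Longrightarrow> \<delta> \<le> \<delta>' \<Longrightarrow> has_short_vector q x \<delta>'" for q x \<delta> \<delta>'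
    unfolding has_short_vector_def by (meson less_le_trans)
  have "{z. \<forall>\<delta>>0. \<forall>\<^sub>F k in sequentially. has_short_vector (Q k) (f z) \<delta>} =
      (\<Inter>i. \<Union>n. \<Inter>k\<in>{n..}. {z. has_short_vector (Q k) (f z) (1 / real (Suc i))})"
  proof (intro equalityI subsetI)
    fix z assume z: "z \<in> {z. \<forall>\<delta>>0. \<forall>\<^sub>F k in sequentially. has_short_vector (Q k) (f z) \<delta>}"
    then have "\<forall>\<^sub>F k in sequentially. has_short_vector (Q k) (f z) (1 / real (Suc i))" for i by simp
    then show "z \<in> (\<Inter>i. \<Union>n. \<Inter>k\<in>{n..}. {z. has_short_vector (Q k) (f z) (1 / real (Suc i))})"
      unfolding eventually_sequentially by (simp only: INT_iff UN_iff atLeast_iff mem_Collect_eq; blast)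
  next
    fix z assume z: "z \<in> (\<Inter>i. \<Union>n. \<Inter>k\<in>{n..}. {z. has_short_vector (Q k) (f z) (1 / real (Suc i))})"
    show "z \<in> {z. \<forall>\<delta>>0. \<forall>\<^sub>F k in sequentially. has_short_vector (Q k) (f z) \<delta>}"
    proof (intro CollectI allI impI)
      fix \<delta> :: real assume "0 < \<delta>"
      then obtain i where i: "1 / real (Suc i) < \<delta>" using nat_approx_posE by blast
      have "z \<in> (\<Union>n. \<Inter>k\<in>{n..}. {z. has_short_vector (Q k) (f z) (1 / real (Suc i))})"
        using z UNIV_I by (rule INT_D)
      then obtain n where "z \<in> (\<Inter>k\<in>{n..}. {z. has_short_vector (Q k) (f z) (1 / real (Suc i))})" by blast
      then have "\<forall>\<^sub>F k in sequentially. has_short_vector (Q k) (f z) (1 / real (Suc i))"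
        unfolding eventually_sequentially by (intro exI[of _ n]) simp
      then show "\<forall>\<^sub>F k in sequentially. has_short_vector (Q k) (f z) \<delta>"
        by (rule eventually_mono) (use mono i in fastforce)
    qed
  qed
  also have "\<dots> \<in> sets borel"
  proof (intro sets.countable_INT'' sets.countable_UN image_subsetI)
    show "{z. has_short_vector (Q k) (f z) (1 / real (Suc i))} \<in> sets borel" for i k
      using open_has_short_vector[OF f] by (rule borel_open)
  qed simp_all
  finally show ?thesis .
qed

text \<open>By inner regularity only compact subsets matter, and each of these is covered by
  finitely many of the open sets.\<close>

lemma radon_locally_null:
  assumes \<mu>: "radon_measure \<mu>" and N: "N \<in> sets borel"
  shows "emeasure \<mu> (N \<inter> \<Union>{B. open B \<and> emeasure \<mu> (B \<inter> N) = 0}) = 0"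
proof -
  let ?V = "\<Union>{B. open B \<and> emeasure \<mu> (B \<inter> N) = 0}"
  have sets_\<mu>: "sets \<mu> = sets borel" using \<mu> by (simp add: radon_measure_def)
  have "open ?V" by auto
  then have NV: "N \<inter> ?V \<in> sets \<mu>" using N sets_\<mu> by auto
  have "emeasure \<mu> K = 0" if K: "compact K" "K \<subseteq> N \<inter> ?V" for K
  proof -
    define \<O> where "\<O> = {B. open B \<and> emeasure \<mu> (B \<inter> N) = 0}"
    have sub: "K \<subseteq> \<Union>\<O>" using K(2) by (simp add: \<O>_def)
    have op: "open B" if "B \<in> \<O>" for B using that by (simp add: \<O>_def)
    obtain \<B> where \<B>: "\<B> \<subseteq> \<O>" "finite \<B>" "K \<subseteq> \<Union>\<B>" using compactE[OF K(1) sub op] by metis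
    have "B \<inter> N \<in> null_sets \<mu>" if "B \<in> \<B>" for B
    proof -
      have B: "B \<in> \<O>" using \<B>(1) that by blast
      then have "B \<inter> N \<in> sets \<mu>" using op N sets_\<mu> by simp
      then show ?thesis using B by (simp add: null_sets_def \<O>_def)
    qed
    then have null: "(\<Union>B\<in>\<B>. B \<inter> N) \<in> null_sets \<mu>" using \<B>(2) by (intro null_sets.finite_UN)
    have "K \<subseteq> (\<Union>B\<in>\<B>. B \<inter> N)" using \<B>(3) K(2) by blast
    then show ?thesis by (rule emeasure_eq_0[OF null_setsD2[OF null] null_setsD1[OF null]])
  qed
  then have "(SUP K\<in>{K. compact K \<and> K \<subseteq> N \<inter> ?V}. emeasure \<mu> K) \<le> 0"
    by (intro SUP_least) simp
  moreover have "emeasure \<mu> (N \<inter> ?V) = (SUP K\<in>{K. compact K \<and> K \<subseteq> N \<inter> ?V}. emeasure \<mu> K)"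
    using \<mu> NV unfolding radon_measure_def by (elim conjE) (rule bspec)
  ultimately show ?thesis by simp
qed

lemma AE_in_support:
  assumes \<mu>: "radon_measure \<mu>"
  shows "AE x in \<mu>. x \<in> measure_support \<mu>"
proof (rule AE_I[of _ _ "- measure_support \<mu>"])
  have eq: "- measure_support \<mu> = \<Union>{B. open B \<and> emeasure \<mu> (B \<inter> UNIV) = 0}"
    by (auto simp: measure_support_def)
  show "emeasure \<mu> (- measure_support \<mu>) = 0" using radon_locally_null[OF \<mu>, of UNIV] by (simp add: eq)
  have "open (- measure_support \<mu>)" unfolding eq by auto
  then show "- measure_support \<mu> \<in> sets \<mu>" using \<mu> by (simp add: radon_measure_def)
qed auto

text \<open>The value at \<open>z\<close> is below the supremum, so it only weakens the bound; being
  nonzero, it also excludes the infinite quotient.\<close>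

lemma good_function_on_witness:
  assumes g: "good_function_on C \<alpha> \<mu> U g" and C: "0 \<le> C" and \<alpha>: "0 < \<alpha>"
    and x: "x \<in> measure_support \<mu>" "0 < r" "ball x r \<subseteq> U" and z: "z \<in> ball x r \<inter> measure_support \<mu>"
    and \<epsilon>: "0 < \<epsilon>" and nz: "g z \<noteq> 0"
  shows "emeasure \<mu> {y\<in>ball x r. \<bar>g y\<bar> < \<epsilon>} \<le> ennreal (C * (\<epsilon> / \<bar>g z\<bar>) powr \<alpha>) * emeasure \<mu> (ball x r)"
proof -
  let ?s = "sup_norm_on \<mu> (ball x r) g"
  have "ennreal \<bar>g z\<bar> \<le> ?s" unfolding sup_norm_on_def using z by (rule SUP_upper)
  then have "inverse ?s \<le> inverse (ennreal \<bar>g z\<bar>)"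
    using nz by (cases ?s) (auto simp: inverse_ennreal le_imp_inverse_le)
  then have "ennreal \<epsilon> / ?s \<le> ennreal \<epsilon> / ennreal \<bar>g z\<bar>"
    unfolding divide_ennreal_def by (simp add: mult_left_mono)
  also have "\<dots> = ennreal (\<epsilon> / \<bar>g z\<bar>)" using \<epsilon> nz by (intro divide_ennreal) auto
  finally have le: "ennreal \<epsilon> / ?s \<le> ennreal (\<epsilon> / \<bar>g z\<bar>)" .
  have "ennreal_powr (ennreal \<epsilon> / ?s) \<alpha> \<le> ennreal ((\<epsilon> / \<bar>g z\<bar>) powr \<alpha>)"
  proof -
    have fin: "ennreal \<epsilon> / ?s \<noteq> \<infinity>" using le by (metis ennreal_neq_top infinity_ennreal_def top_unique)
    have "enn2real (ennreal \<epsilon> / ?s) \<le> \<epsilon> / \<bar>g z\<bar>" using le \<epsilon> by (intro enn2real_leI) auto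
    then have "enn2real (ennreal \<epsilon> / ?s) powr \<alpha> \<le> (\<epsilon> / \<bar>g z\<bar>) powr \<alpha>" using \<alpha> by (intro powr_mono2) auto
    then show ?thesis unfolding ennreal_powr_def using fin by (auto intro: ennreal_leI)
  qed
  then have "ennreal C * ennreal_powr (ennreal \<epsilon> / ?s) \<alpha> \<le> ennreal (C * (\<epsilon> / \<bar>g z\<bar>) powr \<alpha>)"
    using C by (simp add: ennreal_mult mult_left_mono)
  then have "ennreal C * ennreal_powr (ennreal \<epsilon> / ?s) \<alpha> * emeasure \<mu> (ball x r) \<le>
      ennreal (C * (\<epsilon> / \<bar>g z\<bar>) powr \<alpha>) * emeasure \<mu> (ball x r)" by (rule mult_right_mono) simp
  moreover have "emeasure \<mu> {y\<in>ball x r. \<bar>g y\<bar> < \<epsilon>} \<le>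
      ennreal C * ennreal_powr (ennreal \<epsilon> / ?s) \<alpha> * emeasure \<mu> (ball x r)"
    using g x \<epsilon> unfolding good_function_on_def by blast
  ultimately show ?thesis by (rule order_trans[rotated])
qed

text \<open>The ball has positive measure because its centre is in the support; together with
  finiteness this lets the quotient in \<open>ennreal\<close> be multiplied back.\<close>

lemma federer_on_doubling:
  assumes fed: "federer_on D \<mu> U" and x: "x \<in> measure_support \<mu>" "0 < r" "ball x (3 * r) \<subseteq> U"
    and fin: "emeasure \<mu> (ball x r) < \<infinity>"
  shows "emeasure \<mu> (ball x (3 * r)) \<le> ennreal D * emeasure \<mu> (ball x r)"
proof -
  let ?a = "emeasure \<mu> (ball x (3 * r))" and ?b = "emeasure \<mu> (ball x r)"
  have "0 < ?b" using x(1,2) by (simp add: measure_support_def)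
  then have b: "?b \<noteq> 0" "?b \<noteq> top" using fin by auto
  have "?a / ?b \<le> Sup {emeasure \<mu> (ball x (3 * r)) / emeasure \<mu> (ball x r) | x r.
           x \<in> measure_support \<mu> \<and> 0 < r \<and> ball x (3 * r) \<subseteq> U}"
    using x by (intro Sup_upper) blast
  also have "\<dots> \<le> ennreal D" using fed unfolding federer_on_def by (intro less_imp_le) blast
  finally have "?a / ?b * ?b \<le> ennreal D * ?b" by (rule mult_right_mono) simp
  also have "?a / ?b * ?b = ?a * ?b / ?b" by (simp add: ennreal_divide_times ennreal_times_divide)
  also have "\<dots> = ?a" using b by (rule ennreal_mult_divide_eq)
  finally show ?thesis .
qed

lemma good_nonplanar_locally_null:
  fixes \<mu> :: "'a::metric_space measure" and f :: "'a \<Rightarrow> real ^ 'n::finite"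
  assumes \<mu>: "radon_measure \<mu>" and x: "x \<in> measure_support \<mu>" "x \<in> U1" "federer_on D \<mu> U1"
    and gp: "0 < C" "0 < \<alpha>" "good_pair_at C \<alpha> f \<mu> x" and f: "continuous_on UNIV f"
    and L: "nonplanar_in f \<mu> L" "y \<in> L" and e: "0 < e"
    and Q: "\<And>k. 0 < Q k" "\<And>k :: nat. \<not> has_short_vector (Q k) y e"
  shows "\<exists>r>0. \<exists>T\<in>null_sets \<mu>. {z\<in>ball x r \<inter> measure_support \<mu>.
    \<forall>\<delta>>0. \<forall>\<^sub>F k in sequentially. has_short_vector (Q k) (f z) \<delta>} \<subseteq> T"
proof -
  let ?m = "CARD('n coord)" and ?S = "measure_support \<mu>"
  have sets_\<mu>: "sets \<mu> = sets borel" using \<mu> by (simp add: radon_measure_def)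
  obtain U2 where U2: "open U2" "x \<in> U2"
    and gf: "\<And>c0 (c :: real ^ 'n). good_function_on C \<alpha> \<mu> U2 (\<lambda>y. c0 + (\<Sum>i\<in>UNIV. c $ i * f y $ i))"
    using gp(3) unfolding good_pair_at_def by blast
  obtain U3 where U3: "open U3" "x \<in> U3" "emeasure \<mu> U3 < \<infinity>"
    using \<mu> unfolding radon_measure_def by blast
  have "open (U1 \<inter> U2 \<inter> U3)" using x(3) U2 U3 by (auto simp: federer_on_def)
  moreover have "x \<in> U1 \<inter> U2 \<inter> U3" using x U2 U3 by blast
  ultimately obtain R where R: "0 < R" "ball x R \<subseteq> U1 \<inter> U2 \<inter> U3" by (meson open_contains_ball)
  \<comment> \<open>On \<open>ball x R\<close> doubling, goodness and finiteness of the measure hold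
    together; \<open>r\<close> is chosen so that the enlarged chart is exactly this ball.\<close>
  define r where "r = R / 5 ^ ?m"
  have r: "0 < r" "5 ^ ?m * r = R" using R(1) by (auto simp: r_def)
  have fin: "emeasure \<mu> (ball x' r') < \<infinity>" if "ball x' r' \<subseteq> ball x R" for x' r'
  proof -
    have "emeasure \<mu> (ball x' r') \<le> emeasure \<mu> U3" using that R(2) U3(1) sets_\<mu> by (intro emeasure_mono) auto
    then show ?thesis using U3(3) by (rule le_less_trans)
  qed
  have pos: "0 < emeasure \<mu> (ball x' r')" if "x' \<in> ?S" "0 < r'" for x' r'
    using that by (auto simp: measure_support_def)
  interpret good_chart \<mu> ?S "ball x R" f "max 1 D" C \<alpha> x r
  proof
    show "emeasure \<mu> (ball x' (3 * r')) \<le> ennreal (max 1 D) * emeasure \<mu> (ball x' r')"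
      if that: "x' \<in> ?S" "0 < r'" "ball x' (3 * r') \<subseteq> ball x R" for x' r'
    proof -
      have "ball x' r' \<subseteq> ball x' (3 * r')" using that(2) by (intro subset_ball) simp
      then have "emeasure \<mu> (ball x' (3 * r')) \<le> ennreal D * emeasure \<mu> (ball x' r')"
        using that R(2) by (intro federer_on_doubling[OF x(3)] fin) auto
      also have "\<dots> \<le> ennreal (max 1 D) * emeasure \<mu> (ball x' r')"
        by (intro mult_right_mono ennreal_leI) auto
      finally show ?thesis .
    qed
    show "emeasure \<mu> {y\<in>ball x' r'. \<bar>c0 + (\<Sum>i\<in>UNIV. c $ i * f y $ i)\<bar> < \<epsilon>} \<le>
        ennreal (C * (\<epsilon> / \<bar>c0 + (\<Sum>i\<in>UNIV. c $ i * f z $ i)\<bar>) powr \<alpha>) * emeasure \<mu> (ball x' r')"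
      if "x' \<in> ?S" "0 < r'" "ball x' r' \<subseteq> ball x R" "z \<in> ball x' r' \<inter> ?S" "0 < \<epsilon>"
        "c0 + (\<Sum>i\<in>UNIV. c $ i * f z $ i) \<noteq> 0" for c0 c x' r' z \<epsilon>
      using that gp R(2) by (intro good_function_on_witness[OF gf[of c0 c]]) auto
  qed (use sets_\<mu> gp f x(1) r fin pos in auto)
  have "y \<in> affine hull (f ` (ball x r \<inter> ?S))"
    using L pos[OF x(1) r(1)] unfolding nonplanar_in_def by blast
  then show ?thesis using e Q r(1) by (intro exI[of _ r] conjI eventually_short_null)
qed

lemma good_nonplanar_eventually_short_null:
  fixes \<mu> :: "'a::metric_space measure" and f :: "'a \<Rightarrow> real ^ 'n::finite"
  assumes \<mu>: "federer_measure \<mu>" and gp: "good_pair f \<mu>" and f: "continuous_on UNIV f"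
    and L: "nonplanar_in f \<mu> L" "y \<in> L" and e: "0 < e"
    and Q: "\<And>k. 0 < Q k" "\<And>k :: nat. \<not> has_short_vector (Q k) y e"
  shows "AE z in \<mu>. \<not> (\<forall>\<delta>>0. \<forall>\<^sub>F k in sequentially. has_short_vector (Q k) (f z) \<delta>)"
proof -
  define N where "N = {z. \<forall>\<delta>>0. \<forall>\<^sub>F k in sequentially. has_short_vector (Q k) (f z) \<delta>}"
  have radon: "radon_measure \<mu>" using \<mu> by (simp add: federer_measure_def)
  have sets_\<mu>: "sets \<mu> = sets borel" using radon by (simp add: radon_measure_def)
  have N: "N \<in> sets borel" unfolding N_def using f by (rule borel_eventually_short)
  let ?V = "\<Union>{B. open B \<and> emeasure \<mu> (B \<inter> N) = 0}"
  have supp: "AE x in \<mu>. x \<in> measure_support \<mu>" using radon by (rule AE_in_support)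
  have fed: "AE x in \<mu>. \<exists>U D. x \<in> U \<and> 0 < D \<and> federer_on D \<mu> U" using \<mu> by (simp add: federer_measure_def)
  have good: "AE x in \<mu>. \<exists>C>0. \<exists>\<alpha>>0. good_pair_at C \<alpha> f \<mu> x" using gp by (simp add: good_pair_def)
  have "AE x in \<mu>. x \<in> ?V"
    using supp fed good
  proof eventually_elim
    case (elim x)
    then obtain U D C \<alpha> where U: "x \<in> U" "federer_on D \<mu> U" and C: "0 < C" "0 < \<alpha>" "good_pair_at C \<alpha> f \<mu> x" by blast
    have eq: "{z\<in>ball x r \<inter> measure_support \<mu>. \<forall>\<delta>>0. \<forall>\<^sub>F k in sequentially. has_short_vector (Q k) (f z) \<delta>} =
        ball x r \<inter> measure_support \<mu> \<inter> N" for r by (auto simp: N_def)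
    obtain r T where r: "0 < r" and T: "T \<in> null_sets \<mu>" "ball x r \<inter> measure_support \<mu> \<inter> N \<subseteq> T"
      using good_nonplanar_locally_null[where Q = Q, OF radon elim(1) U C f L e Q] unfolding eq by blast
    \<comment> \<open>The null set \<open>T\<close> covers only the points of the support, so almost
      every point being in the support is used once more.\<close>
    have "AE z in \<mu>. z \<notin> ball x r \<inter> N"
      using supp AE_not_in[OF T(1)]
    proof eventually_elim
      case (elim z)
      then show ?case using T(2) by blast
    qed
    then have "emeasure \<mu> (ball x r \<inter> N) = 0"
      using N sets_\<mu> by (subst (asm) AE_iff_measurable[of "ball x r \<inter> N"])
        (auto simp: sets_eq_imp_space_eq[OF sets_\<mu>])
    then show ?case using r by (intro UnionI[of "ball x r"]) auto
  qed
  moreover have "N \<inter> ?V \<in> null_sets \<mu>"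
  proof -
    have "open ?V" by auto
    then have "N \<inter> ?V \<in> sets \<mu>" using N sets_\<mu> by auto
    then show ?thesis using radon_locally_null[OF radon N] by (simp add: null_sets_def)
  qed
  then have "AE z in \<mu>. z \<notin> N \<inter> ?V" by (rule AE_not_in)
  ultimately have "AE z in \<mu>. z \<notin> N" by eventually_elim blast
  then show ?thesis by (simp add: N_def)
qed

theorem theorem1p8:
  fixes \<mu> :: "'a::metric_space measure"
    and L :: "(real ^ 'n) set"
    and f :: "'a \<Rightarrow> real ^ 'n"
  assumes "besicovitch_space TYPE('a)"
    and "federer_measure \<mu>"
    and "emeasure \<mu> UNIV \<noteq> 0"
    and "affine L"
    and "range f \<subseteq> L"
    and "continuous_on UNIV f"
    and "good_pair f \<mu>"
    and "nonplanar_in f \<mu> L"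
  shows "((\<exists>x\<in>measure_support \<mu>. \<not> singular_vector (f x)) \<longleftrightarrow>
            (\<exists>y\<in>L. \<not> singular_vector y)) \<and>
         ((\<exists>y\<in>L. \<not> singular_vector y) \<longleftrightarrow>
            (AE y in affine_lebesgue L. \<not> singular_vector y)) \<and>
         ((AE y in affine_lebesgue L. \<not> singular_vector y) \<longleftrightarrow>
            (AE x in \<mu>. \<not> singular_vector (f x)))"
proof -
  have radon: "radon_measure \<mu>" using assms(2) by (simp add: federer_measure_def)
  have space_\<mu>: "space \<mu> = UNIV"
    using radon sets_eq_imp_space_eq[of \<mu> borel] by (simp add: radon_measure_def)
  \<comment> \<open>The hub of the equivalences: the sequence obtained from one \<open>y\<close> is
    fed to both measures.\<close>
  have all: "(AE y in affine_lebesgue L. \<not> singular_vector y) \<and> (AE x in \<mu>. \<not> singular_vector (f x))"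
    if ex: "\<exists>y\<in>L. \<not> singular_vector y"
  proof -
    obtain y where y: "y \<in> L" "\<not> singular_vector y" using ex by blast
    obtain e Q where e: "0 < e" and Q: "\<And>k. 1 \<le> Q k" "filterlim Q at_top sequentially"
      and long: "\<And>k :: nat. \<not> has_short_vector (Q k) y e"
      using nonsingular_imp_no_short_vectors[OF y(2)] by blast
    have Q0: "0 < Q k" for k using Q(1)[of k] by linarith
    have sing: "\<forall>\<delta>>0. \<forall>\<^sub>F k in sequentially. has_short_vector (Q k) x \<delta>" if "singular_vector x" for x :: "real ^ 'n"
      using singular_imp_short_vectors[OF that Q(2) Q0] by blast
    have "AE z in affine_lebesgue L. \<not> singular_vector z"
      by (rule eventually_mono[OF affine_lebesgue_eventually_short_null[where Q = Q, OF assms(4) y(1) e Q0 long]])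
        (use sing in blast)
    moreover have "AE x in \<mu>. \<not> singular_vector (f x)"
      by (rule eventually_mono[OF good_nonplanar_eventually_short_null[where Q = Q, OF assms(2,7,6,8) y(1) e Q0 long]])
        (use sing in blast)
    ultimately show ?thesis by blast
  qed
  \<comment> \<open>Almost every point is in the support and \<mu> is not zero, so an almost sure
    property holds somewhere on the support.\<close>
  have mu: "\<exists>x\<in>measure_support \<mu>. \<not> singular_vector (f x)" if AE: "AE x in \<mu>. \<not> singular_vector (f x)"
  proof (rule ccontr)
    assume "\<not> ?thesis"
    then have "AE x in \<mu>. False" using AE AE_in_support[OF radon] by (auto elim: eventually_elim2)
    moreover have "UNIV \<in> sets \<mu>" using sets.top[of \<mu>] space_\<mu> by simp
    ultimately have "emeasure \<mu> UNIV = 0"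
      using AE_iff_measurable[of UNIV \<mu> "\<lambda>_. False"] space_\<mu> by simp
    then show False using assms(3) by simp
  qed
  have leb: "\<exists>y\<in>L. \<not> singular_vector y" if AE: "AE y in affine_lebesgue L. \<not> singular_vector y"
  proof (rule ccontr)
    assume no: "\<not> ?thesis"
    have "L \<noteq> {}" using assms(5) by blast
    then obtain a E where aE: "affine_frame L a E"
      "affine_lebesgue L = distr (\<Pi>\<^sub>M e\<in>E. lborel) borel (\<lambda>t. a + (\<Sum>e\<in>E. t e *\<^sub>R e))"
      using affine_lebesgue_eq_distr[OF assms(4)] by blast
    interpret framed_affine L a E "affine_lebesgue L" using aE by unfold_locales
    \<comment> \<open>If every point of \<open>L\<close> were singular, the almost sure property
      would make the whole measure vanish; a ball about \<open>a\<close> has positive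
      measure.\<close>
    have "AE y in affine_lebesgue L. y \<notin> ball a 1" using AE AE_in_L no by (auto elim: eventually_elim2)
    then have "emeasure (affine_lebesgue L) (ball a 1) = 0"
      using sets_mu by (subst (asm) AE_iff_measurable[of "ball a 1"]) (auto simp: sets_eq_imp_space_eq[OF sets_mu])
    then show False using emeasure_ball_pos[OF a_in, of 1] by simp
  qed
  have supp: "\<exists>y\<in>L. \<not> singular_vector y" if "\<exists>x\<in>measure_support \<mu>. \<not> singular_vector (f x)"
    using that assms(5) by blast
  show ?thesis using all mu leb supp by blast
qed

end
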